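(* Let $d\ge3$, $q>0$, and let $Q$ be the external field on $\mathbb{S}^{d-1}$ given by $Q(x)=q\,(1-x_1)^{-(d-2)/2}$, $x=(x_1,\dots,x_d)\in\mathbb{S}^{d-1}$. Then the support $S_Q$ of the extremal measure $\mu_Q$ is a spherical cap $C_{S,\alpha}$ centered at the South Pole, with $\alpha=\alpha_0\in(0,\pi)$, where the angle $\alpha_0$ is defined as the unique solution in $(0,\pi)$ of the equation $$\csc^{d-1}\Big(\frac\alpha2\Big)\,\mathrm{B}\Big(\cos^2\Big(\frac\alpha2\Big);\frac{d-2}{2},\frac d2\Big)-\mathrm{B}\Big(\cos^2\Big(\frac\alpha2\Big);\frac{d-2}{2},\frac12\Big)=\frac{\sqrt\pi\,\Gamma(d/2-1)}{q\,2^{(d-2)/2}\,\Gamma((d-1)/2)}.$$ Let $$C_Q=\frac{\Gamma(d/2-1)}{2^{d-1}\pi^{d/2}}\Big(\mathrm{B}\Big(\cos^2\Big(\frac{\alpha_0}{2}\Big);\frac{d-2}{2},\frac d2\Big)\Big)^{-1}\Big\{1+\frac{q\,2^{(d-2)/2}\,\Gamma((d-1)/2)}{\sqrt\pi\,\Gamma(d/2-1)}\,\mathrm{B}\Big(\cos^2\Big(\frac{\alpha_0}{2}\Big);\frac{d-2}{2},\frac12\Big)\Big\}.$$ The density $f$ of the equilibrium measure $\mu_Q$ (that is, $d\mu_Q=f\,d\sigma_d$ with $f$ a function of the polar angle $\eta$) is given by $$f(\eta)=C_Q\Big(\frac{1-\cos\alpha_0}{1-\cos\eta}\Big)^{(d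-1)/2}\sqrt{\frac{1-\cos\alpha_0}{\cos\alpha_0-\cos\eta}}\;{}_2F_1\Big(1,\frac{d-1}{2};\frac12;\frac{\cos\alpha_0-\cos\eta}{1-\cos\eta}\Big)-\frac{q\,\Gamma((d-1)/2)}{\sqrt2\,\pi^{(d+1)/2}}\,\frac{1}{(1-\cos\eta)^{(d-1)/2}}\sqrt{\frac{1-\cos\alpha_0}{\cos\alpha_0-\cos\eta}},\qquad\alpha_0\le\eta\le\pi.$$
   Context: $\mathbb{S}^{d-1}=\{x\in\mathbb{R}^d:|x|=1\}$, $d\ge3$, with Lebesgue surface measure $\sigma_d$. For $x=(x_1,\dots,x_d)\in\mathbb{S}^{d-1}$ the polar angle $\eta\in[0,\pi]$ is defined by $x_1=\cos\eta$; the South Pole is $(-1,0,\dots,0)$. $C_{S,\alpha}$ is the set of points of $\mathbb{S}^{d-1}$ with polar angle in $[\alpha,\pi]$. For a unit positive Borel measure $\mu$ on $\mathbb{S}^{d-1}$ put $$I(\mu)=\iint\frac{1}{|x-y|^{d-2}}\,d\mu(x)\,d\mu(y),\qquad I_Q(\mu)=I(\mu)+2\int Q\,d\mu,$$ and $V_Q=\inf\{I_Q(\mu)\}$ over all unit positive Borel measures $\mu$ on $\mathbb{S}^{d-1}$. The extremal (or equilibrium) measure $\mu_Q$ is the unit positive Borel measure on $\mathbb{S}^{d-1}$ with $I_Q(\mu_Q)=V_Q$, and $S_Q=\operatorname{supp}\mu_Q$. (Here $Q=+\infty$ at the North Pole $(1,0,\dots,0)$.) Incomplete Beta function: $\mathrm{B}(z;a,b)=\int_0^z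 t^{a-1}(1-t)^{b-1}\,dt$. Gauss hypergeometric function: ${}_2F_1(a,b;c;z)=\sum_{n\ge0}\frac{(a)_n(b)_n}{(c)_n}\frac{z^n}{n!}$ for $|z|<1$, with $(a)_0=1$, $(a)_n=a(a+1)\cdots(a+n-1)$. As usual, formulas for densities are understood almost everywhere. *)

theory Defs
  imports "HOL-Probability.Probability"
begin

section \<open>The sphere and its surface measure\<close>

text \<open>The sphere \<open>S\<^sup>d\<^sup>-\<^sup>1\<close> lives in \<open>real ^ 'n\<close> with \<open>CARD('n) = d\<close>. The index \<open>k :: 'n\<close> below
  plays the role of the first coordinate; the poles are \<open>axis k 1\<close> (North) and
  \<open>- axis k 1\<close> (South).\<close>

abbreviation unit_sphere :: "(real ^ 'n) set"
  where "unit_sphere \<equiv> sphere 0 1"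

definition sphere_borel :: "(real ^ 'n) measure"
  where "sphere_borel = restrict_space borel unit_sphere"

text \<open>Surface measure in polar coordinates: the surface measure of \<open>A\<close> is \<open>d\<close> times the volume of
  the cone \<open>{r a | 0 < r < 1, a \<in> A}\<close>.\<close>

definition surface_measure :: "(real ^ 'n) measure"
  where "surface_measure =
    scale_measure (of_nat CARD('n))
      (distr (restrict_space lborel (ball 0 1 - {0})) sphere_borel (\<lambda>x. x /\<^sub>R norm x))"

definition polar_angle :: "'n \<Rightarrow> real ^ 'n \<Rightarrow> real"
  where "polar_angle k x = arccos (x $ k)"

definition south_cap :: "'n \<Rightarrow> real \<Rightarrow> (real ^ 'n) set"
  where "south_cap k \<alpha> = {x \<in> unit_sphere. polar_angle k x \<in> {\<alpha>..pi}}"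

lemma space_sphere_borel: "space sphere_borel = unit_sphere"
  by (simp add: sphere_borel_def space_restrict_space)

lemma measurable_radial_projection:
  "(\<lambda>x::real ^ 'n. x /\<^sub>R norm x) \<in>
     measurable (restrict_space lborel (ball 0 1 - {0})) sphere_borel"
  unfolding sphere_borel_def
  by (rule measurable_restrict_space2)
     (auto simp: space_restrict_space intro!: measurable_restrict_space1)

lemma emeasure_surface_measure:
  fixes A :: "(real ^ 'n) set"
  assumes "A \<in> sets sphere_borel"
  shows "emeasure surface_measure A =
    of_nat CARD('n) * emeasure lborel {x \<in> ball 0 1 - {0}. x /\<^sub>R norm x \<in> A}"
proof -
  let ?B = "{x \<in> ball 0 1 - {0}. x /\<^sub>R norm x \<in> A}"
  have "(\<lambda>x. x /\<^sub>R norm x) -` A \<inter> (ball 0 1 - {0}) = ?B"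
    by auto
  moreover have "emeasure (restrict_space lborel (ball 0 1 - {0})) ?B = emeasure lborel ?B"
    by (rule emeasure_restrict_space) auto
  ultimately show ?thesis
    using assms
    by (simp add: surface_measure_def emeasure_distr[OF measurable_radial_projection]
        space_restrict_space del: mem_ball_0)
qed

section \<open>Weighted energy and the extremal measure\<close>

text \<open>Energies take values in \<^typ>\<open>ennreal\<close>; the division there satisfies \<open>1 / 0 = \<infinity>\<close>, which gives
  the kernel its value on the diagonal.\<close>

definition riesz_kernel :: "real ^ 'n \<Rightarrow> real ^ 'n \<Rightarrow> ennreal"
  where "riesz_kernel x y = 1 / ennreal (norm (x - y) ^ (CARD('n) - 2))"

definition riesz_energy :: "(real ^ 'n) measure \<Rightarrow> ennreal"
  where "riesz_energy \<mu> = (\<integral>\<^sup>+ x. (\<integral>\<^sup>+ y. riesz_kernel x y \<partial>\<mu>) \<partial>\<mu>)"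

definition weighted_energy :: "(real ^ 'n \<Rightarrow> ennreal) \<Rightarrow> (real ^ 'n) measure \<Rightarrow> ennreal"
  where "weighted_energy Q \<mu> = riesz_energy \<mu> + 2 * (\<integral>\<^sup>+ x. Q x \<partial>\<mu>)"

definition unit_sphere_measures :: "(real ^ 'n) measure set"
  where "unit_sphere_measures = {\<mu>. prob_space \<mu> \<and> sets \<mu> = sets sphere_borel}"

definition minimal_energy :: "(real ^ 'n \<Rightarrow> ennreal) \<Rightarrow> ennreal"
  where "minimal_energy Q = (INF \<mu> \<in> unit_sphere_measures. weighted_energy Q \<mu>)"

definition is_extremal_measure :: "(real ^ 'n \<Rightarrow> ennreal) \<Rightarrow> (real ^ 'n) measure \<Rightarrow> bool"
  where "is_extremal_measure Q \<mu> \<longleftrightarrow>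
    \<mu> \<in> unit_sphere_measures \<and> weighted_energy Q \<mu> = minimal_energy Q"

definition extremal_measure :: "(real ^ 'n \<Rightarrow> ennreal) \<Rightarrow> (real ^ 'n) measure"
  where "extremal_measure Q = (THE \<mu>. is_extremal_measure Q \<mu>)"

definition measure_support :: "('a::topological_space) measure \<Rightarrow> 'a set"
  where "measure_support \<mu> =
    {x \<in> space \<mu>. \<forall>U. open U \<longrightarrow> x \<in> U \<longrightarrow> emeasure \<mu> (U \<inter> space \<mu>) > 0}"

definition point_charge_field :: "'n \<Rightarrow> real \<Rightarrow> real ^ 'n \<Rightarrow> ennreal"
  where "point_charge_field k q x =
    ennreal q / ennreal ((1 - x $ k) powr ((real CARD('n) - 2) / 2))"

lemma riesz_kernel_diagonal:
  fixes x :: "real ^ 'n"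
  assumes "CARD('n) \<ge> 3"
  shows "riesz_kernel x x = \<infinity>"
  using assms by (simp add: riesz_kernel_def power_0_left)

lemma riesz_kernel_off_diagonal:
  fixes x y :: "real ^ 'n"
  assumes "x \<noteq> y"
  shows "riesz_kernel x y = ennreal (1 / norm (x - y) ^ (CARD('n) - 2))"
  using assms by (simp add: riesz_kernel_def divide_ennreal flip: ennreal_1)

lemma point_charge_field_north_pole:
  "q > 0 \<Longrightarrow> point_charge_field k q (axis k 1) = \<infinity>"
  by (simp add: point_charge_field_def ennreal_divide_eq_top_iff)

lemma point_charge_field_eq:
  assumes "q > 0" "x $ k < 1"
  shows "point_charge_field k q (x :: real ^ 'n) =
    ennreal (q * (1 - x $ k) powr (- ((real CARD('n) - 2) / 2)))"
proof -
  have "(1 - x $ k) powr ((real CARD('n) - 2) / 2) > 0"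
    using assms by simp
  then have "point_charge_field k q x = ennreal (q / (1 - x $ k) powr ((real CARD('n) - 2) / 2))"
    unfolding point_charge_field_def using assms by (subst divide_ennreal) auto
  then show ?thesis
    by (simp add: powr_minus_divide)
qed

section \<open>Special functions\<close>

definition incomplete_Beta :: "real \<Rightarrow> real \<Rightarrow> real \<Rightarrow> real"
  where "incomplete_Beta z a b = integral {0..z} (\<lambda>t. t powr (a - 1) * (1 - t) powr (b - 1))"

definition hyp2F1 :: "real \<Rightarrow> real \<Rightarrow> real \<Rightarrow> real \<Rightarrow> real"
  where "hyp2F1 a b c z =
    (\<Sum>n. pochhammer a n * pochhammer b n / pochhammer c n * (z ^ n / fact n))"

section \<open>Angle equation and density\<close>

definition angle_equation :: "nat \<Rightarrow> real \<Rightarrow> real \<Rightarrow> bool"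
  where "angle_equation d q \<alpha> \<longleftrightarrow>
    (1 / sin (\<alpha> / 2)) ^ (d - 1) * incomplete_Beta ((cos (\<alpha> / 2))\<^sup>2) ((real d - 2) / 2) (real d / 2)
      - incomplete_Beta ((cos (\<alpha> / 2))\<^sup>2) ((real d - 2) / 2) (1 / 2)
    = sqrt pi * Gamma (real d / 2 - 1) / (q * 2 powr ((real d - 2) / 2) * Gamma ((real d - 1) / 2))"

definition density_const :: "nat \<Rightarrow> real \<Rightarrow> real \<Rightarrow> real"
  where "density_const d q \<alpha> =
    Gamma (real d / 2 - 1) / (2 ^ (d - 1) * pi powr (real d / 2))
    * inverse (incomplete_Beta ((cos (\<alpha> / 2))\<^sup>2) ((real d - 2) / 2) (real d / 2))
    * (1 + q * 2 powr ((real d - 2) / 2) * Gamma ((real d - 1) / 2)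
             / (sqrt pi * Gamma (real d / 2 - 1))
           * incomplete_Beta ((cos (\<alpha> / 2))\<^sup>2) ((real d - 2) / 2) (1 / 2))"

text \<open>At \<open>\<eta> = \<alpha>\<close> both square roots below have a zero denominator and take the junk value \<open>0\<close>;
  this is one value of the polar angle and so affects only a null set of the sphere.\<close>

definition density_formula :: "nat \<Rightarrow> real \<Rightarrow> real \<Rightarrow> real \<Rightarrow> real"
  where "density_formula d q \<alpha> \<eta> =
    density_const d q \<alpha>
      * ((1 - cos \<alpha>) / (1 - cos \<eta>)) powr ((real d - 1) / 2)
      * sqrt ((1 - cos \<alpha>) / (cos \<alpha> - cos \<eta>))
      * hyp2F1 1 ((real d - 1) / 2) (1 / 2) ((cos \<alpha> - cos \<eta>) / (1 - cos \<eta>))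
    - q * Gamma ((real d - 1) / 2) / (sqrt 2 * pi powr ((real d + 1) / 2))
      * (1 / (1 - cos \<eta>) powr ((real d - 1) / 2))
      * sqrt ((1 - cos \<alpha>) / (cos \<alpha> - cos \<eta>))"

text \<open>\<open>M\<close> has the real-valued density \<open>g\<close> with respect to \<open>N\<close>. Nonnegativity is required
  explicitly because \<^const>\<open>ennreal\<close> maps negative reals to \<open>0\<close>.\<close>

definition has_real_density :: "'a measure \<Rightarrow> 'a measure \<Rightarrow> ('a \<Rightarrow> real) \<Rightarrow> bool"
  where "has_real_density M N g \<longleftrightarrow>
    g \<in> borel_measurable N \<and> (AE x in N. 0 \<le> g x) \<and> M = density N (\<lambda>x. ennreal (g x))"

end

theory Submission
  imports Defs
begin

text \<open>The measure with constant total potential on a cap is found without inversion. For a point \<open>x\<close> of the sphere,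
  the kernel \<open>|x - y|\<^sup>2\<^sup>-\<^sup>d\<close> is the Jacobian of the double cover \<open>w \<mapsto> y\<close> that sends a direction \<open>w\<close> to the second
  intersection of the sphere with the line through \<open>x\<close> in direction \<open>w\<close>. The potential at \<open>x\<close> is therefore an
  integral over directions; slicing it parallel to the chord from \<open>x\<close> to the North Pole \<open>n\<close> leaves arcsine integrals.
  With \<open>p = 1 - y\<^sub>1\<close>, the equilibrium density is a multiple of the incomplete Beta integral of
  \<open>u\<^sup>(\<^sup>d\<^sup>-\<^sup>2\<^sup>)\<^sup>/\<^sup>2 (1 - u)\<^sup>-\<^sup>1\<^sup>/\<^sup>2\<close> over \<open>p\<^sub>0 / p < u < 1\<close>; the complementary integral is a density whose potential equals
  the field on the cap and is smaller off the cap, while the sum of the two densities is constant on the sphere and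
  so has constant potential. Minimality and uniqueness then follow from the strict positive definiteness of the kernel.\<close>

section \<open>Lebesgue measure along directions, slabs and homogeneous cross-sections\<close>

text \<open>The Beta weight is chosen so that a line integral in chord direction is an arcsine
  integral whose value does not depend on the length of its interval. What remains is a power
  integral up to the smaller of p0 and Q/a, with Q the value of \<open>chord_form\<close> and a the
  squared length orthogonal to the chord. Since Q/a is at least 1 - x_1, the bound p0 is the smaller
  one for every x in the cap. The potential is then a constant times the integral of sqrt Q over a
  region Q \<le> 1, and a linear change of variables turns this into a multiple of (1 -
  x_1)^(-(d-2)/2): this is where the field comes from. Matching that multiple with q fixes the
  normalisation of both densities, so the mass of the equilibrium density is a function of p0 alone.
  The angle equation says that this mass is 1, and its solution is unique because the mass is
  strictly decreasing in p0. Energies may be infinite, so all identities between them are written as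
  sums and cancelled only where a term is known to be finite.\<close>

lemma nn_integral_lborel_translate:
  fixes F :: "'a::euclidean_space \<Rightarrow> ennreal"
  assumes [measurable]: "F \<in> borel_measurable borel"
  shows "(\<integral>\<^sup>+z. F (z + c) \<partial>lborel) = (\<integral>\<^sup>+z. F z \<partial>lborel)"
proof -
  have "(\<integral>\<^sup>+z. F z \<partial>lborel) = (\<integral>\<^sup>+z. F z \<partial>distr lborel borel ((+) c))"
    by (simp add: lborel_distr_plus)
  then show ?thesis by (simp add: nn_integral_distr add.commute)
qed

lemma nn_integral_lborel_scale:
  fixes F :: "'a::euclidean_space \<Rightarrow> ennreal"
  assumes [measurable]: "F \<in> borel_measurable borel" and l: "l > 0"
  shows "(\<integral>\<^sup>+z. F z \<partial>lborel) = ennreal (l ^ DIM('a)) * (\<integral>\<^sup>+z. F (l *\<^sub>R z) \<partial>lborel)"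
  using l by (subst lborel_affine[of l 0])
     (auto simp: nn_integral_density nn_integral_distr nn_integral_cmult)

definition perp :: "'a::real_inner \<Rightarrow> 'a \<Rightarrow> 'a"
  where "perp e z = z - (z \<bullet> e) *\<^sub>R e"

definition slab :: "'a::real_inner \<Rightarrow> 'a set"
  where "slab e = {z. \<bar>z \<bullet> e\<bar> < 1/2}"

lemma perp_measurable [measurable]: "perp e \<in> borel_measurable borel"
  for e :: "'a::euclidean_space"
  unfolding perp_def by measurable

lemma slab_measurable [measurable]: "slab e \<in> sets borel"
  for e :: "'a::euclidean_space"
  unfolding slab_def by measurable

lemma perp_inner [simp]: "norm e = 1 \<Longrightarrow> perp e z \<bullet> e = 0"
  by (simp add: perp_def inner_diff_left norm_eq_1)

lemma perp_add_scaleR [simp]: "norm e = 1 \<Longrightarrow> perp e (z + s *\<^sub>R e) = perp e z"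
  by (simp add: perp_def inner_add_left norm_eq_1 scaleR_add_left)

lemma perp_perp [simp]: "norm e = 1 \<Longrightarrow> perp e (perp e z) = perp e z"
  by (simp add: perp_def[of e "perp e z"])

lemma perp_scaleR: "perp e (l *\<^sub>R z) = l *\<^sub>R perp e z"
  by (simp add: perp_def scaleR_diff_right)

lemma norm_perp_add:
  assumes "norm e = 1"
  shows "norm (perp e z + s *\<^sub>R e) = sqrt ((norm (perp e z))\<^sup>2 + s\<^sup>2)"
proof -
  have "orthogonal (perp e z) (s *\<^sub>R e)"
    using assms by (simp add: orthogonal_def)
  from norm_add_Pythagorean[OF this] show ?thesis
    using assms by (metis abs_norm_cancel mult.right_neutral norm_scaleR power2_abs real_sqrt_abs)
qed

text \<open>Fubini along an arbitrary direction \<open>e\<close>: the slab plays the role of the hyperplane orthogonal to \<open>e\<close>,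
  thickened to unit width, so that no coordinates have to be chosen.\<close>

lemma nn_integral_slab:
  fixes F :: "'a::euclidean_space \<Rightarrow> ennreal"
  assumes [measurable]: "F \<in> borel_measurable borel" and e: "norm e = 1"
  shows "(\<integral>\<^sup>+z. F z \<partial>lborel) =
    (\<integral>\<^sup>+z. (\<integral>\<^sup>+s. F (perp e z + s *\<^sub>R e) \<partial>lborel) * indicator (slab e) z \<partial>lborel)"
proof -
  have ee: "e \<bullet> e = 1" using e by (simp add: norm_eq_1)
  \<comment> \<open>The interval of all s within 1/2 of z \<bullet> e has length 1, so its indicator
    can be inserted under the integral. After Fubini and a translation by
    \<open>s *\<^sub>R e\<close> this window becomes the slab.\<close>
  have len: "(\<integral>\<^sup>+s. indicator {s. \<bar>c - s\<bar> < 1/2} s \<partial>lborel) = 1" for c :: real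
  proof -
    have "{s. \<bar>c - s\<bar> < 1/2} = {c - 1/2<..<c + 1/2}" by (auto simp: abs_if)
    then show ?thesis by simp
  qed
  have recentre: "(\<integral>\<^sup>+s. F (z + s *\<^sub>R e) \<partial>lborel) = (\<integral>\<^sup>+s. F (perp e z + s *\<^sub>R e) \<partial>lborel)" for z
    using nn_integral_lborel_translate[of "\<lambda>s. F (z + s *\<^sub>R e)" "- (z \<bullet> e)"]
    by (simp add: perp_def algebra_simps)
  have shift: "(\<integral>\<^sup>+z. F z * indicator {p. \<bar>snd p \<bullet> e - fst p\<bar> < 1/2} (s, z) \<partial>lborel) =
    (\<integral>\<^sup>+z. F (z + s *\<^sub>R e) * indicator {p. \<bar>snd p \<bullet> e - fst p\<bar> < 1/2} (s, z + s *\<^sub>R e) \<partial>lborel)" for s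
    by (rule nn_integral_lborel_translate[symmetric]) measurable
  have "(\<integral>\<^sup>+z. F z \<partial>lborel) = (\<integral>\<^sup>+z. (\<integral>\<^sup>+s. F z * indicator {s. \<bar>z \<bullet> e - s\<bar> < 1/2} s \<partial>lborel) \<partial>lborel)"
    by (subst nn_integral_cmult, measurable) (simp only: len mult_1_right)
  also have "\<dots> = (\<integral>\<^sup>+z. (\<integral>\<^sup>+s. F z * indicator {p. \<bar>snd p \<bullet> e - fst p\<bar> < 1/2} (s, z) \<partial>lborel) \<partial>lborel)"
    by (intro nn_integral_cong) (auto simp: indicator_def)
  also have "\<dots> = (\<integral>\<^sup>+s. (\<integral>\<^sup>+z. F z * indicator {p. \<bar>snd p \<bullet> e - fst p\<bar> < 1/2} (s, z) \<partial>lborel) \<partial>lborel)"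
    by (rule lborel_pair.Fubini') measurable
  also have "\<dots> = (\<integral>\<^sup>+s. (\<integral>\<^sup>+z. F (z + s *\<^sub>R e) * indicator {p. \<bar>snd p \<bullet> e - fst p\<bar> < 1/2} (s, z + s *\<^sub>R e) \<partial>lborel) \<partial>lborel)"
    by (simp only: shift)
  also have "(\<integral>\<^sup>+s. (\<integral>\<^sup>+z. F (z + s *\<^sub>R e) * indicator {p. \<bar>snd p \<bullet> e - fst p\<bar> < 1/2} (s, z + s *\<^sub>R e) \<partial>lborel) \<partial>lborel)
    = (\<integral>\<^sup>+s. (\<integral>\<^sup>+z. F (z + s *\<^sub>R e) * indicator (slab e) z \<partial>lborel) \<partial>lborel)"
    by (intro nn_integral_cong) (auto simp: indicator_def slab_def inner_add_left ee)
  also have "\<dots> = (\<integral>\<^sup>+z. (\<integral>\<^sup>+s. F (z + s *\<^sub>R e) * indicator (slab e) z \<partial>lborel) \<partial>lborel)"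
    by (rule lborel_pair.Fubini'[symmetric]) measurable
  also have "\<dots> = (\<integral>\<^sup>+z. (\<integral>\<^sup>+s. F (z + s *\<^sub>R e) \<partial>lborel) * indicator (slab e) z \<partial>lborel)"
    by (intro nn_integral_cong, subst nn_integral_multc) auto
  also have "\<dots> = (\<integral>\<^sup>+z. (\<integral>\<^sup>+s. F (perp e z + s *\<^sub>R e) \<partial>lborel) * indicator (slab e) z \<partial>lborel)"
    by (intro nn_integral_cong) (simp only: recentre[symmetric])
  finally show ?thesis .
qed

text \<open>The component along \<open>e\<close> is the inner variable in
  \<open>nn_integral_slab\<close>, so stretching it is a one-dimensional substitution and no
  determinant has to be computed.\<close>

lemma nn_integral_lborel_axis_scale:
  fixes F :: "'a::euclidean_space \<Rightarrow> ennreal"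
  assumes [measurable]: "F \<in> borel_measurable borel" and e: "norm e = 1" and l: "l > 0"
  shows "(\<integral>\<^sup>+z. F z \<partial>lborel) = ennreal l * (\<integral>\<^sup>+z. F (z + ((l - 1) * (z \<bullet> e)) *\<^sub>R e) \<partial>lborel)"
proof -
  have ee: "e \<bullet> e = 1" using e by (simp add: norm_eq_1)
  have "(\<integral>\<^sup>+s. F (perp e z + s *\<^sub>R e) \<partial>lborel) = ennreal l * (\<integral>\<^sup>+s. F (perp e z + (l * s) *\<^sub>R e) \<partial>lborel)" for z
    using l by (subst nn_integral_real_affine[where c=l and t=0]) auto
  then have "(\<integral>\<^sup>+z. F z \<partial>lborel) =
    (\<integral>\<^sup>+z. ennreal l * ((\<integral>\<^sup>+s. F (perp e z + (l * s) *\<^sub>R e) \<partial>lborel) * indicator (slab e) z) \<partial>lborel)"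
    by (subst nn_integral_slab[OF _ e]) (auto simp: mult_ac)
  also have "\<dots> = ennreal l * (\<integral>\<^sup>+z. (\<integral>\<^sup>+s. F (perp e z + (l * s) *\<^sub>R e) \<partial>lborel) * indicator (slab e) z \<partial>lborel)"
    by (rule nn_integral_cmult) measurable
  also have "(\<integral>\<^sup>+z. (\<integral>\<^sup>+s. F (perp e z + (l * s) *\<^sub>R e) \<partial>lborel) * indicator (slab e) z \<partial>lborel)
     = (\<integral>\<^sup>+z. F (z + ((l - 1) * (z \<bullet> e)) *\<^sub>R e) \<partial>lborel)"
    using e by (subst (2) nn_integral_slab[OF _ e])
       (auto simp: inner_add_left ee algebra_simps intro!: nn_integral_cong)
  finally show ?thesis .
qed

text \<open>For a density homogeneous of degree \<open>-DIM('a)\<close> all star-shaped cross-sections carry the same mass.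
  The extra scaling parameter \<open>l\<close> integrates to \<open>1\<close> against either cross-section.\<close>

lemma homogeneous_cross_section:
  fixes h :: "'a::euclidean_space \<Rightarrow> ennreal" and a b :: "'a \<Rightarrow> real"
  assumes [measurable]: "h \<in> borel_measurable borel" "a \<in> borel_measurable borel" "b \<in> borel_measurable borel"
    and h: "\<And>z l. l > 0 \<Longrightarrow> ennreal (l ^ DIM('a)) * h (l *\<^sub>R z) = h z"
    and a: "\<And>z l. l > 0 \<Longrightarrow> a (l *\<^sub>R z) = l * a z"
    and b: "\<And>z l. l > 0 \<Longrightarrow> b (l *\<^sub>R z) = l * b z"
    and a0: "AE z in lborel. a z > 0" and b0: "AE z in lborel. b z > 0"
  shows "(\<integral>\<^sup>+z. h z * ennreal (a z ^ DIM('a)) * indicator {z. a z \<le> 1} z \<partial>lborel) =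
         (\<integral>\<^sup>+z. h z * ennreal (b z ^ DIM('a)) * indicator {z. b z \<le> 1} z \<partial>lborel)"
proof -
  define D where "D = DIM('a)"
  have D: "D \<ge> 1" by (simp add: D_def DIM_positive Suc_leI)
  have i1: "(\<integral>\<^sup>+l. ennreal (real D * l ^ (D - 1) * c ^ D) * indicator {l. 0 < l \<and> l * c \<le> 1} l \<partial>lborel) = 1"
    if "c > 0" for c :: real
  proof -
    have "(\<integral>\<^sup>+l. ennreal (real D * l ^ (D - 1) * c ^ D) * indicator {l. 0 < l \<and> l * c \<le> 1} l \<partial>lborel)
       = (\<integral>\<^sup>+l. ennreal (real D * l ^ (D - 1) * c ^ D) * indicator {0..1/c} l \<partial>lborel)"
      using that by (intro nn_integral_cong_AE eventually_mono[OF AE_lborel_singleton[of 0]])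
        (auto simp: indicator_def field_simps)
    also have "\<dots> = ennreal ((1/c) ^ D * c ^ D - 0 ^ D * c ^ D)"
      using that D by (intro nn_integral_FTC_Icc) (auto intro!: derivative_eq_intros)
    also have "\<dots> = 1" using that D by (simp add: power_divide)
    finally show ?thesis .
  qed
  have i2: "(\<integral>\<^sup>+l. ennreal (real D * c ^ D / l ^ Suc D) * indicator {l. 0 < l \<and> c \<le> l} l \<partial>lborel) = 1"
    if "c > 0" for c :: real
  proof -
    have "(\<integral>\<^sup>+l. ennreal (real D * c ^ D / l ^ Suc D) * indicator {l. 0 < l \<and> c \<le> l} l \<partial>lborel)
       = (\<integral>\<^sup>+l. ennreal (real D * c ^ D / l ^ Suc D) * indicator {c..} l \<partial>lborel)"
      using that by (intro nn_integral_cong) (auto simp: indicator_def)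
    also have "\<dots> = ennreal (0 - (- ((c / c) ^ D)))"
    proof (rule nn_integral_FTC_atLeast[where F="\<lambda>x. - ((c / x) ^ D)"])
      fix x assume "c \<le> x"
      obtain k where k: "D = Suc k" using D by (cases D) auto
      have "((\<lambda>x. - (c ^ D / x ^ D)) has_real_derivative c ^ D * (real D * x ^ (D - 1)) / (x ^ D * x ^ D)) (at x)"
        using that \<open>c \<le> x\<close> by (auto intro!: derivative_eq_intros)
      also have "c ^ D * (real D * x ^ (D - 1)) / (x ^ D * x ^ D) = real D * c ^ D / x ^ Suc D"
        using that \<open>c \<le> x\<close> by (simp add: k field_simps)
      finally show "((\<lambda>x. - ((c / x) ^ D)) has_real_derivative real D * c ^ D / x ^ Suc D) (at x)"
        by (simp add: power_divide)
    next
      have "((\<lambda>x. - ((c * inverse x) ^ D)) \<longlongrightarrow> - ((c * 0) ^ D)) at_top"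
        by (intro tendsto_intros filterlim_compose[OF tendsto_inverse_0] filterlim_at_top_imp_at_infinity filterlim_ident)
      then show "((\<lambda>x. - ((c / x) ^ D)) \<longlongrightarrow> 0) at_top" using D by (simp add: divide_inverse power_0_left)
    qed (use that in auto)
    also have "\<dots> = 1" using that by simp
    finally show ?thesis .
  qed
  \<comment> \<open>\<open>i1\<close> with c = \<open>b z\<close> brings the variable l into the
    left side. Replacing z by z / l turns the integrand \<open>X\<close> into \<open>Y\<close> by
    homogeneity, and integrating l out of \<open>Y\<close> by \<open>i2\<close> with c =
    \<open>a z\<close> leaves the right side.\<close>
  define X where "X = (\<lambda>l z. h z * ennreal (a z ^ D) * indicator {z. a z \<le> 1} z *
      (ennreal (real D * l ^ (D - 1) * b z ^ D) * indicator {l. 0 < l \<and> l * b z \<le> 1} l))"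
  define Y where "Y = (\<lambda>l w. h w * ennreal (b w ^ D) * indicator {z. b z \<le> 1} w *
      (ennreal (real D * a w ^ D / l ^ Suc D) * indicator {l. 0 < l \<and> a w \<le> l} l))"
  have mX [measurable]: "(\<lambda>(l, z). X l z) \<in> borel_measurable (lborel \<Otimes>\<^sub>M lborel)"
    unfolding X_def indicator_def mem_Collect_eq by measurable
  have mY [measurable]: "(\<lambda>(l, z). Y l z) \<in> borel_measurable (lborel \<Otimes>\<^sub>M lborel)"
    unfolding Y_def indicator_def mem_Collect_eq by measurable
  have "(\<integral>\<^sup>+z. h z * ennreal (a z ^ D) * indicator {z. a z \<le> 1} z \<partial>lborel) = (\<integral>\<^sup>+z. (\<integral>\<^sup>+l. X l z \<partial>lborel) \<partial>lborel)"
    unfolding X_def by (intro nn_integral_cong_AE eventually_mono[OF b0], subst nn_integral_cmult, measurable) (simp only: i1 mult_1_right)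
  also have "\<dots> = (\<integral>\<^sup>+l. (\<integral>\<^sup>+z. X l z \<partial>lborel) \<partial>lborel)"
    using lborel_pair.Fubini'[OF mX] by simp
  also have "\<dots> = (\<integral>\<^sup>+l. (\<integral>\<^sup>+z. Y l z \<partial>lborel) \<partial>lborel)"
  proof (rule nn_integral_cong)
    fix l :: real
    show "(\<integral>\<^sup>+z. X l z \<partial>lborel) = (\<integral>\<^sup>+z. Y l z \<partial>lborel)"
    proof (cases "l > 0")
      case True
      have "(\<integral>\<^sup>+z. X l z \<partial>lborel) = (\<integral>\<^sup>+z. ennreal ((1/l) ^ D) * X l ((1/l) *\<^sub>R z) \<partial>lborel)"
        using True by (subst nn_integral_lborel_scale[of _ "1/l"]) (simp_all add: D_def nn_integral_cmult)
      also have "\<dots> = (\<integral>\<^sup>+z. Y l z \<partial>lborel)"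
      proof (intro nn_integral_cong_AE, use a0 b0 in eventually_elim)
        case (elim z)
        define u where "u = (1/l) *\<^sub>R z"
        have az: "a u = a z / l" and bz: "b u = b z / l"
          using a[of "1/l" z] b[of "1/l" z] True by (simp_all add: u_def)
        have hz: "h z = ennreal ((1/l) ^ D) * h u"
          using h[of "1/l" z] True by (simp add: D_def u_def)
        obtain k where k: "D = Suc k" using D by (cases D) auto
        have "(a z / l) ^ D * (real D * l ^ (D - 1) * (b z / l) ^ D) = b z ^ D * (real D * a z ^ D / l ^ Suc D)"
          using True by (simp add: k power_divide field_simps)
        then have e: "ennreal (a u ^ D) * ennreal (real D * l ^ (D - 1) * b u ^ D)
           = ennreal (b z ^ D) * ennreal (real D * a z ^ D / l ^ Suc D)"
          using True elim by (simp add: az bz flip: ennreal_mult)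
        have i1: "indicator {l. 0 < l \<and> l * b u \<le> 1} l = (indicator {z. b z \<le> 1} z :: ennreal)"
          and i2: "indicator {z. a z \<le> 1} u = (indicator {l. 0 < l \<and> a z \<le> l} l :: ennreal)"
          using True by (auto simp: az bz indicator_def field_simps)
        have "ennreal ((1/l) ^ D) * X l u = h z * (ennreal (a u ^ D) * ennreal (real D * l ^ (D - 1) * b u ^ D))
            * indicator {z. b z \<le> 1} z * indicator {l. 0 < l \<and> a z \<le> l} l"
          unfolding X_def i1 i2 hz by (simp only: mult_ac)
        also have "\<dots> = Y l z"
          unfolding Y_def e by (simp only: mult_ac)
        finally show ?case by (simp only: u_def)
      qed
      finally show ?thesis .
    qed (simp add: X_def Y_def)
  qed
  also have "\<dots> = (\<integral>\<^sup>+z. (\<integral>\<^sup>+l. Y l z \<partial>lborel) \<partial>lborel)"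
    using lborel_pair.Fubini'[OF mY] by simp
  also have "\<dots> = (\<integral>\<^sup>+z. h z * ennreal (b z ^ D) * indicator {z. b z \<le> 1} z \<partial>lborel)"
  proof (rule nn_integral_cong_AE, rule eventually_mono[OF a0])
    fix z :: 'a assume "0 < a z"
    have "(\<integral>\<^sup>+l. Y l z \<partial>lborel) = h z * ennreal (b z ^ D) * indicator {z. b z \<le> 1} z *
       (\<integral>\<^sup>+l. ennreal (real D * a z ^ D / l ^ Suc D) * indicator {l. 0 < l \<and> a z \<le> l} l \<partial>lborel)"
      unfolding Y_def by (rule nn_integral_cmult) measurable
    then show "(\<integral>\<^sup>+l. Y l z \<partial>lborel) = h z * ennreal (b z ^ D) * indicator {z. b z \<le> 1} z"
      by (simp only: i2[OF \<open>0 < a z\<close>] mult_1_right)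
  qed
  finally show ?thesis by (simp only: D_def)
qed

section \<open>Integration over the sphere\<close>

text \<open>The substitutions below run over open or unbounded intervals, often with integrands
  singular at an end. Compact subintervals exhaust such an interval, and monotone convergence
  carries the compact case over.\<close>

lemma nn_integral_substitution_open:
  fixes F :: "real \<Rightarrow> ennreal" and g g' :: "real \<Rightarrow> real"
  assumes [measurable]: "F \<in> borel_measurable borel"
    and ab: "a < b" and S: "S = einterval a b"
    and der: "\<And>x. x \<in> S \<Longrightarrow> (g has_real_derivative g' x) (at x)"
    and cont: "continuous_on S g'"
    and nonneg: "\<And>x. x \<in> S \<Longrightarrow> 0 \<le> g' x"
  shows "(\<integral>\<^sup>+y. F y * indicator (g ` S) y \<partial>lborel) = (\<integral>\<^sup>+x. F (g x) * ennreal (g' x) * indicator S x \<partial>lborel)"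
proof -
  obtain u l :: "nat \<Rightarrow> real" where ul: "einterval a b = (\<Union>i. {l i .. u i})" "incseq u" "decseq l"
    "\<And>i. l i < u i"
    by (rule einterval_Icc_approximation[OF ab]) (erule that)
  have sub: "{l i..u i} \<subseteq> S" for i using ul(1) S by auto
  have mono: "g x \<le> g y" if "x \<in> {l i..u i}" "y \<in> {l i..u i}" "x \<le> y" for i x y
  proof (rule DERIV_nonneg_imp_nondecreasing[OF that(3)])
    fix t assume "x \<le> t" "t \<le> y"
    then have "t \<in> S" using sub[of i] that by auto
    then show "\<exists>y. (g has_real_derivative y) (at t) \<and> 0 \<le> y" using der nonneg by blast
  qed
  have cg: "continuous_on {l i..u i} g" for i
    using der sub by (meson DERIV_continuous continuous_at_imp_continuous_on subsetD)
  have img: "{g (l i)..g (u i)} = g ` {l i..u i}" for i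
  proof (intro subset_antisym subsetI)
    fix y assume "y \<in> {g (l i)..g (u i)}"
    then show "y \<in> g ` {l i..u i}"
      using IVT'[of g "l i" y "u i"] cg[of i] ul(4)[of i] by force
  next
    fix y assume "y \<in> g ` {l i..u i}"
    then show "y \<in> {g (l i)..g (u i)}"
      using mono[of _ i] ul(4)[of i] by force
  qed
  have nest: "{l i..u i} \<subseteq> {l j..u j}" if "i \<le> j" for i j
    using incseqD[OF ul(2) that] decseqD[OF ul(3) that] by auto
  have nest': "{g (l i)..g (u i)} \<subseteq> {g (l j)..g (u j)}" if "i \<le> j" for i j
    unfolding img using nest[OF that] by (rule image_mono)
  have imS: "g ` S = (\<Union>i. {g (l i)..g (u i)})" unfolding S ul(1) img by (rule image_UN)
  have eq: "(\<integral>\<^sup>+y. F y * indicator {g (l i)..g (u i)} y \<partial>lborel) =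
    (\<integral>\<^sup>+x. F (g x) * ennreal (g' x) * indicator {l i..u i} x \<partial>lborel)" for i
    by (rule nn_integral_substitution_aux) (use sub[of i, THEN subsetD] ul(4)[of i] der nonneg in \<open>simp_all add: continuous_on_subset[OF cont sub]\<close>)
  have lim: "(\<lambda>i. c * indicator (A i) x) \<longlonglongrightarrow> c * indicator (\<Union>i. A i) x"
    if "\<And>i j. i \<le> j \<Longrightarrow> A i \<subseteq> A j" for A :: "nat \<Rightarrow> real set" and c :: ennreal and x
  proof (cases "x \<in> (\<Union>i. A i)")
    case True
    then obtain n where "x \<in> A n" by auto
    then have "eventually (\<lambda>i. c * indicator (A i) x = c * indicator (\<Union>i. A i) x) sequentially"
      using that by (auto simp: eventually_sequentially indicator_def intro!: exI[of _ n])
    then show ?thesis by (rule tendsto_eventually)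
  qed auto
  have inc: "incseq (\<lambda>i x. H x * indicator (A i) x)"
    if "\<And>i j. i \<le> j \<Longrightarrow> A i \<subseteq> A j" for A :: "nat \<Rightarrow> real set" and H :: "real \<Rightarrow> ennreal"
    unfolding incseq_def le_fun_def
    by (simp add: indicator_def) (use that in blast)
  have "(\<lambda>i. \<integral>\<^sup>+y. F y * indicator {g (l i)..g (u i)} y \<partial>lborel) \<longlonglongrightarrow> (\<integral>\<^sup>+y. F y * indicator (g ` S) y \<partial>lborel)"
    unfolding imS by (rule nn_integral_LIMSEQ[OF inc[OF nest'] _ lim[OF nest']]) measurable
  moreover have "(\<lambda>i. \<integral>\<^sup>+y. F y * indicator {g (l i)..g (u i)} y \<partial>lborel) \<longlonglongrightarrow>
      (\<integral>\<^sup>+x. F (g x) * ennreal (g' x) * indicator S x \<partial>lborel)"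
  proof -
    \<comment> \<open>Nothing is known of \<open>g\<close> and \<open>g'\<close> outside S, so
      measurability is shown for cut-off versions that agree with them under the indicator.\<close>
    have gm: "(\<lambda>x. F (g x) * ennreal (g' x) * indicator {l i..u i} x) \<in> borel_measurable borel" for i
    proof -
      have m1: "(\<lambda>x. if x \<in> {l i..u i} then g x else 0) \<in> borel_measurable borel"
        by (intro borel_measurable_continuous_on_if cg) auto
      have m2: "(\<lambda>x. if x \<in> {l i..u i} then g' x else 0) \<in> borel_measurable borel"
        by (intro borel_measurable_continuous_on_if continuous_on_subset[OF cont sub]) auto
      have "(\<lambda>x. F (if x \<in> {l i..u i} then g x else 0) * ennreal (if x \<in> {l i..u i} then g' x else 0)
         * indicator {l i..u i} x) \<in> borel_measurable borel"
        using m1 m2 by measurable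
      then show ?thesis by (rule measurable_cong[THEN iffD1, rotated]) (auto simp: indicator_def)
    qed
    show ?thesis unfolding eq S ul(1)
      by (rule nn_integral_LIMSEQ[OF inc[OF nest] _ lim[OF nest]]) (simp_all add: gm)
  qed
  ultimately show ?thesis by (rule LIMSEQ_unique)
qed

section \<open>Surface integrals as volume integrals over cones and cylinders\<close>

lemma sgn_measurable [measurable]: "(sgn :: 'a \<Rightarrow> 'a::euclidean_space) \<in> borel_measurable borel"
  unfolding sgn_div_norm[abs_def] by measurable

definition sphere_int :: "('a::euclidean_space \<Rightarrow> ennreal) \<Rightarrow> ennreal"
  where "sphere_int G = ennreal (real DIM('a)) * (\<integral>\<^sup>+z. G (sgn z) * indicator {z. norm z \<le> 1} z \<partial>lborel)"

text \<open>The surface integral over the unit sphere of the hyperplane orthogonal to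
  \<open>e\<close>, thickened by the slab to full dimension. The weight
  \<open>norm (perp e z)\<close> raises the radial density from r^(DIM - 2) to r^(DIM - 1), whose
  integral over [0, 1] cancels the factor \<open>DIM('a)\<close>.\<close>

definition equator_int :: "'a::euclidean_space \<Rightarrow> ('a \<Rightarrow> ennreal) \<Rightarrow> ennreal"
  where "equator_int e H = ennreal (real DIM('a)) *
    (\<integral>\<^sup>+z. H (sgn (perp e z)) * ennreal (norm (perp e z)) * indicator (slab e \<inter> {z. norm (perp e z) \<le> 1}) z \<partial>lborel)"

lemma AE_norm_pos: "AE z in lborel. 0 < norm (z :: 'a::euclidean_space)"
  by (rule eventually_mono[OF AE_lborel_singleton[of 0]]) auto

text \<open>The zeros of \<open>perp e\<close> form the line spanned by \<open>e\<close>. From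
  dimension 2 on some nonzero w is orthogonal to \<open>e\<close>, and the hyperplane orthogonal to
  w contains that line.\<close>

lemma AE_perp_nonzero:
  assumes "norm (e :: 'a::euclidean_space) = 1" "2 \<le> DIM('a)"
  shows "AE z in lborel. perp e z \<noteq> 0"
proof -
  obtain w where w: "w \<noteq> 0" "orthogonal e w"
    using orthogonal_to_vector_exists[OF assms(2)] by blast
  have "negligible {z. w \<bullet> z = 0}" using w by (intro negligible_hyperplane) auto
  then have "{z. w \<bullet> z = 0} \<in> null_sets lebesgue" by (simp add: negligible_iff_null_sets)
  then have "AE z in lebesgue. w \<bullet> z \<noteq> 0" by (rule AE_I') auto
  then have "AE z in lborel. w \<bullet> z \<noteq> 0" by (simp add: AE_completion_iff)
  then show ?thesis
  proof (rule eventually_mono)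
    fix z assume z: "w \<bullet> z \<noteq> 0"
    show "perp e z \<noteq> 0"
    proof
      assume "perp e z = 0"
      then have "z = (z \<bullet> e) *\<^sub>R e" by (simp add: perp_def)
      then have "w \<bullet> z = (z \<bullet> e) * (w \<bullet> e)" by (metis inner_scaleR_right)
      with z w show False by (simp add: orthogonal_def inner_commute)
    qed
  qed
qed

text \<open>\<open>homogeneous_cross_section\<close>, applied to the density G(sgn z) / |z|^DIM,
  lets any star-shaped body b \<le> 1 replace the unit ball in \<open>sphere_int\<close>. The bodies
  used later are a cylinder and the region cut out by a quadratic form.\<close>

lemma sphere_int_cross_section:
  fixes G :: "'a::euclidean_space \<Rightarrow> ennreal" and b :: "'a \<Rightarrow> real"
  assumes [measurable]: "G \<in> borel_measurable borel" "b \<in> borel_measurable borel"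
    and b: "\<And>z l. l > 0 \<Longrightarrow> b (l *\<^sub>R z) = l * b z" and b0: "AE z in lborel. b z > 0"
  shows "sphere_int G = ennreal (real DIM('a)) *
    (\<integral>\<^sup>+z. G (sgn z) * ennreal ((b z / norm z) ^ DIM('a)) * indicator {z. b z \<le> 1} z \<partial>lborel)"
proof -
  let ?h = "\<lambda>z::'a. G (sgn z) * ennreal (1 / norm z ^ DIM('a))"
  have "(\<integral>\<^sup>+z. G (sgn z) * indicator {z. norm z \<le> 1} z \<partial>lborel) =
     (\<integral>\<^sup>+z. ?h z * ennreal (norm z ^ DIM('a)) * indicator {z. norm z \<le> 1} z \<partial>lborel)"
  proof (intro nn_integral_cong_AE eventually_mono[OF AE_norm_pos])
    fix z :: 'a assume "0 < norm z"
    then have "ennreal (1 / norm z ^ DIM('a)) * ennreal (norm z ^ DIM('a)) = 1"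
      by (simp flip: ennreal_mult)
    then show "G (sgn z) * indicator {z. norm z \<le> 1} z = ?h z * ennreal (norm z ^ DIM('a)) * indicator {z. norm z \<le> 1} z"
      by (simp add: mult.assoc)
  qed
  also have "\<dots> = (\<integral>\<^sup>+z. ?h z * ennreal (b z ^ DIM('a)) * indicator {z. b z \<le> 1} z \<partial>lborel)"
  proof (rule homogeneous_cross_section)
    fix z :: 'a and l :: real assume "l > 0"
    then show "ennreal (l ^ DIM('a)) * ?h (l *\<^sub>R z) = ?h z"
      by (cases "z = 0") (auto simp: sgn_scaleR power_mult_distrib power_0_left mult.left_commute simp flip: ennreal_mult)
  qed (use AE_norm_pos b b0 in auto)
  also have "\<dots> = (\<integral>\<^sup>+z. G (sgn z) * ennreal ((b z / norm z) ^ DIM('a)) * indicator {z. b z \<le> 1} z \<partial>lborel)"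
    by (intro nn_integral_cong_AE eventually_mono[OF b0])
      (simp add: mult.assoc power_divide flip: ennreal_mult)
  finally show ?thesis unfolding sphere_int_def by simp
qed

text \<open>The body is the infinite cylinder around the axis \<open>e\<close>. Central projection
  of its lateral surface sends the point \<open>x + t *\<^sub>R e\<close> at height t above the
  equator to the sphere with Jacobian (1 + t^2)^(-DIM/2).\<close>

lemma sphere_int_cylinder:
  fixes G :: "'a::euclidean_space \<Rightarrow> ennreal"
  assumes [measurable]: "G \<in> borel_measurable borel" and e: "norm e = 1" and d: "2 \<le> DIM('a)"
  shows "sphere_int G = equator_int e (\<lambda>x. \<integral>\<^sup>+t. G (sgn (x + t *\<^sub>R e)) * ennreal (1 / sqrt (1 + t\<^sup>2) ^ DIM('a)) \<partial>lborel)"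
proof -
  let ?F = "\<lambda>z. G (sgn z) * ennreal ((norm (perp e z) / norm z) ^ DIM('a)) * indicator {z. norm (perp e z) \<le> 1} z"
  let ?H = "\<lambda>x. \<integral>\<^sup>+t. G (sgn (x + t *\<^sub>R e)) * ennreal (1 / sqrt (1 + t\<^sup>2) ^ DIM('a)) \<partial>lborel"
  have "sphere_int G = ennreal (real DIM('a)) * (\<integral>\<^sup>+z. ?F z \<partial>lborel)"
    by (rule sphere_int_cross_section)
      (use AE_perp_nonzero[OF e d] in \<open>auto simp: perp_scaleR\<close>)
  also have "(\<integral>\<^sup>+z. ?F z \<partial>lborel) = (\<integral>\<^sup>+z. (\<integral>\<^sup>+s. ?F (perp e z + s *\<^sub>R e) \<partial>lborel) * indicator (slab e) z \<partial>lborel)"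
    by (rule nn_integral_slab[OF _ e]) measurable
  also have "\<dots> = (\<integral>\<^sup>+z. ?H (sgn (perp e z)) * ennreal (norm (perp e z)) * indicator (slab e \<inter> {z. norm (perp e z) \<le> 1}) z \<partial>lborel)"
  proof (rule nn_integral_cong_AE, rule eventually_mono[OF AE_perp_nonzero[OF e d]])
    fix z assume z: "perp e z \<noteq> 0"
    \<comment> \<open>Heights are measured in units of r, so that the direction of
      \<open>perp e z + (r * t) *\<^sub>R e\<close> depends only on t and on the direction of
      \<open>perp e z\<close>.\<close>
    define r where "r = norm (perp e z)"
    have r: "r > 0" using z by (simp add: r_def)
    have F: "?F (perp e z + (r * t) *\<^sub>R e) = G (sgn (sgn (perp e z) + t *\<^sub>R e)) * ennreal (1 / sqrt (1 + t\<^sup>2) ^ DIM('a)) * indicator {z. norm (perp e z) \<le> 1} z" for t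
    proof -
      have 1: "perp e z + (r * t) *\<^sub>R e = r *\<^sub>R (sgn (perp e z) + t *\<^sub>R e)"
        using r by (simp add: sgn_div_norm scaleR_add_right r_def)
      have 2: "norm (perp e z + (r * t) *\<^sub>R e) = r * sqrt (1 + t\<^sup>2)"
      proof -
        have "norm (perp e z + (r * t) *\<^sub>R e) = sqrt (r\<^sup>2 * (1 + t\<^sup>2))"
          using e by (simp add: norm_perp_add power_mult_distrib distrib_left flip: r_def)
        then show ?thesis using r by (simp only: real_sqrt_mult) simp
      qed
      have 3: "sgn (perp e z + (r * t) *\<^sub>R e) = sgn (sgn (perp e z) + t *\<^sub>R e)"
        unfolding 1 using r by (simp add: sgn_scaleR)
      show ?thesis unfolding 2 3 using e r
        by (simp add: r_def[symmetric] power_divide indicator_def)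
    qed
    have "(\<integral>\<^sup>+s. ?F (perp e z + s *\<^sub>R e) \<partial>lborel) = ennreal r * (\<integral>\<^sup>+t. ?F (perp e z + (r * t) *\<^sub>R e) \<partial>lborel)"
      using nn_integral_real_affine[of "\<lambda>s. ?F (perp e z + s *\<^sub>R e)" r 0] r by simp
    also have "\<dots> = ennreal r * (?H (sgn (perp e z)) * indicator {z. norm (perp e z) \<le> 1} z)"
      unfolding F by (subst nn_integral_multc) auto
    finally show "(\<integral>\<^sup>+s. ?F (perp e z + s *\<^sub>R e) \<partial>lborel) * indicator (slab e) z =
       ?H (sgn (perp e z)) * ennreal (norm (perp e z)) * indicator (slab e \<inter> {z. norm (perp e z) \<le> 1}) z"
      by (simp add: r_def indicator_inter_arith mult_ac)
  qed
  finally show ?thesis unfolding equator_int_def .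
qed

section \<open>The kernel as a Jacobian of reflections\<close>

lemma nn_integral_lborel_uminus:
  fixes F :: "'a::euclidean_space \<Rightarrow> ennreal"
  assumes [measurable]: "F \<in> borel_measurable borel"
  shows "(\<integral>\<^sup>+z. F (- z) \<partial>lborel) = (\<integral>\<^sup>+z. F z \<partial>lborel)"
  by (subst (2) lborel_affine[of "-1" 0]) (auto simp: nn_integral_density nn_integral_distr)

lemma perp_uminus: "perp e (- z) = - perp e z"
  by (simp add: perp_def)

lemma equator_int_uminus:
  assumes [measurable]: "H \<in> borel_measurable borel"
  shows "equator_int e (\<lambda>x. H (- x)) = equator_int e H"
proof -
  let ?F = "\<lambda>z. H (sgn (perp e z)) * ennreal (norm (perp e z)) * indicator (slab e \<inter> {z. norm (perp e z) \<le> 1}) z"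
  have "(\<integral>\<^sup>+z. ?F (- z) \<partial>lborel) = (\<integral>\<^sup>+z. ?F z \<partial>lborel)"
    by (rule nn_integral_lborel_uminus) measurable
  then show ?thesis
    unfolding equator_int_def
    by (simp add: perp_uminus sgn_minus slab_def indicator_def)
qed

lemma equator_int_cong:
  fixes e :: "'a::euclidean_space"
  assumes e: "norm e = 1" and d: "2 \<le> DIM('a)"
    and H: "\<And>x. norm x = 1 \<Longrightarrow> x \<bullet> e = 0 \<Longrightarrow> H x = H' x"
  shows "equator_int e H = equator_int e H'"
proof -
  have "H (sgn (perp e z)) = H' (sgn (perp e z))" if "perp e z \<noteq> 0" for z
    using that e by (intro H) (auto simp: norm_sgn, simp add: sgn_div_norm)
  then show ?thesis unfolding equator_int_def
    by (intro arg_cong[where f="\<lambda>x. _ * x"] nn_integral_cong_AE eventually_mono[OF AE_perp_nonzero[OF e d]]) auto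
qed

lemma equator_int_cmult:
  assumes [measurable]: "H \<in> borel_measurable borel"
  shows "equator_int e (\<lambda>x. c * H x) = c * equator_int e H"
  unfolding equator_int_def by (simp add: nn_integral_cmult mult.assoc mult.left_commute[of _ c])

lemma equator_int_add:
  assumes [measurable]: "H \<in> borel_measurable borel" "H' \<in> borel_measurable borel"
  shows "equator_int e (\<lambda>x. H x + H' x) = equator_int e H + equator_int e H'"
  unfolding equator_int_def by (simp add: nn_integral_add distrib_left distrib_right)

text \<open>The orthogonal reflection in the hyperplane normal to \<open>w\<close>; it depends only
  on the line spanned by \<open>w\<close>. Division by zero makes it the identity for w = 0.\<close>

definition reflect :: "'a::euclidean_space \<Rightarrow> 'a \<Rightarrow> 'a"
  where "reflect w x = x - (2 * (x \<bullet> w) / (w \<bullet> w)) *\<^sub>R w"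

lemma reflect_measurable [measurable]: "(\<lambda>w. reflect w x) \<in> borel_measurable borel"
  unfolding reflect_def by measurable

lemma reflect_scaleR: "l \<noteq> 0 \<Longrightarrow> reflect (l *\<^sub>R w) x = reflect w x"
  by (cases "w = 0") (simp_all add: reflect_def field_simps)

lemma reflect_sgn: "reflect (sgn w) x = reflect w x"
  by (cases "w = 0") (simp_all add: sgn_div_norm reflect_scaleR)

lemma reflect_uminus: "reflect (- w) x = reflect w x"
  using reflect_scaleR[of "-1" w x] by simp

lemma norm_add_axis:
  assumes "norm x = 1" "norm e = 1" "x \<bullet> e = 0"
  shows "norm (x + t *\<^sub>R e) = sqrt (1 + t\<^sup>2)"
  using norm_perp_add[OF assms(2), of x t] assms by (simp add: perp_def)

text \<open>In terms of latitude the reflection doubles an angle: if t = tan phi, the image has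
  slope (t - 1/t) / 2 = -cot (2 phi). The sign t < 0 puts the image on the half-meridian through x;
  for t > 0 it would lie on the one through -x.\<close>

lemma reflect_axis:
  fixes e x :: "'a::euclidean_space"
  assumes e: "norm e = 1" and x: "norm x = 1" "x \<bullet> e = 0" and t: "t < 0"
  shows "sgn (x + ((t - 1 / t) / 2) *\<^sub>R e) = reflect (x + t *\<^sub>R e) e"
    and "norm (e - reflect (x + t *\<^sub>R e) e) = - 2 * t / sqrt (1 + t\<^sup>2)"
    and "sqrt (1 + ((t - 1 / t) / 2)\<^sup>2) = (1 + t\<^sup>2) / (- 2 * t)"
proof -
  have pos: "1 + t\<^sup>2 > 0" by (simp add: add_pos_nonneg)
  have ww: "(x + t *\<^sub>R e) \<bullet> (x + t *\<^sub>R e) = 1 + t\<^sup>2"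
    using norm_add_axis[OF x(1) e x(2), of t] pos by (simp add: dot_square_norm)
  have ew: "e \<bullet> (x + t *\<^sub>R e) = t"
    using e x by (simp add: inner_add_right norm_eq_1 inner_commute[of e x])
  have r: "reflect (x + t *\<^sub>R e) e = e - (2 * t / (1 + t\<^sup>2)) *\<^sub>R (x + t *\<^sub>R e)"
    unfolding reflect_def ww ew ..
  show "norm (e - reflect (x + t *\<^sub>R e) e) = - 2 * t / sqrt (1 + t\<^sup>2)"
    unfolding r using t pos norm_add_axis[OF x(1) e x(2), of t]
    by (simp add: abs_div abs_mult real_div_sqrt flip: times_divide_eq_left)
       (simp add: field_simps flip: real_sqrt_mult)
  have "1 + ((t - 1 / t) / 2)\<^sup>2 = ((1 + t\<^sup>2) / (- 2 * t))\<^sup>2"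
    using t by (simp add: field_simps power2_eq_square)
  then show s: "sqrt (1 + ((t - 1 / t) / 2)\<^sup>2) = (1 + t\<^sup>2) / (- 2 * t)"
    using t pos by (simp add: real_sqrt_abs divide_less_0_iff abs_div)
  have n: "norm (x + ((t - 1 / t) / 2) *\<^sub>R e) = (1 + t\<^sup>2) / (- 2 * t)"
    unfolding norm_add_axis[OF x(1) e x(2)] by (rule s)
  have c1: "inverse ((1 + t\<^sup>2) / (- 2 * t)) = - (2 * t / (1 + t\<^sup>2))"
    using t pos by (simp add: field_simps)
  have c2: "- (2 * t / (1 + t\<^sup>2)) * ((t - 1 / t) / 2) = 1 - (2 * t / (1 + t\<^sup>2)) * t"
    using t pos by (simp add: divide_simps) (simp add: algebra_simps power2_eq_square)
  show "sgn (x + ((t - 1 / t) / 2) *\<^sub>R e) = reflect (x + t *\<^sub>R e) e"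
    unfolding sgn_div_norm n c1 r scaleR_add_right scaleR_scaleR c2
    by (simp add: algebra_simps)
qed

text \<open>The kernel is exactly the Jacobian of \<open>w \<mapsto> reflect w x\<close>, a double cover of the sphere.\<close>

lemma sphere_int_kernel_reflect:
  fixes g :: "'a::euclidean_space \<Rightarrow> ennreal"
  assumes [measurable]: "g \<in> borel_measurable borel" and e: "norm e = 1" and d: "2 \<le> DIM('a)"
  shows "sphere_int (\<lambda>y. g y * ennreal (1 / norm (e - y) ^ (DIM('a) - 2))) = sphere_int (\<lambda>w. g (reflect w e))"
proof -
  define D where "D = DIM('a)"
  let ?T = "\<lambda>t::real. (t - 1 / t) / 2"
  \<comment> \<open>Both sides are expressed through \<open>N\<close>, the integral over directions
    of negative slope on the meridian of x. On the left the substitution (t - 1/t) / 2 covers the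
    whole meridian and yields 2 N x. On the right the positive slopes are moved to the meridian of
    -x, which yields N x + N (-x). Symmetry of the equator makes the two agree.\<close>
  define N where "N x = (\<integral>\<^sup>+t. g (reflect (x + t *\<^sub>R e) e) * ennreal (1 / sqrt (1 + t\<^sup>2) ^ D) * indicator {..<0} t \<partial>lborel)" for x
  have [measurable]: "N \<in> borel_measurable borel" unfolding N_def by measurable
  have L: "(\<integral>\<^sup>+t. g (sgn (x + t *\<^sub>R e)) * ennreal (1 / norm (e - sgn (x + t *\<^sub>R e)) ^ (D - 2)) *
      ennreal (1 / sqrt (1 + t\<^sup>2) ^ D) \<partial>lborel) = 2 * N x" (is "?L = _")
    if x: "norm x = 1" "x \<bullet> e = 0" for x
  proof -
    let ?F = "\<lambda>t. g (sgn (x + t *\<^sub>R e)) * ennreal (1 / norm (e - sgn (x + t *\<^sub>R e)) ^ (D - 2)) * ennreal (1 / sqrt (1 + t\<^sup>2) ^ D)"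
    \<comment> \<open>The preimage is the negative root of t^2 - 2 y t - 1 = 0.\<close>
    have "y \<in> ?T ` {..<0}" for y
    proof
      have "sqrt (y\<^sup>2 + 1) > \<bar>y\<bar>" by (rule real_less_rsqrt) simp
      then have neg: "y - sqrt (y\<^sup>2 + 1) < 0" by (simp add: abs_if split: if_splits)
      show "y - sqrt (y\<^sup>2 + 1) \<in> {..<0}" using neg by simp
      have "(y - sqrt (y\<^sup>2 + 1)) * (y + sqrt (y\<^sup>2 + 1)) = -1"
        by (simp add: algebra_simps flip: power2_eq_square)
      then have "1 / (y - sqrt (y\<^sup>2 + 1)) = - (y + sqrt (y\<^sup>2 + 1))"
        using neg by (simp add: field_simps)
      then show "y = ?T (y - sqrt (y\<^sup>2 + 1))" by simp
    qed
    then have im: "?T ` {..<0} = UNIV" by auto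
    have "?L = (\<integral>\<^sup>+t. ?F t * indicator (?T ` {..<0}) t \<partial>lborel)" by (simp add: im)
    also have "\<dots> = (\<integral>\<^sup>+t. ?F (?T t) * ennreal ((1 + 1 / t\<^sup>2) / 2) * indicator {..<0} t \<partial>lborel)"
    proof (rule nn_integral_substitution_open[where a="-\<infinity>" and b=0])
      show "{..<0} = einterval (-\<infinity>) 0" by (auto simp: einterval_def)
    qed (auto intro!: derivative_eq_intros continuous_intros simp: power2_eq_square)
    also have "\<dots> = (\<integral>\<^sup>+t. 2 * (g (reflect (x + t *\<^sub>R e) e) * ennreal (1 / sqrt (1 + t\<^sup>2) ^ D) * indicator {..<0} t) \<partial>lborel)"
    proof (rule nn_integral_cong)
      fix t :: real
      show "?F (?T t) * ennreal ((1 + 1 / t\<^sup>2) / 2) * indicator {..<0} t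
        = 2 * (g (reflect (x + t *\<^sub>R e) e) * ennreal (1 / sqrt (1 + t\<^sup>2) ^ D) * indicator {..<0} t)"
      proof (cases "t < 0")
        case t: True
        define r where "r = sqrt (1 + t\<^sup>2)"
        define s where "s = - t"
        have s: "s > 0" using t by (simp add: s_def)
        have r: "r > 0" "r\<^sup>2 = 1 + t\<^sup>2" by (simp_all add: r_def add_pos_nonneg)
        have r': "1 + 1 / t\<^sup>2 = r\<^sup>2 / s\<^sup>2" using t by (simp add: r(2) s_def field_simps)
        obtain k where k: "D = k + 2" using d by (metis D_def add.commute le_Suc_ex)
        \<comment> \<open>The kernel at the image, the cylinder Jacobian at the new slope and the
          derivative of the substitution multiply to twice the cylinder Jacobian at the old slope.
          This cancellation is what singles out the exponent D - 2.\<close>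
        have "1 / (2 * s / r) ^ k * (1 / (r\<^sup>2 / (2 * s)) ^ (k + 2)) * (r\<^sup>2 / s\<^sup>2 / 2) = 2 * (1 / r ^ (k + 2))"
          using r(1) s by (simp add: power_divide power_mult_distrib divide_simps) (simp add: power_add power2_eq_square power4_eq_xxxx power_mult_distrib algebra_simps)
        then have "ennreal (1 / (2 * s / r) ^ k) * ennreal (1 / (r\<^sup>2 / (2 * s)) ^ (k + 2)) * ennreal (r\<^sup>2 / s\<^sup>2 / 2) = 2 * ennreal (1 / r ^ (k + 2))"
          using r(1) s by (simp flip: ennreal_mult ennreal_numeral)
        then have ABC: "G * ennreal (1 / (2 * s / r) ^ k) * ennreal (1 / (r\<^sup>2 / (2 * s)) ^ (k + 2)) * ennreal (r\<^sup>2 / s\<^sup>2 / 2) = 2 * (G * ennreal (1 / r ^ (k + 2)))" for G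
          by (simp only: mult.assoc mult.left_commute[of 2])
        have q: "- 2 * t / r = 2 * s / r" "(1 + t\<^sup>2) / (- 2 * t) = r\<^sup>2 / (2 * s)" "sqrt (1 + t\<^sup>2) = r" "D - 2 = k"
          by (simp_all add: r(2) s_def k flip: r_def)
        have "indicator {..<0} t = (1::ennreal)" using t by simp
        then show ?thesis
          unfolding reflect_axis[OF e x t] q r' unfolding k using ABC by simp
      qed simp
    qed
    also have "\<dots> = 2 * N x" unfolding N_def by (rule nn_integral_cmult) measurable
    finally show ?thesis .
  qed
  have R: "(\<integral>\<^sup>+t. g (reflect (sgn (x + t *\<^sub>R e)) e) * ennreal (1 / sqrt (1 + t\<^sup>2) ^ D) \<partial>lborel) = N x + N (- x)" for x
  proof -
    let ?G = "\<lambda>t. g (reflect (x + t *\<^sub>R e) e) * ennreal (1 / sqrt (1 + t\<^sup>2) ^ D)"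
    have "(\<integral>\<^sup>+t. ?G t \<partial>lborel) = (\<integral>\<^sup>+t. ?G t * indicator {..<0} t + ?G t * indicator {0<..} t \<partial>lborel)"
      by (intro nn_integral_cong_AE eventually_mono[OF AE_lborel_singleton[of 0]]) (auto simp: indicator_def)
    also have "\<dots> = N x + (\<integral>\<^sup>+t. ?G t * indicator {0<..} t \<partial>lborel)"
      unfolding N_def by (rule nn_integral_add) measurable
    also have "(\<integral>\<^sup>+t. ?G t * indicator {0<..} t \<partial>lborel) = (\<integral>\<^sup>+t. ?G (-t) * indicator {0<..} (-t) \<partial>lborel)"
      by (rule nn_integral_lborel_uminus[symmetric]) measurable
    also have "\<dots> = N (- x)"
      unfolding N_def
    proof (rule nn_integral_cong)
      fix t :: real
      have "reflect (x + (- t) *\<^sub>R e) e = reflect (- x + t *\<^sub>R e) e"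
        using reflect_uminus[of "x + (- t) *\<^sub>R e" e] by simp
      then show "?G (-t) * indicator {0<..} (-t) = g (reflect (- x + t *\<^sub>R e) e) * ennreal (1 / sqrt (1 + t\<^sup>2) ^ D) * indicator {..<0} t"
        by (simp add: indicator_def)
    qed
    finally show ?thesis by (simp add: reflect_sgn)
  qed
  have "sphere_int (\<lambda>y. g y * ennreal (1 / norm (e - y) ^ (D - 2))) = equator_int e (\<lambda>x. 2 * N x)"
    using L by (subst sphere_int_cylinder[OF _ e d]) (auto simp flip: D_def intro!: equator_int_cong[OF e d])
  also have "\<dots> = equator_int e N + equator_int e N"
    using equator_int_cmult[of N e 2] by (simp add: mult_2)
  also have "\<dots> = equator_int e N + equator_int e (\<lambda>x. N (- x))"
    by (simp add: equator_int_uminus)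
  also have "\<dots> = equator_int e (\<lambda>x. N x + N (- x))"
    by (rule equator_int_add[symmetric]) measurable
  also have "\<dots> = sphere_int (\<lambda>w. g (reflect w e))"
    by (subst sphere_int_cylinder[OF _ e d]) (simp_all add: R flip: D_def)
  finally show ?thesis by (simp only: D_def)
qed

section \<open>Line integrals of truncated Beta densities\<close>

text \<open>Rescaling to the arcsine density on (-1, 1) removes \<open>c\<close> from the value.
  This independence is what makes the later line integrals elementary.\<close>

lemma nn_integral_arcsine:
  assumes c: "c > 0" and s: "s > 0"
  shows "(\<integral>\<^sup>+t. ennreal (1 / sqrt (c - s * t\<^sup>2)) * indicator {t. s * t\<^sup>2 < c} t \<partial>lborel) = ennreal (pi / sqrt s)"
proof -
  define l where "l = sqrt (c / s)"
  have l: "l > 0" "l\<^sup>2 = c / s" using c s by (simp_all add: l_def)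
  have lt: "s * (l * t)\<^sup>2 = c * t\<^sup>2" for t using s l by (simp add: power_mult_distrib)
  have im: "sin ` {-(pi/2)<..<pi/2} = {-1<..<1}"
  proof (intro subset_antisym subsetI)
    fix y assume "y \<in> sin ` {-(pi/2)<..<pi/2}"
    then obtain x where x: "y = sin x" "-(pi/2) < x" "x < pi/2" by auto
    then have "sin x < sin (pi/2)" "sin (-(pi/2)) < sin x"
      by (simp_all only: sin_mono_less_eq less_imp_le order_refl pi_half_ge_zero)
    then show "y \<in> {-1<..<1}" using x by simp
  next
    fix y :: real assume "y \<in> {-1<..<1}"
    then have "y = sin (arcsin y)" "-(pi/2) < arcsin y" "arcsin y < pi/2"
      using arcsin_lt_bounded[of y] by auto
    then show "y \<in> sin ` {-(pi/2)<..<pi/2}" by (intro image_eqI[of _ _ "arcsin y"]) auto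
  qed
  let ?F = "\<lambda>w. ennreal (1 / sqrt (1 - w\<^sup>2))"
  have "(\<integral>\<^sup>+w. ?F w * indicator (sin ` {-(pi/2)<..<pi/2}) w \<partial>lborel) =
    (\<integral>\<^sup>+x. ?F (sin x) * ennreal (cos x) * indicator {-(pi/2)<..<pi/2} x \<partial>lborel)"
  proof (rule nn_integral_substitution_open[where a="-(pi/2)" and b="pi/2"])
    show "{-(pi/2)<..<pi/2} = einterval (ereal (-(pi/2))) (ereal (pi/2))"
      by (auto simp: einterval_def)
  qed (auto intro!: derivative_eq_intros continuous_intros less_imp_le[OF cos_gt_zero_pi])
  also have "\<dots> = (\<integral>\<^sup>+x. indicator {-(pi/2)<..<pi/2} x \<partial>lborel)"
  proof (rule nn_integral_cong)
    fix x :: real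
    show "?F (sin x) * ennreal (cos x) * indicator {-(pi/2)<..<pi/2} x = indicator {-(pi/2)<..<pi/2} x"
    proof (cases "x \<in> {-(pi/2)<..<pi/2}")
      case True
      then have "cos x > 0" by (auto intro: cos_gt_zero_pi)
      then show ?thesis by (simp add: cos_squared_eq[symmetric] flip: ennreal_mult)
    qed simp
  qed
  also have "\<dots> = ennreal pi" by simp
  finally have base: "(\<integral>\<^sup>+w. ?F w * indicator {-1<..<1} w \<partial>lborel) = ennreal pi" by (simp only: im)
  let ?G = "\<lambda>t. ennreal (1 / sqrt (c - s * t\<^sup>2)) * indicator {t. s * t\<^sup>2 < c} t"
  have "(\<integral>\<^sup>+t. ?G t \<partial>lborel) = ennreal l * (\<integral>\<^sup>+w. ?G (l * w) \<partial>lborel)"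
    using nn_integral_real_affine[of ?G l 0] l by simp
  also have "(\<integral>\<^sup>+w. ?G (l * w) \<partial>lborel) = (\<integral>\<^sup>+w. ennreal (1 / sqrt c) * (?F w * indicator {-1<..<1} w) \<partial>lborel)"
  proof (rule nn_integral_cong)
    fix w
    have i: "indicator {t. s * t\<^sup>2 < c} (l * w) = (indicator {-1<..<1} w :: ennreal)"
      using c by (auto simp: indicator_def lt abs_square_less_1 abs_less_iff)
    have "c - s * (l * w)\<^sup>2 = c * (1 - w\<^sup>2)" by (simp only: lt) (simp add: algebra_simps)
    then have "1 / sqrt (c - s * (l * w)\<^sup>2) = 1 / sqrt c * (1 / sqrt (1 - w\<^sup>2))"
      by (simp add: real_sqrt_mult)
    then show "?G (l * w) = ennreal (1 / sqrt c) * (?F w * indicator {-1<..<1} w)"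
      using ennreal_mult'[of "1 / sqrt c" "1 / sqrt (1 - w\<^sup>2)"] c
      by (simp only: i mult.assoc) (simp add: mult.assoc)
  qed
  also have "\<dots> = ennreal (1 / sqrt c) * ennreal pi"
    by (subst nn_integral_cmult) (simp_all add: base)
  also have "ennreal l * \<dots> = ennreal (pi / sqrt s)"
    using c s by (simp add: l_def real_sqrt_divide flip: ennreal_mult)
  finally show ?thesis .
qed

lemma nn_integral_powr_from_0:
  assumes a: "a > -1" and c: "c \<ge> 0"
  shows "(\<integral>\<^sup>+s. ennreal (s powr a) * indicator {0<..<c} s \<partial>lborel) = ennreal (c powr (a + 1) / (a + 1))"
proof -
  have "(\<integral>\<^sup>+s. ennreal (s powr a) * indicator {0<..<c} s \<partial>lborel) =
    (\<integral>\<^sup>+s. ennreal (indicator {0..c} s * s powr a) \<partial>lborel)"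
    by (intro nn_integral_cong_AE eventually_mono[OF eventually_conj[OF AE_lborel_singleton[of 0] AE_lborel_singleton[of c]]])
      (auto simp: indicator_def)
  also have "\<dots> = ennreal (c powr (a + 1) / (a + 1))"
    by (rule nn_integral_has_integral_lebesgue) (use has_integral_powr_from_0[OF a c] in auto)
  finally show ?thesis .
qed

text \<open>As a function of \<open>p = 1 - y \<bullet> n\<close> this is, up to a constant, the density whose potential equals the field of
  the point charge on the cap \<open>c \<le> p\<close>; \<open>head_beta\<close> below is the equilibrium density.\<close>

definition tail_beta :: "real \<Rightarrow> real \<Rightarrow> real \<Rightarrow> ennreal"
  where "tail_beta m c p = (\<integral>\<^sup>+u. ennreal (u powr m / sqrt (1 - u)) * indicator {u. 0 < u \<and> u < 1 \<and> u * p < c} u \<partial>lborel)"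

lemma tail_beta_measurable [measurable]: "tail_beta m c \<in> borel_measurable borel"
  unfolding tail_beta_def indicator_def mem_Collect_eq by measurable

text \<open>With s = u p the truncation u p < c becomes s < c, which no longer involves p. This
  prepares the exchange of the s-integral with an integral along which p varies.\<close>

lemma tail_beta_eq:
  assumes p: "p > 0"
  shows "tail_beta m c p = (\<integral>\<^sup>+s. ennreal (p powr (- (m + 1/2)) * (s powr m / sqrt (p - s))) * indicator {s. 0 < s \<and> s < p \<and> s < c} s \<partial>lborel)"
proof -
  let ?G = "\<lambda>u. ennreal (u powr m / sqrt (1 - u)) * indicator {u. 0 < u \<and> u < 1 \<and> u * p < c} u"
  have [measurable]: "?G \<in> borel_measurable borel" unfolding indicator_def mem_Collect_eq by measurable
  have "tail_beta m c p = ennreal (1/p) * (\<integral>\<^sup>+s. ?G (1/p * s) \<partial>lborel)"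
    using nn_integral_real_affine[of ?G "1/p" 0] p by (simp add: tail_beta_def)
  also have "\<dots> = (\<integral>\<^sup>+s. ennreal (1/p) * ?G (1/p * s) \<partial>lborel)"
    by (rule nn_integral_cmult[symmetric]) measurable
  also have "\<dots> = (\<integral>\<^sup>+s. ennreal (p powr (- (m + 1/2)) * (s powr m / sqrt (p - s))) * indicator {s. 0 < s \<and> s < p \<and> s < c} s \<partial>lborel)"
  proof (rule nn_integral_cong)
    fix s
    show "ennreal (1/p) * ?G (1/p * s) = ennreal (p powr (- (m + 1/2)) * (s powr m / sqrt (p - s))) * indicator {s. 0 < s \<and> s < p \<and> s < c} s"
    proof (cases "0 < s \<and> s < p \<and> s < c")
      case True
      have pp: "p powr (- (m + 1/2)) = inverse (p powr m * sqrt p)"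
        using p unfolding powr_minus powr_add by (simp add: powr_half_sqrt)
      have "1 - 1/p * s = (p - s) / p" using p by (simp add: field_simps)
      then have "1/p * ((1/p * s) powr m / sqrt (1 - 1/p * s)) = p powr (- (m + 1/2)) * (s powr m / sqrt (p - s))"
        unfolding pp using p True by (simp add: powr_divide real_sqrt_divide divide_simps)
      then show ?thesis using True p by (simp add: indicator_def flip: ennreal_mult)
    qed (use p in \<open>auto simp: indicator_def field_simps\<close>)
  qed
  finally show ?thesis .
qed

text \<open>The line integral along a chord direction; \<open>Q\<close> and \<open>a\<close> are the values of \<open>chord_form\<close> (defined below)
  and of the squared norm on the orthogonal complement.\<close>

lemma nn_integral_tail_beta_line:
  fixes D :: nat
  assumes Q: "Q > 0" and a: "a > 0" and c: "c > 0" and D: "D \<ge> 2"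
  shows "(\<integral>\<^sup>+t. tail_beta ((real D - 2) / 2) c (Q / (a + t\<^sup>2)) * ennreal (sqrt (Q / (a + t\<^sup>2)) ^ D) \<partial>lborel)
    = ennreal (pi * sqrt Q * (min c (Q / a) powr ((real D - 1) / 2) / ((real D - 1) / 2)))"
proof -
  define m where "m = (real D - 2) / 2"
  \<comment> \<open>The arcsine kernel in t splits off because (p - s) (a + t^2) = Q - s a - s t^2
    for p = Q / (a + t^2).\<close>
  let ?H = "\<lambda>t s. ennreal (s powr m * sqrt Q) * (ennreal (1 / sqrt (Q - s * a - s * t\<^sup>2)) * indicator {t. s * t\<^sup>2 < Q - s * a} t) * indicator {0<..<c} s"
  have mH [measurable]: "(\<lambda>(t, s). ?H t s) \<in> borel_measurable (borel \<Otimes>\<^sub>M borel)"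
    unfolding indicator_def mem_Collect_eq by measurable
  have 1: "tail_beta m c (Q / (a + t\<^sup>2)) * ennreal (sqrt (Q / (a + t\<^sup>2)) ^ D) = (\<integral>\<^sup>+s. ?H t s \<partial>lborel)" for t
  proof -
    define p where "p = Q / (a + t\<^sup>2)"
    have at: "a + t\<^sup>2 > 0" using a by (simp add: add_pos_nonneg)
    have p: "p > 0" using Q at by (simp add: p_def)
    have pw: "sqrt p ^ D = p powr (real D / 2)"
      using p by (simp add: powr_half_sqrt[symmetric] powr_realpow[symmetric] powr_powr)
    have "tail_beta m c p * ennreal (sqrt p ^ D) = (\<integral>\<^sup>+s. ennreal (p powr (- (m + 1/2)) * (s powr m / sqrt (p - s))) *
        indicator {s. 0 < s \<and> s < p \<and> s < c} s * ennreal (sqrt p ^ D) \<partial>lborel)"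
      unfolding tail_beta_eq[OF p] by (rule nn_integral_multc[symmetric]) measurable
    also have "\<dots> = (\<integral>\<^sup>+s. ?H t s \<partial>lborel)"
    proof (rule nn_integral_cong)
      fix s
      have iff: "s * t\<^sup>2 < Q - s * a \<longleftrightarrow> s < p"
        using at by (simp add: p_def pos_less_divide_eq algebra_simps)
      show "ennreal (p powr (- (m + 1/2)) * (s powr m / sqrt (p - s))) *
        indicator {s. 0 < s \<and> s < p \<and> s < c} s * ennreal (sqrt p ^ D) = ?H t s"
      proof (cases "0 < s \<and> s < p \<and> s < c")
        case True
        \<comment> \<open>The exponent of the Beta weight is chosen for this cancellation: -(m +
          1/2) + D/2 = 1/2.\<close>
        have e: "p powr (- (m + 1/2)) * p powr (real D / 2) = sqrt p"
          using p by (simp add: m_def field_simps flip: powr_add powr_half_sqrt)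
        have "Q - s * a - s * t\<^sup>2 = (p - s) * (a + t\<^sup>2)" using at by (simp add: p_def field_simps)
        then have f: "sqrt Q / sqrt (Q - s * a - s * t\<^sup>2) = sqrt p / sqrt (p - s)"
          using at True Q by (simp add: p_def real_sqrt_mult real_sqrt_divide)
        have "p powr (- (m + 1/2)) * (s powr m / sqrt (p - s)) * (sqrt p ^ D)
           = s powr m * (p powr (- (m + 1/2)) * p powr (real D / 2)) / sqrt (p - s)"
          by (simp add: pw)
        also have "\<dots> = s powr m * sqrt Q * (1 / sqrt (Q - s * a - s * t\<^sup>2))"
          unfolding e using arg_cong[OF f, of "\<lambda>u. s powr m * u"] by simp
        finally have g: "p powr (- (m + 1/2)) * (s powr m / sqrt (p - s)) * (sqrt p ^ D) = s powr m * sqrt Q * (1 / sqrt (Q - s * a - s * t\<^sup>2))" .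
        have "ennreal (p powr (- (m + 1/2)) * (s powr m / sqrt (p - s))) * ennreal (sqrt p ^ D)
          = ennreal (p powr (- (m + 1/2)) * (s powr m / sqrt (p - s)) * sqrt p ^ D)"
          using True p by (intro ennreal_mult[symmetric]) auto
        also have "\<dots> = ennreal (s powr m * sqrt Q * (1 / sqrt (Q - s * a - s * t\<^sup>2)))" by (simp only: g)
        also have "\<dots> = ennreal (s powr m * sqrt Q) * ennreal (1 / sqrt (Q - s * a - s * t\<^sup>2))"
          using True p Q iff by (intro ennreal_mult) auto
        finally have "ennreal (p powr (- (m + 1/2)) * (s powr m / sqrt (p - s))) * ennreal (sqrt p ^ D)
          = ennreal (s powr m * sqrt Q) * ennreal (1 / sqrt (Q - s * a - s * t\<^sup>2))" .
        then show ?thesis using True iff by (simp add: indicator_def)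
      qed (auto simp: indicator_def iff)
    qed
    finally show ?thesis by (simp only: p_def)
  qed
  \<comment> \<open>The range of t is nonempty only for s < Q / a; together with s < c this produces
    the minimum.\<close>
  have 2: "(\<integral>\<^sup>+t. ?H t s \<partial>lborel) = ennreal (pi * sqrt Q) * (ennreal (s powr ((real D - 3) / 2)) * indicator {0<..<min c (Q / a)} s)" for s
  proof -
    have "(\<integral>\<^sup>+t. ?H t s \<partial>lborel) = ennreal (s powr m * sqrt Q) * (\<integral>\<^sup>+t. ennreal (1 / sqrt (Q - s * a - s * t\<^sup>2)) * indicator {t. s * t\<^sup>2 < Q - s * a} t \<partial>lborel) * indicator {0<..<c} s"
      by (subst nn_integral_multc, measurable, subst nn_integral_cmult, measurable)
    also have "\<dots> = ennreal (pi * sqrt Q) * (ennreal (s powr ((real D - 3) / 2)) * indicator {0<..<min c (Q / a)} s)"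
    proof (cases "0 < s \<and> s < c")
      case s: True
      show ?thesis
      proof (cases "s * a < Q")
        case True
        have m': "(real D - 3) / 2 = m - 1/2" by (simp add: m_def field_simps)
        have "s powr m / sqrt s = s powr ((real D - 3) / 2)"
          unfolding m' using s by (simp add: powr_diff powr_half_sqrt)
        from arg_cong[OF this, of "\<lambda>u. pi * sqrt Q * u"]
        have e: "s powr m * sqrt Q * (pi / sqrt s) = pi * sqrt Q * s powr ((real D - 3) / 2)" by (simp add: mult_ac)
        have "s \<in> {0<..<min c (Q / a)}" using s True a by (simp add: field_simps)
        moreover have "ennreal (s powr m * sqrt Q) * ennreal (pi / sqrt s) = ennreal (pi * sqrt Q) * ennreal (s powr ((real D - 3) / 2))"
          using s Q e by (simp flip: ennreal_mult)
        ultimately show ?thesis using True s nn_integral_arcsine[of "Q - s * a" s] by simp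
      next
        case False
        then have "{t. s * t\<^sup>2 < Q - s * a} = {}" using s
          by (smt (verit) Collect_empty_eq mult_nonneg_nonneg zero_le_power2)
        moreover have "s \<notin> {0<..<min c (Q / a)}" using s False a by (simp add: field_simps)
        ultimately show ?thesis by simp
      qed
    qed auto
    finally show ?thesis .
  qed
  have "(\<integral>\<^sup>+t. tail_beta m c (Q / (a + t\<^sup>2)) * ennreal (sqrt (Q / (a + t\<^sup>2)) ^ D) \<partial>lborel) = (\<integral>\<^sup>+t. (\<integral>\<^sup>+s. ?H t s \<partial>lborel) \<partial>lborel)"
    by (simp only: 1)
  also have "\<dots> = (\<integral>\<^sup>+s. (\<integral>\<^sup>+t. ?H t s \<partial>lborel) \<partial>lborel)"
    using lborel_pair.Fubini'[of "\<lambda>t s. ?H t s"] mH by simp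
  also have "\<dots> = ennreal (pi * sqrt Q) * (\<integral>\<^sup>+s. ennreal (s powr ((real D - 3) / 2)) * indicator {0<..<min c (Q / a)} s \<partial>lborel)"
    unfolding 2 by (rule nn_integral_cmult) measurable
  also have "(\<integral>\<^sup>+s. ennreal (s powr ((real D - 3) / 2)) * indicator {0<..<min c (Q / a)} s \<partial>lborel)
      = ennreal (min c (Q / a) powr ((real D - 3) / 2 + 1) / ((real D - 3) / 2 + 1))"
    using D a c Q by (intro nn_integral_powr_from_0) auto
  also have "(real D - 3) / 2 + 1 = (real D - 1) / 2" by (simp add: field_simps)
  also have "ennreal (pi * sqrt Q) * ennreal (min c (Q / a) powr ((real D - 1) / 2) / ((real D - 1) / 2))
     = ennreal (pi * sqrt Q * (min c (Q / a) powr ((real D - 1) / 2) / ((real D - 1) / 2)))"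
    using Q D by (intro ennreal_mult[symmetric]) auto
  finally show ?thesis by (simp only: m_def)
qed

section \<open>Potentials of zonal densities\<close>

definition chord_dir :: "'a::euclidean_space \<Rightarrow> 'a \<Rightarrow> 'a"
  where "chord_dir x n = sgn (n - x)"

text \<open>Equal to \<open>(norm z)\<^sup>2 * (1 - reflect z x \<bullet> n)\<close>. It does not change along the chord from \<open>x\<close> to \<open>n\<close>, which is why
  slicing in that direction makes the potential explicit.\<close>

definition chord_form :: "'a::euclidean_space \<Rightarrow> 'a \<Rightarrow> 'a \<Rightarrow> real"
  where "chord_form x n z = (1 - x \<bullet> n) * (norm (perp (chord_dir x n) z))\<^sup>2 + 2 * (x \<bullet> perp (chord_dir x n) z)\<^sup>2"

lemma chord_form_measurable [measurable]: "chord_form x n \<in> borel_measurable borel"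
  unfolding chord_form_def by measurable

lemma chord_form_scaleR: "chord_form x n (l *\<^sub>R z) = l\<^sup>2 * chord_form x n z"
  by (simp add: chord_form_def perp_scaleR power_mult_distrib algebra_simps)

context
  fixes x n :: "'a::euclidean_space" and l e
  assumes x: "norm x = 1" and n: "norm n = 1" and xn: "x \<noteq> n"
  defines "l \<equiv> 1 - x \<bullet> n" and "e \<equiv> chord_dir x n"
begin

lemma norm_chord: "(norm (n - x))\<^sup>2 = 2 * l"
  using x n by (simp add: l_def power2_norm_eq_inner inner_diff_left inner_diff_right norm_eq_1 inner_commute)

lemma chord_pos: "0 < l" 
  using norm_chord xn by (smt (verit) right_minus_eq zero_less_norm_iff zero_less_power)

lemma norm_chord_dir: "norm e = 1"
  using xn by (simp add: e_def chord_dir_def norm_sgn)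

lemma inner_chord_dir: "(n - x) \<bullet> z = sqrt (2 * l) * (z \<bullet> e)" "n \<bullet> e = sqrt (l / 2)" "x \<bullet> e = - sqrt (l / 2)"
proof -
  have s: "norm (n - x) = sqrt (2 * l)" using norm_chord by (metis norm_ge_zero real_sqrt_unique)
  have e: "e = (n - x) /\<^sub>R sqrt (2 * l)" by (simp add: e_def chord_dir_def sgn_div_norm s)
  have q: "inverse (sqrt (2 * l)) * l = sqrt (l / 2)"
    using chord_pos by (simp add: real_sqrt_mult real_sqrt_divide field_simps)
  show "(n - x) \<bullet> z = sqrt (2 * l) * (z \<bullet> e)" using chord_pos by (simp add: e inner_commute)
  show "n \<bullet> e = sqrt (l / 2)"
    using n q by (simp add: e inner_diff_right norm_eq_1 inner_commute l_def)
  show "x \<bullet> e = - sqrt (l / 2)"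
    using x q by (simp add: e inner_diff_right norm_eq_1 l_def) (simp add: algebra_simps)
qed

text \<open>Since n - x is a multiple of \<open>e\<close>, the terms in z \<bullet> e cancel. The
  definition shows that the form is constant along \<open>e\<close>; this version connects it with
  the reflection of x.\<close>

lemma chord_form_eq: "chord_form x n z = l * (z \<bullet> z) + 2 * (x \<bullet> z) * (n \<bullet> z)"
proof -
  have ee: "e \<bullet> e = 1" using norm_chord_dir by (simp add: norm_eq_1)
  have nz: "n \<bullet> z = x \<bullet> z + sqrt (2 * l) * (z \<bullet> e)" using inner_chord_dir(1)[of z] by (simp add: inner_diff_left)
  have 1: "(norm (perp e z))\<^sup>2 = z \<bullet> z - (z \<bullet> e)\<^sup>2"
    unfolding power2_norm_eq_inner perp_def
    by (simp add: inner_diff_left inner_diff_right ee inner_commute[of e z] power2_eq_square)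
  have 2: "x \<bullet> perp e z = x \<bullet> z + sqrt (l / 2) * (z \<bullet> e)"
    by (simp add: perp_def inner_diff_right inner_chord_dir(3))
  have 3: "sqrt (2 * l) = 2 * sqrt (l / 2)"
    using real_sqrt_mult[of 4 "l / 2"] by simp
  have 4: "sqrt (l / 2) * sqrt (l / 2) = l / 2" using chord_pos by simp
  have "chord_form x n z = l * (z \<bullet> z - (z \<bullet> e)\<^sup>2) + 2 * (x \<bullet> z + sqrt (l / 2) * (z \<bullet> e))\<^sup>2"
    unfolding chord_form_def l_def[symmetric] e_def[symmetric] 1 2 ..
  also have "\<dots> = l * (z \<bullet> z) - l * (z \<bullet> e)\<^sup>2 + 2 * (x \<bullet> z)\<^sup>2 + 4 * (x \<bullet> z) * (sqrt (l / 2) * (z \<bullet> e)) + 2 * (sqrt (l / 2) * sqrt (l / 2)) * (z \<bullet> e)\<^sup>2"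
    by (simp add: algebra_simps power2_eq_square)
  also have "\<dots> = l * (z \<bullet> z) + 2 * (x \<bullet> z) * (n \<bullet> z)"
    unfolding 4 nz 3 by (simp add: algebra_simps power2_eq_square)
  finally show ?thesis .
qed

text \<open>By this bound c is the smaller entry of the minimum in
  \<open>potential_tail_beta\<close> whenever c \<le> 1 - x \<bullet> n, that is for x in the
  cap.\<close>

lemma chord_form_ge: "l * (norm (perp e z))\<^sup>2 \<le> chord_form x n z"
  by (simp add: chord_form_def l_def e_def)

lemma chord_form_pos: "perp e z \<noteq> 0 \<Longrightarrow> 0 < chord_form x n z"
  using chord_form_ge[of z] chord_pos by (smt (verit) mult_pos_pos zero_less_norm_iff zero_less_power)

lemma reflect_chord: "z \<noteq> 0 \<Longrightarrow> 1 - reflect z x \<bullet> n = chord_form x n z / (norm z)\<^sup>2"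
  by (simp add: chord_form_eq reflect_def inner_diff_left l_def dot_square_norm inner_commute[of n z] field_simps)

text \<open>The body \<open>chord_form x n z \<le> 1\<close> has the square root of
  \<open>chord_form\<close> as its gauge and is invariant along \<open>e\<close>. Its slices in that
  direction are whole lines, and \<open>nn_integral_tail_beta_line\<close> integrates them
  exactly.\<close>

lemma potential_tail_beta:
  assumes d: "2 \<le> DIM('a)" and c: "c > 0"
  shows "sphere_int (\<lambda>y. tail_beta ((real DIM('a) - 2) / 2) c (1 - y \<bullet> n) * ennreal (1 / norm (x - y) ^ (DIM('a) - 2))) =
    ennreal (real DIM('a)) * (\<integral>\<^sup>+z. ennreal (pi * sqrt (chord_form x n z) * (min c (chord_form x n z / (norm (perp e z))\<^sup>2) powr ((real DIM('a) - 1) / 2) / ((real DIM('a) - 1) / 2)))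
      * indicator (slab e \<inter> {z. chord_form x n z \<le> 1}) z \<partial>lborel)"
proof -
  let ?D = "DIM('a)" and ?Q = "chord_form x n"
  let ?A = "tail_beta ((real DIM('a) - 2) / 2) c"
  note e1 = norm_chord_dir
  let ?F = "\<lambda>z. ?A (1 - reflect (sgn z) x \<bullet> n) * ennreal ((sqrt (?Q z) / norm z) ^ ?D) * indicator {z. sqrt (?Q z) \<le> 1} z"
  have "sphere_int (\<lambda>y. ?A (1 - y \<bullet> n) * ennreal (1 / norm (x - y) ^ (?D - 2))) = sphere_int (\<lambda>w. ?A (1 - reflect w x \<bullet> n))"
    by (rule sphere_int_kernel_reflect[OF _ x d]) measurable
  also have "\<dots> = ennreal (real ?D) * (\<integral>\<^sup>+z. ?F z \<partial>lborel)"
  proof (rule sphere_int_cross_section)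
    show "AE z in lborel. 0 < sqrt (?Q z)"
      by (rule eventually_mono[OF AE_perp_nonzero[OF e1 d]]) (simp add: chord_form_pos)
  qed (auto simp: chord_form_scaleR real_sqrt_mult)
  also have "(\<integral>\<^sup>+z. ?F z \<partial>lborel) = (\<integral>\<^sup>+z. (\<integral>\<^sup>+s. ?F (perp e z + s *\<^sub>R e) \<partial>lborel) * indicator (slab e) z \<partial>lborel)"
    by (rule nn_integral_slab[OF _ e1]) measurable
  also have "\<dots> = (\<integral>\<^sup>+z. ennreal (pi * sqrt (?Q z) * (min c (?Q z / (norm (perp e z))\<^sup>2) powr ((real ?D - 1) / 2) / ((real ?D - 1) / 2)))
      * indicator (slab e \<inter> {z. ?Q z \<le> 1}) z \<partial>lborel)"
  proof (rule nn_integral_cong_AE, rule eventually_mono[OF AE_perp_nonzero[OF e1 d]])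
    fix z assume z: "perp e z \<noteq> 0"
    define a where "a = (norm (perp e z))\<^sup>2"
    have a: "a > 0" using z by (simp add: a_def)
    have Q: "?Q (perp e z + s *\<^sub>R e) = ?Q z" for s
      using e1 by (simp add: chord_form_def flip: e_def)
    have nrm: "norm (perp e z + s *\<^sub>R e) = sqrt (a + s\<^sup>2)" for s
      using norm_perp_add[OF e1] by (simp add: a_def)
    have as: "a + s\<^sup>2 > 0" for s using a by (simp add: add_pos_nonneg)
    have nz: "perp e z + s *\<^sub>R e \<noteq> 0" for s
      using nrm[of s] as[of s] by (metis norm_zero real_sqrt_gt_0_iff less_irrefl)
    have F: "?F (perp e z + s *\<^sub>R e) = ?A (?Q z / (a + s\<^sup>2)) * ennreal (sqrt (?Q z / (a + s\<^sup>2)) ^ ?D) * indicator {z. ?Q z \<le> 1} z" for s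
      using as[of s] by (simp add: reflect_sgn reflect_chord[OF nz] Q nrm real_sqrt_divide indicator_def)
    have "(\<integral>\<^sup>+s. ?F (perp e z + s *\<^sub>R e) \<partial>lborel) = (\<integral>\<^sup>+s. ?A (?Q z / (a + s\<^sup>2)) * ennreal (sqrt (?Q z / (a + s\<^sup>2)) ^ ?D) \<partial>lborel) * indicator {z. ?Q z \<le> 1} z"
      unfolding F by (rule nn_integral_multc) measurable
    also have "\<dots> = ennreal (pi * sqrt (?Q z) * (min c (?Q z / a) powr ((real ?D - 1) / 2) / ((real ?D - 1) / 2))) * indicator {z. ?Q z \<le> 1} z"
      by (subst nn_integral_tail_beta_line[OF chord_form_pos[OF z] a c d]) simp
    finally show "(\<integral>\<^sup>+s. ?F (perp e z + s *\<^sub>R e) \<partial>lborel) * indicator (slab e) z = ennreal (pi * sqrt (?Q z) * (min c (?Q z / (norm (perp e z))\<^sup>2) powr ((real ?D - 1) / 2) / ((real ?D - 1) / 2)))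
      * indicator (slab e \<inter> {z. ?Q z \<le> 1}) z"
      by (simp add: a_def indicator_inter_arith mult_ac)
  qed
  finally show ?thesis .
qed

text \<open>On the hyperplane orthogonal to \<open>e\<close> the form is l times the squared norm
  plus a rank-one term along v, the projection of x. Its eigenvalue along v is l + 2 |v|^2 = 2, so a
  stretch along v and a dilation reduce it to the squared norm.\<close>

lemma nn_integral_sqrt_chord_form:
  shows "ennreal (real DIM('a)) * (\<integral>\<^sup>+z. ennreal (sqrt (chord_form x n z)) * indicator (slab e \<inter> {z. chord_form x n z \<le> 1}) z \<partial>lborel)
    = ennreal (l powr (- ((real DIM('a) - 2) / 2)) / sqrt 2) * equator_int e (\<lambda>_. 1)"
proof -
  let ?D = "DIM('a)" and ?Q = "chord_form x n"
  note e1 = norm_chord_dir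
  have ee: "e \<bullet> e = 1" using e1 by (simp add: norm_eq_1)
  let ?F = "\<lambda>q::'a \<Rightarrow> real. \<lambda>z. ennreal (sqrt (q z)) * indicator (slab e \<inter> {z. q z \<le> 1}) z"
  define R where "R z = l * (norm (perp e z))\<^sup>2" for z
  have [measurable]: "R \<in> borel_measurable borel" unfolding R_def by measurable
  define v where "v = perp e x"
  have ve: "v \<bullet> e = 0" using e1 by (simp add: v_def)
  have "v \<bullet> v = x \<bullet> x - (x \<bullet> e)\<^sup>2"
    by (simp add: v_def perp_def inner_diff_left inner_diff_right ee inner_commute[of e x] power2_eq_square)
  also have "\<dots> = 1 - l / 2" using x chord_pos by (simp add: inner_chord_dir(3) norm_eq_1)
  finally have vv: "v \<bullet> v = 1 - l / 2" .
  have xv: "x \<bullet> perp e z = z \<bullet> v" for z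
    by (simp add: perp_def v_def inner_diff_left inner_diff_right inner_commute)
  have Q: "?Q z = l * (norm (perp e z))\<^sup>2 + 2 * (z \<bullet> v)\<^sup>2" for z
    by (simp add: chord_form_def xv flip: l_def e_def)
  have 1: "(\<integral>\<^sup>+z. ?F ?Q z \<partial>lborel) = ennreal (sqrt (l / 2)) * (\<integral>\<^sup>+z. ?F R z \<partial>lborel)"
  proof (cases "v = 0")
    case True
    \<comment> \<open>Here x is the antipode of n: the form is already isotropic and the factor sqrt
      (l / 2) is 1.\<close>
    then have "l = 2" using vv by simp
    moreover have "?Q = R" using True by (auto simp: Q R_def)
    ultimately show ?thesis by simp
  next
    case False
    define w where "w = sgn v"
    have w1: "norm w = 1" using False by (simp add: w_def norm_sgn)
    then have ww: "w \<bullet> w = 1" by (simp add: norm_eq_1)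
    have we: "w \<bullet> e = 0" using ve by (simp add: w_def sgn_div_norm)
    have vw: "v = norm v *\<^sub>R w" using False by (simp add: w_def sgn_div_norm)
    \<comment> \<open>The stretch by k along w turns the eigenvalue 2 into 2 k^2 = l, the eigenvalue
      of the other directions.\<close>
    define k where "k = sqrt (l / 2)"
    have k: "k > 0" "k\<^sup>2 = l / 2" using chord_pos by (simp_all add: k_def)
    let ?S = "\<lambda>z. z + ((k - 1) * (z \<bullet> w)) *\<^sub>R w"
    have zv: "z \<bullet> v = norm v * (z \<bullet> w)" for z by (subst vw) simp
    have nv: "(norm v)\<^sup>2 = 1 - l / 2" using vv by (simp add: power2_norm_eq_inner)
    have pe: "(norm (perp e (?S z)))\<^sup>2 = (norm (perp e z))\<^sup>2 + (k\<^sup>2 - 1) * (z \<bullet> w)\<^sup>2" for z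
      unfolding power2_norm_eq_inner perp_def using we
      by (simp add: inner_diff_left inner_diff_right inner_add_left inner_add_right ee ww
          inner_commute[of e z] inner_commute[of w z] inner_commute[of e w])
         (simp add: algebra_simps power2_eq_square)
    have "?Q (?S z) = R z" for z
    proof -
      have "?S z \<bullet> w = k * (z \<bullet> w)" by (simp add: inner_add_left ww algebra_simps)
      then have "?Q (?S z) = l * ((norm (perp e z))\<^sup>2 + (k\<^sup>2 - 1) * (z \<bullet> w)\<^sup>2) + 2 * ((norm v)\<^sup>2 * (k\<^sup>2 * (z \<bullet> w)\<^sup>2))"
        unfolding Q zv pe by (simp add: power_mult_distrib)
      also have "\<dots> = R z" unfolding nv k(2) R_def by (simp add: field_simps)
      finally show ?thesis .
    qed
    moreover have "?S z \<in> slab e \<longleftrightarrow> z \<in> slab e" for z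
      by (simp add: slab_def inner_add_left we)
    ultimately have "?F ?Q (?S z) = ?F R z" for z
      by (simp add: indicator_def)
    then show ?thesis
      using nn_integral_lborel_axis_scale[of "?F ?Q" w k] w1 k(1) by (simp add: k_def)
  qed
  \<comment> \<open>Dilation by r turns \<open>R\<close> into the squared norm but also changes the
    width of the slab; a stretch by 1 / r along \<open>e\<close> restores the width.\<close>
  define r where "r = 1 / sqrt l"
  have r: "r > 0" using chord_pos by (simp add: r_def)
  let ?G = "\<lambda>z. ennreal (norm (perp e z)) * indicator (slab e \<inter> {z. norm (perp e z) \<le> 1}) z"
  let ?G' = "\<lambda>z. ennreal (norm (perp e z)) * indicator ({z. \<bar>z \<bullet> e\<bar> * r < 1 / 2} \<inter> {z. norm (perp e z) \<le> 1}) z"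
  have sR: "sqrt (R (r *\<^sub>R z)) = norm (perp e z)" and R1: "R (r *\<^sub>R z) \<le> 1 \<longleftrightarrow> norm (perp e z) \<le> 1" for z
  proof -
    have "R (r *\<^sub>R z) = (norm (perp e z))\<^sup>2"
      using chord_pos by (simp add: R_def r_def perp_scaleR power_mult_distrib power_divide)
    then show "sqrt (R (r *\<^sub>R z)) = norm (perp e z)" "R (r *\<^sub>R z) \<le> 1 \<longleftrightarrow> norm (perp e z) \<le> 1"
      by (simp_all add: abs_square_le_1)
  qed
  have "(\<integral>\<^sup>+z. ?F R z \<partial>lborel) = ennreal (r ^ ?D) * (\<integral>\<^sup>+z. ?F R (r *\<^sub>R z) \<partial>lborel)"
    by (rule nn_integral_lborel_scale[OF _ r]) measurable
  also have "(\<lambda>z. ?F R (r *\<^sub>R z)) = ?G'"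
    using r by (auto simp: fun_eq_iff sR R1 slab_def indicator_def abs_mult mult.commute)
  also have "(\<integral>\<^sup>+z. ?G' z \<partial>lborel) = ennreal (1 / r) * (\<integral>\<^sup>+z. ?G' (z + ((1 / r - 1) * (z \<bullet> e)) *\<^sub>R e) \<partial>lborel)"
    using r by (intro nn_integral_lborel_axis_scale[OF _ e1]) auto
  also have "(\<lambda>z. ?G' (z + ((1 / r - 1) * (z \<bullet> e)) *\<^sub>R e)) = ?G"
  proof
    fix z
    have "(z + ((1 / r - 1) * (z \<bullet> e)) *\<^sub>R e) \<bullet> e = (z \<bullet> e) / r" by (simp add: inner_add_left ee algebra_simps)
    then show "?G' (z + ((1 / r - 1) * (z \<bullet> e)) *\<^sub>R e) = ?G z"
      using e1 r by (simp add: indicator_def slab_def)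
  qed
  finally have 2: "(\<integral>\<^sup>+z. ?F R z \<partial>lborel) = ennreal (r ^ ?D) * (ennreal (1 / r) * (\<integral>\<^sup>+z. ?G z \<partial>lborel))" .
  have "sqrt (l / 2) * (r ^ ?D * (1 / r)) = l powr (- ((real ?D - 2) / 2)) / sqrt 2"
  proof -
    have rl: "r = l powr (- (1/2))"
      unfolding r_def powr_minus_divide using chord_pos by (simp only: powr_half_sqrt)
    have "r ^ ?D * (1 / r) = r powr (real ?D - 1)"
      using r by (simp add: powr_diff powr_realpow)
    also have "\<dots> = l powr (- ((real ?D - 1) / 2))" unfolding rl by (simp add: powr_powr)
    finally have "sqrt (l / 2) * (r ^ ?D * (1 / r)) = l powr (1/2) * l powr (- ((real ?D - 1) / 2)) / sqrt 2"
      using chord_pos by (simp add: real_sqrt_divide powr_half_sqrt)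
    also have "l powr (1/2) * l powr (- ((real ?D - 1) / 2)) = l powr (- ((real ?D - 2) / 2))"
      unfolding powr_add[symmetric] by (rule arg_cong[where f="(powr) l"]) (simp add: field_simps)
    finally show ?thesis .
  qed
  then have "ennreal (sqrt (l / 2)) * (ennreal (r ^ ?D) * ennreal (1 / r)) = ennreal (l powr (- ((real ?D - 2) / 2)) / sqrt 2)"
    using r chord_pos by (simp flip: ennreal_mult)
  note K = this
  show ?thesis unfolding 1 2 equator_int_def K[symmetric] by (simp only: mult_1 mult_ac)
qed

end

lemma equator_int_1:
  assumes e: "norm (e::'a::euclidean_space) = 1" and d: "2 \<le> DIM('a)"
  shows "sphere_int (\<lambda>_::'a. 1) = (\<integral>\<^sup>+t. ennreal (1 / sqrt (1 + t\<^sup>2) ^ DIM('a)) \<partial>lborel) * equator_int e (\<lambda>_. 1)"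
  using equator_int_cmult[of "\<lambda>_. 1" e "\<integral>\<^sup>+t. ennreal (1 / sqrt (1 + t\<^sup>2) ^ DIM('a)) \<partial>lborel"]
  by (subst sphere_int_cylinder[OF _ e d]) auto

section \<open>Beta integrals and total masses\<close>

lemma nn_integral_Beta:
  assumes "a > 0" "b > 0"
  shows "(\<integral>\<^sup>+u. ennreal (u powr (a - 1) * (1 - u) powr (b - 1)) * indicator {0<..<1} u \<partial>lborel) = ennreal (Beta a b)"
proof -
  have "(\<integral>\<^sup>+u. ennreal (u powr (a - 1) * (1 - u) powr (b - 1)) * indicator {0<..<1} u \<partial>lborel) =
    (\<integral>\<^sup>+u. ennreal (indicator {0..1} u * (u powr (a - 1) * (1 - u) powr (b - 1))) \<partial>lborel)"
    by (intro nn_integral_cong_AE eventually_mono[OF eventually_conj[OF AE_lborel_singleton[of 0] AE_lborel_singleton[of 1]]])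
      (auto simp: indicator_def)
  also have "\<dots> = ennreal (Beta a b)"
    by (rule nn_integral_has_integral_lebesgue) (use has_integral_Beta_real[OF assms] in auto)
  finally show ?thesis .
qed

lemma nn_integral_Beta_infinite:
  assumes "a > 0" "b > 0"
  shows "(\<integral>\<^sup>+y. ennreal (y powr (a - 1) * (1 + y) powr (- (a + b))) * indicator {0<..} y \<partial>lborel) = ennreal (Beta a b)"
proof -
  let ?g = "\<lambda>u::real. u / (1 - u)"
  have im: "?g ` {0<..<1} = {0<..}"
  proof (intro subset_antisym subsetI)
    fix y :: real assume "y \<in> {0<..}"
    then show "y \<in> ?g ` {0<..<1}"
      by (intro image_eqI[of _ _ "y / (1 + y)"]) (auto simp: field_simps)
  qed auto
  have "(\<integral>\<^sup>+y. ennreal (y powr (a - 1) * (1 + y) powr (- (a + b))) * indicator (?g ` {0<..<1}) y \<partial>lborel) =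
    (\<integral>\<^sup>+u. ennreal (?g u powr (a - 1) * (1 + ?g u) powr (- (a + b))) * ennreal (1 / (1 - u)\<^sup>2) * indicator {0<..<1} u \<partial>lborel)"
  proof (rule nn_integral_substitution_open[where a=0 and b=1])
    show "{0<..<1} = einterval 0 1" by (auto simp: einterval_def)
  qed (auto intro!: derivative_eq_intros continuous_intros simp: power2_eq_square)
  also have "\<dots> = (\<integral>\<^sup>+u. ennreal (u powr (a - 1) * (1 - u) powr (b - 1)) * indicator {0<..<1} u \<partial>lborel)"
  proof (rule nn_integral_cong)
    fix u :: real
    show "ennreal (?g u powr (a - 1) * (1 + ?g u) powr (- (a + b))) * ennreal (1 / (1 - u)\<^sup>2) * indicator {0<..<1} u
      = ennreal (u powr (a - 1) * (1 - u) powr (b - 1)) * indicator {0<..<1} u"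
    proof (cases "u \<in> {0<..<1}")
      case True
      define v where "v = 1 - u"
      have v: "v > 0" "u > 0" using True by (auto simp: v_def)
      have 1: "1 + u / v = v powr (-1)" using v by (simp add: v_def powr_minus field_simps)
      have 2: "1 / v\<^sup>2 = v powr (-2)" using v by (simp add: powr_minus powr_numeral field_simps)
      have 3: "(u / v) powr (a - 1) = u powr (a - 1) * v powr (- (a - 1))"
        unfolding powr_minus using v by (simp add: powr_divide) (simp add: divide_inverse)
      have "(u / v) powr (a - 1) * (1 + u / v) powr (- (a + b)) * (1 / v\<^sup>2) = u powr (a - 1) * (v powr (- (a - 1)) * v powr (a + b) * v powr (-2))"
        unfolding 1 2 3 powr_powr by (simp add: mult_ac add.commute)
      also have "v powr (- (a - 1)) * v powr (a + b) * v powr (-2) = v powr (b - 1)"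
        unfolding powr_add[symmetric] by (rule arg_cong[where f="(powr) v"]) simp
      finally show ?thesis using True v by (simp flip: v_def ennreal_mult')
    qed simp
  qed
  also have "\<dots> = ennreal (Beta a b)" by (rule nn_integral_Beta[OF assms])
  finally show ?thesis unfolding im .
qed

lemma sqrt_power_eq_powr: "x > 0 \<Longrightarrow> sqrt x ^ n = x powr (real n / 2)"
  by (simp add: powr_half_sqrt[symmetric] powr_realpow[symmetric] powr_powr)

lemma nn_integral_polar_weight:
  assumes D: "2 \<le> D"
  shows "(\<integral>\<^sup>+t. ennreal (1 / sqrt (1 + t\<^sup>2) ^ D) \<partial>lborel) = ennreal (Beta (1/2) ((real D - 1) / 2))"
proof -
  let ?F = "\<lambda>t::real. ennreal (1 / sqrt (1 + t\<^sup>2) ^ D)"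
  have im: "sqrt ` {0<..} = {0<..}"
  proof (intro subset_antisym subsetI)
    fix y :: real assume "y \<in> {0<..}"
    then show "y \<in> sqrt ` {0<..}" by (intro image_eqI[of _ _ "y\<^sup>2"]) auto
  qed auto
  have "(\<integral>\<^sup>+t. ?F t * indicator (sqrt ` {0<..}) t \<partial>lborel) =
     (\<integral>\<^sup>+y. ?F (sqrt y) * ennreal (inverse (sqrt y) / 2) * indicator {0<..} y \<partial>lborel)"
  proof (rule nn_integral_substitution_open[where a=0 and b=\<infinity>])
    show "{0<..} = einterval 0 \<infinity>" by (auto simp: einterval_def)
  qed (auto intro!: DERIV_real_sqrt continuous_intros)
  also have "\<dots> = (\<integral>\<^sup>+y. ennreal (1/2) * (ennreal (y powr (1/2 - 1) * (1 + y) powr (- (1/2 + (real D - 1) / 2))) * indicator {0<..} y) \<partial>lborel)"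
  proof (rule nn_integral_cong)
    fix y :: real
    show "?F (sqrt y) * ennreal (inverse (sqrt y) / 2) * indicator {0<..} y
       = ennreal (1/2) * (ennreal (y powr (1/2 - 1) * (1 + y) powr (- (1/2 + (real D - 1) / 2))) * indicator {0<..} y)"
    proof (cases "y > 0")
      case True
      have e: "1/2 + (real D - 1) / 2 = real D / 2" "1/2 - 1 = - (1/2 :: real)" by (simp_all add: field_simps)
      have 1: "1 / sqrt (1 + (sqrt y)\<^sup>2) ^ D = (1 + y) powr (- (real D / 2))"
        unfolding powr_minus_divide using True by (simp add: sqrt_power_eq_powr)
      have 2: "inverse (sqrt y) / 2 = 1/2 * y powr (- (1/2))"
        unfolding powr_minus using True by (simp add: powr_half_sqrt)
      have ind: "indicator {0<..} y = (1 :: ennreal)" using True by simp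
      have "ennreal ((1 + y) powr (- (real D / 2))) * ennreal (1/2 * y powr (- (1/2))) =
        ennreal (1/2) * ennreal (y powr (- (1/2)) * (1 + y) powr (- (real D / 2)))"
        by (subst (1 2) ennreal_mult[symmetric]) (simp_all add: mult_ac)
      then show ?thesis unfolding e 1 2 ind mult_1_right .
    qed simp
  qed
  also have "\<dots> = ennreal (1/2) * ennreal (Beta (1/2) ((real D - 1) / 2))"
    using D by (subst nn_integral_cmult, measurable, subst nn_integral_Beta_infinite) auto
  finally have half: "(\<integral>\<^sup>+t. ?F t * indicator {0<..} t \<partial>lborel) = ennreal (1/2) * ennreal (Beta (1/2) ((real D - 1) / 2))"
    unfolding im .
  have "(\<integral>\<^sup>+t. ?F t \<partial>lborel) = (\<integral>\<^sup>+t. ?F t * indicator {0<..} t + ?F (-t) * indicator {0<..} (-t) \<partial>lborel)"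
    by (intro nn_integral_cong_AE eventually_mono[OF AE_lborel_singleton[of 0]]) (auto simp: indicator_def)
  also have "\<dots> = (\<integral>\<^sup>+t. ?F t * indicator {0<..} t \<partial>lborel) + (\<integral>\<^sup>+t. ?F (-t) * indicator {0<..} (-t) \<partial>lborel)"
    by (rule nn_integral_add) measurable
  also have "(\<integral>\<^sup>+t. ?F (-t) * indicator {0<..} (-t) \<partial>lborel) = (\<integral>\<^sup>+t. ?F t * indicator {0<..} t \<partial>lborel)"
    by (rule nn_integral_lborel_uminus) measurable
  also have "(\<integral>\<^sup>+t. ?F t * indicator {0<..} t \<partial>lborel) + (\<integral>\<^sup>+t. ?F t * indicator {0<..} t \<partial>lborel)
     = (ennreal (1/2) + ennreal (1/2)) * ennreal (Beta (1/2) ((real D - 1) / 2))"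
    unfolding half by (simp only: distrib_right)
  also have "ennreal (1/2) + ennreal (1/2) = 1" by (subst ennreal_plus[symmetric]) simp_all
  finally show ?thesis by simp
qed

lemma sphere_int_one: "sphere_int (\<lambda>_::'a::euclidean_space. 1) = ennreal (2 * pi powr (real DIM('a) / 2) / Gamma (real DIM('a) / 2))"
proof -
  have "sphere_int (\<lambda>_::'a. 1) = ennreal (real DIM('a)) * emeasure lborel (cball (0::'a) 1)"
    by (simp add: sphere_int_def cball_def dist_norm)
  also have "\<dots> = ennreal (real DIM('a) * unit_ball_vol DIM('a))"
    by (simp add: emeasure_cball flip: ennreal_mult)
  also have "real DIM('a) * unit_ball_vol DIM('a) = 2 * pi powr (real DIM('a) / 2) / Gamma (real DIM('a) / 2)"
  proof -
    define h where "h = real DIM('a) / 2"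
    have h: "h > 0" by (simp add: h_def)
    have "Gamma (h + 1) = h * Gamma h" using h by (intro Gamma_plus1) auto
    moreover have "real DIM('a) = 2 * h" by (simp add: h_def)
    moreover have "Gamma h > 0" using h by (rule Gamma_real_pos)
    ultimately show ?thesis
      using h by (simp add: unit_ball_vol_def)
  qed
  finally show ?thesis .
qed

text \<open>\<open>equator_int\<close> is a volume integral in full dimension, so the area of the
  equator is read off from the area of the sphere by dividing by the polar weight integral.\<close>

lemma equator_int_one:
  assumes e: "norm (e::'a::euclidean_space) = 1" and d: "2 \<le> DIM('a)"
  shows "equator_int e (\<lambda>_. 1) = ennreal (2 * pi powr ((real DIM('a) - 1) / 2) / Gamma ((real DIM('a) - 1) / 2))"
proof -
  define D where "D = real DIM('a)"
  have D: "D \<ge> 2" using d by (simp add: D_def)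
  have G: "Gamma ((D - 1) / 2) > 0" using D by (intro Gamma_real_pos) auto
  have h: "1 / 2 + (D - 1) / 2 = D / 2" by (simp add: field_simps)
  have B: "Beta (1/2) ((D - 1) / 2) > 0" unfolding Beta_def using D by (intro divide_pos_pos mult_pos_pos Gamma_real_pos) (auto simp: field_simps)
  have "Beta (1/2) ((D - 1) / 2) * (2 * pi powr ((D - 1) / 2) / Gamma ((D - 1) / 2)) = 2 * (sqrt pi * pi powr ((D - 1) / 2)) / Gamma (D / 2)"
    using G by (simp add: Beta_def Gamma_one_half_real h)
  also have "sqrt pi * pi powr ((D - 1) / 2) = pi powr (D / 2)"
  proof -
    have "sqrt pi * pi powr ((D - 1) / 2) = pi powr (1/2 + (D - 1) / 2)"
      unfolding powr_add by (simp add: powr_half_sqrt)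
    also have "1/2 + (D - 1) / 2 = D / 2" by (simp add: field_simps)
    finally show ?thesis .
  qed
  finally have r: "Beta (1/2) ((D - 1) / 2) * (2 * pi powr ((D - 1) / 2) / Gamma ((D - 1) / 2)) = 2 * pi powr (D / 2) / Gamma (D / 2)" .
  have "ennreal (Beta (1/2) ((D - 1) / 2)) * equator_int e (\<lambda>_. 1) = ennreal (2 * pi powr (D / 2) / Gamma (D / 2))"
    using equator_int_1[OF e d] nn_integral_polar_weight[OF d] sphere_int_one[where 'a='a] by (simp add: D_def)
  also have "\<dots> = ennreal (Beta (1/2) ((D - 1) / 2)) * ennreal (2 * pi powr ((D - 1) / 2) / Gamma ((D - 1) / 2))"
    unfolding r[symmetric] using B G by (intro ennreal_mult) auto
  finally show ?thesis using B by (simp add: ennreal_mult_cancel_left D_def)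
qed

definition head_beta :: "real \<Rightarrow> real \<Rightarrow> real \<Rightarrow> ennreal"
  where "head_beta m c p = (\<integral>\<^sup>+u. ennreal (u powr m / sqrt (1 - u)) * indicator {u. 0 < u \<and> u < 1 \<and> c < u * p} u \<partial>lborel)"

lemma head_beta_measurable [measurable]: "head_beta m c \<in> borel_measurable borel"
  unfolding head_beta_def indicator_def mem_Collect_eq by measurable

lemma head_plus_tail_beta:
  assumes m: "m > -1" and p: "p > 0"
  shows "head_beta m c p + tail_beta m c p = ennreal (Beta (m + 1) (1/2))"
proof -
  let ?w = "\<lambda>u. ennreal (u powr m / sqrt (1 - u))"
  have m1: "(\<lambda>u. ?w u * indicator {u. 0 < u \<and> u < 1 \<and> c < u * p} u) \<in> borel_measurable borel"
    and m2: "(\<lambda>u. ?w u * indicator {u. 0 < u \<and> u < 1 \<and> u * p < c} u) \<in> borel_measurable borel"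
    unfolding indicator_def mem_Collect_eq by measurable
  have "head_beta m c p + tail_beta m c p =
    (\<integral>\<^sup>+u. ?w u * indicator {u. 0 < u \<and> u < 1 \<and> c < u * p} u + ?w u * indicator {u. 0 < u \<and> u < 1 \<and> u * p < c} u \<partial>lborel)"
    unfolding head_beta_def tail_beta_def using m1 m2 by (intro nn_integral_add[symmetric]) simp_all
  also have "\<dots> = (\<integral>\<^sup>+u. ennreal (u powr (m + 1 - 1) * (1 - u) powr (1/2 - 1)) * indicator {0<..<1} u \<partial>lborel)"
  proof (rule nn_integral_cong_AE, rule eventually_mono[OF AE_lborel_singleton[of "c / p"]])
    fix u assume u: "u \<noteq> c / p"
    show "?w u * indicator {u. 0 < u \<and> u < 1 \<and> c < u * p} u + ?w u * indicator {u. 0 < u \<and> u < 1 \<and> u * p < c} u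
       = ennreal (u powr (m + 1 - 1) * (1 - u) powr (1/2 - 1)) * indicator {0<..<1} u"
    proof (cases "0 < u \<and> u < 1")
      case True
      have "1/2 - 1 = - (1/2 :: real)" by simp
      then have w: "ennreal (u powr (m + 1 - 1) * (1 - u) powr (1/2 - 1)) = ?w u"
        using True by (simp only: powr_minus_divide) (simp add: powr_half_sqrt)
      have "c < u * p \<or> u * p < c" using u p by (auto simp: field_simps)
      then show ?thesis unfolding w using True by (auto simp: indicator_def)
    qed (auto simp: indicator_def)
  qed
  also have "\<dots> = ennreal (Beta (m + 1) (1/2))" using m by (intro nn_integral_Beta) auto
  finally show ?thesis .
qed

section \<open>Zonal integrals in the polar variable\<close>

lemma sphere_int_zonal:
  fixes G :: "real \<Rightarrow> ennreal" and n :: "'a::euclidean_space"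
  assumes [measurable]: "G \<in> borel_measurable borel" and n: "norm n = 1" and d: "2 \<le> DIM('a)"
  shows "sphere_int (\<lambda>y. G (y \<bullet> n)) =
    (\<integral>\<^sup>+t. G (t / sqrt (1 + t\<^sup>2)) * ennreal (1 / sqrt (1 + t\<^sup>2) ^ DIM('a)) \<partial>lborel) * equator_int n (\<lambda>_. 1)"
proof -
  let ?c = "\<integral>\<^sup>+t. G (t / sqrt (1 + t\<^sup>2)) * ennreal (1 / sqrt (1 + t\<^sup>2) ^ DIM('a)) \<partial>lborel"
  have "sphere_int (\<lambda>y. G (y \<bullet> n)) = equator_int n (\<lambda>x. \<integral>\<^sup>+t. G (sgn (x + t *\<^sub>R n) \<bullet> n) * ennreal (1 / sqrt (1 + t\<^sup>2) ^ DIM('a)) \<partial>lborel)"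
    by (rule sphere_int_cylinder[OF _ n d]) measurable
  also have "\<dots> = equator_int n (\<lambda>_. ?c * 1)"
  proof (rule equator_int_cong[OF n d])
    fix x assume x: "norm x = 1" "x \<bullet> n = 0"
    have "sgn (x + t *\<^sub>R n) \<bullet> n = t / sqrt (1 + t\<^sup>2)" for t
      using n x by (simp add: sgn_div_norm norm_add_axis inner_add_left norm_eq_1 divide_inverse mult.commute)
    then show "(\<integral>\<^sup>+t. G (sgn (x + t *\<^sub>R n) \<bullet> n) * ennreal (1 / sqrt (1 + t\<^sup>2) ^ DIM('a)) \<partial>lborel) = ?c * 1"
      by simp
  qed
  also have "\<dots> = ?c * equator_int n (\<lambda>_. 1)" by (rule equator_int_cmult) simp
  finally show ?thesis .
qed

text \<open>The variable y is cot^2 (\<eta> / 2), the squared stereographic radius, so that 1 - cos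
  \<eta> = 2 / (1 + y) and the polar weight becomes a power of sqrt y over a power of 1 + y.\<close>

lemma nn_integral_stereographic:
  fixes G :: "real \<Rightarrow> ennreal"
  assumes [measurable]: "G \<in> borel_measurable borel" and D: "3 \<le> D"
  shows "(\<integral>\<^sup>+t. G (t / sqrt (1 + t\<^sup>2)) * ennreal (1 / sqrt (1 + t\<^sup>2) ^ D) \<partial>lborel) =
    ennreal (2 ^ (D - 2)) * (\<integral>\<^sup>+y. G (1 - 2 / (1 + y)) * ennreal (sqrt y ^ (D - 3) / (1 + y) ^ (D - 1)) * indicator {0<..} y \<partial>lborel)"
proof -
  let ?F = "\<lambda>t. G (t / sqrt (1 + t\<^sup>2)) * ennreal (1 / sqrt (1 + t\<^sup>2) ^ D)"
  let ?g = "\<lambda>y::real. (y - 1) / (2 * sqrt y)"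
  let ?g' = "\<lambda>y::real. (1 + y) / (4 * (y * sqrt y))"
  \<comment> \<open>The slope t is cot \<eta>, so its preimage is (cot \<eta> + 1 / sin \<eta>)^2 =
    cot^2 (\<eta> / 2).\<close>
  have "t \<in> ?g ` {0<..}" for t
  proof (rule image_eqI)
    have "sqrt (t\<^sup>2 + 1) > \<bar>t\<bar>" by (rule real_less_rsqrt) simp
    then have pos: "t + sqrt (t\<^sup>2 + 1) > 0" by (simp add: abs_if split: if_splits)
    then show "(t + sqrt (t\<^sup>2 + 1))\<^sup>2 \<in> {0<..}" by simp
    have s: "sqrt (t\<^sup>2 + 1) * sqrt (t\<^sup>2 + 1) = t\<^sup>2 + 1" by simp
    have "(t + sqrt (t\<^sup>2 + 1))\<^sup>2 - 1 = t * (2 * (t + sqrt (t\<^sup>2 + 1)))"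
      using s by (simp add: power2_eq_square algebra_simps)
    then show "t = ?g ((t + sqrt (t\<^sup>2 + 1))\<^sup>2)" using pos by simp
  qed
  then have im: "?g ` {0<..} = UNIV" by auto
  have "(\<integral>\<^sup>+t. ?F t \<partial>lborel) = (\<integral>\<^sup>+t. ?F t * indicator (?g ` {0<..}) t \<partial>lborel)" by (simp add: im)
  also have "\<dots> = (\<integral>\<^sup>+y. ?F (?g y) * ennreal (?g' y) * indicator {0<..} y \<partial>lborel)"
  proof (rule nn_integral_substitution_open[where a=0 and b=\<infinity>])
    show "{0<..} = einterval 0 \<infinity>" by (auto simp: einterval_def)
    fix y :: real assume y: "y \<in> {0<..}"
    then have s: "sqrt y > 0" "sqrt y * sqrt y = y" by auto
    have "(?g has_real_derivative ((1 - 0) * (2 * sqrt y) - (y - 1) * (2 * (inverse (sqrt y) / 2))) / ((2 * sqrt y) * (2 * sqrt y))) (at y)"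
    proof (rule DERIV_divide)
      show "((\<lambda>y. y - 1) has_real_derivative 1 - 0) (at y)" by (intro derivative_intros)
      show "((\<lambda>y. 2 * sqrt y) has_real_derivative 2 * (inverse (sqrt y) / 2)) (at y)"
        using y by (intro DERIV_cmult DERIV_real_sqrt) auto
    qed (use s in auto)
    also have "((1 - 0) * (2 * sqrt y) - (y - 1) * (2 * (inverse (sqrt y) / 2))) / ((2 * sqrt y) * (2 * sqrt y)) = ?g' y"
    proof -
      define v where "v = sqrt y"
      have v: "v > 0" and yv: "y = v * v" using s by (auto simp: v_def)
      show ?thesis unfolding v_def[symmetric] unfolding yv using v by (simp add: field_simps)
    qed
    finally show "(?g has_real_derivative ?g' y) (at y)" .
  qed (auto intro!: continuous_intros)
  also have "\<dots> = (\<integral>\<^sup>+y. ennreal (2 ^ (D - 2)) * (G (1 - 2 / (1 + y)) * ennreal (sqrt y ^ (D - 3) / (1 + y) ^ (D - 1)) * indicator {0<..} y) \<partial>lborel)"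
  proof (rule nn_integral_cong)
    fix y :: real
    show "?F (?g y) * ennreal (?g' y) * indicator {0<..} y = ennreal (2 ^ (D - 2)) * (G (1 - 2 / (1 + y)) * ennreal (sqrt y ^ (D - 3) / (1 + y) ^ (D - 1)) * indicator {0<..} y)"
    proof (cases "y > 0")
      case True
      define v where "v = sqrt y"
      have v: "v > 0" and yv: "y = v * v" using True by (auto simp: v_def)
      have gv: "?g y = (v * v - 1) / (2 * v)" using v by (simp add: yv)
      have v2: "1 + v * v > 0" by (simp add: add_pos_nonneg)
      have "1 + (?g y)\<^sup>2 = ((1 + v * v) / (2 * v))\<^sup>2"
        unfolding gv using v by (simp add: field_simps power2_eq_square)
      then have s: "sqrt (1 + (?g y)\<^sup>2) = (1 + v * v) / (2 * v)"
        using v v2 by simp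
      have t: "?g y / sqrt (1 + (?g y)\<^sup>2) = 1 - 2 / (1 + y)"
      proof -
        define q where "q = 1 + v * v"
        have q: "q > 0" "v * v - 1 = q - 2" "1 + y = q" using v2 by (simp_all add: q_def yv)
        show ?thesis unfolding s unfolding gv q(2,3) q_def[symmetric] using q(1) v by (simp add: field_simps)
      qed
      obtain k where k: "D = k + 3" using D by (metis add.commute le_Suc_ex)
      have "1 / ((1 + v * v) / (2 * v)) ^ D * ((1 + v * v) / (4 * (v * v * v))) = 2 ^ (D - 2) * (v ^ (D - 3) / (1 + v * v) ^ (D - 1))"
        using v v2 by (simp add: k power_divide power_mult_distrib power_add eval_nat_numeral divide_simps)
      then have "ennreal (1 / ((1 + v * v) / (2 * v)) ^ D) * ennreal ((1 + v * v) / (4 * (v * v * v))) = ennreal (2 ^ (D - 2)) * ennreal (v ^ (D - 3) / (1 + v * v) ^ (D - 1))"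
        using v v2 by (subst (1 2) ennreal_mult[symmetric]) auto
      then have H: "G u * ennreal (1 / ((1 + v * v) / (2 * v)) ^ D) * ennreal ((1 + v * v) / (4 * (v * v * v))) = ennreal (2 ^ (D - 2)) * (G u * ennreal (v ^ (D - 3) / (1 + v * v) ^ (D - 1)))" for u
        by (simp only: mult.assoc mult.left_commute[of "G u"])
      have g': "?g' y = (1 + v * v) / (4 * (v * v * v))" unfolding v_def[symmetric] unfolding yv ..
      have y1: "1 + y = 1 + v * v" by (simp add: yv)
      have H': "G u * ennreal (1 / sqrt (1 + (?g y)\<^sup>2) ^ D) * ennreal (?g' y) = ennreal (2 ^ (D - 2)) * (G u * ennreal (sqrt y ^ (D - 3) / (1 + y) ^ (D - 1)))" for u
        unfolding s g' unfolding v_def[symmetric] y1 by (rule H)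
      have ind: "indicator {0<..} y = (1::ennreal)" using True by simp
      show ?thesis unfolding t ind mult_1_right by (rule H')
    qed simp
  qed
  also have "\<dots> = ennreal (2 ^ (D - 2)) * (\<integral>\<^sup>+y. G (1 - 2 / (1 + y)) * ennreal (sqrt y ^ (D - 3) / (1 + y) ^ (D - 1)) * indicator {0<..} y \<partial>lborel)"
    by (rule nn_integral_cmult) measurable
  finally show ?thesis .
qed

text \<open>Identities between products of real powers become linear in the logarithms of the bases,
  where simplification settles them.\<close>

lemma eq_via_ln: "0 < a \<Longrightarrow> 0 < b \<Longrightarrow> ln a = ln b \<Longrightarrow> a = (b::real)"
  by simp

text \<open>The first two powers belong to a Beta density with parameters m + 1/2 and 1/2, and m + 1
  is the sum of these. For that exponent the Moebius map w = \<rho> x / (1 + \<rho> x) yields a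
  complete Beta integral over the half-line.\<close>

lemma nn_integral_beta_quotient:
  assumes m: "m > 0" and rho: "0 < \<rho>" "\<rho> < 1"
  shows "(\<integral>\<^sup>+w. ennreal (w powr (m - 1/2) * (1 - w) powr (-1/2) * (\<rho> + (1 - \<rho>) * w) powr (- (m + 1))) * indicator {0<..<1} w \<partial>lborel)
    = ennreal (\<rho> powr (-1/2) * Beta (m + 1/2) (1/2))"
proof -
  let ?g = "\<lambda>x. \<rho> * x / (1 + \<rho> * x)"
  let ?F = "\<lambda>w. ennreal (w powr (m - 1/2) * (1 - w) powr (-1/2) * (\<rho> + (1 - \<rho>) * w) powr (- (m + 1)))"
  have pos: "1 + \<rho> * x > 0" if "x > 0" for x using rho that by (simp add: add_pos_pos)
  have im: "?g ` {0<..} = {0<..<1}"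
  proof (intro subset_antisym subsetI)
    fix y assume "y \<in> ?g ` {0<..}"
    then obtain x where "x > 0" "y = ?g x" by auto
    then show "y \<in> {0<..<1}" using pos[of x] rho by simp
  next
    fix y :: real assume "y \<in> {0<..<1}"
    then show "y \<in> ?g ` {0<..}"
      using rho by (intro image_eqI[of _ _ "y / (\<rho> * (1 - y))"]) (auto simp: field_simps)
  qed
  have "(\<integral>\<^sup>+w. ?F w * indicator (?g ` {0<..}) w \<partial>lborel) = (\<integral>\<^sup>+x. ?F (?g x) * ennreal (\<rho> / (1 + \<rho> * x)\<^sup>2) * indicator {0<..} x \<partial>lborel)"
  proof (rule nn_integral_substitution_open[where a=0 and b=\<infinity>])
    show "{0<..} = einterval 0 \<infinity>" by (auto simp: einterval_def)
    fix x :: real assume "x \<in> {0<..}"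
    then have p: "1 + \<rho> * x > 0" using pos by simp
    have "(?g has_real_derivative (\<rho> * (1 + \<rho> * x) - \<rho> * x * \<rho>) / ((1 + \<rho> * x) * (1 + \<rho> * x))) (at x)"
      using p by (auto intro!: derivative_eq_intros)
    then show "(?g has_real_derivative \<rho> / (1 + \<rho> * x)\<^sup>2) (at x)"
      by (simp add: power2_eq_square algebra_simps)
    show "0 \<le> \<rho> / (1 + \<rho> * x)\<^sup>2" using rho by simp
  next
    show "continuous_on {0<..} (\<lambda>x. \<rho> / (1 + \<rho> * x)\<^sup>2)"
      using pos by (intro continuous_intros) (auto simp: less_imp_neq[symmetric])
  qed measurable
  also have "\<dots> = (\<integral>\<^sup>+x. ennreal (\<rho> powr (-1/2)) * (ennreal (x powr (m + 1/2 - 1) * (1 + x) powr (- (m + 1/2 + 1/2))) * indicator {0<..} x) \<partial>lborel)"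
  proof (rule nn_integral_cong)
    fix x :: real
    show "?F (?g x) * ennreal (\<rho> / (1 + \<rho> * x)\<^sup>2) * indicator {0<..} x = ennreal (\<rho> powr (-1/2)) * (ennreal (x powr (m + 1/2 - 1) * (1 + x) powr (- (m + 1/2 + 1/2))) * indicator {0<..} x)"
    proof (cases "x > 0")
      case True
      define e where "e = 1 + \<rho> * x"
      have e: "e > 0" using pos[OF True] by (simp add: e_def)
      have w1: "1 - \<rho> * x / e = 1 / e" using e by (simp add: e_def field_simps)
      have w2: "\<rho> + (1 - \<rho>) * (\<rho> * x / e) = \<rho> * (1 + x) / e" using e by (simp add: e_def field_simps)
      define q where "q = 1 + x"
      have q: "q > 0" using True by (simp add: q_def)
      have "(\<rho> * x / e) powr (m - 1/2) * (1 / e) powr (-1/2) * (\<rho> * q / e) powr (- (m + 1)) * (\<rho> / e\<^sup>2)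
         = \<rho> powr (-1/2) * (x powr (m + 1/2 - 1) * q powr (- (m + 1/2 + 1/2)))"
        by (rule eq_via_ln) (use True e rho q in \<open>auto simp: ln_mult ln_div ln_powr ln_realpow algebra_simps intro!: mult_pos_pos divide_pos_pos\<close>)
      then have "ennreal ((\<rho> * x / e) powr (m - 1/2) * (1 / e) powr (-1/2) * (\<rho> * q / e) powr (- (m + 1))) * ennreal (\<rho> / e\<^sup>2)
         = ennreal (\<rho> powr (-1/2)) * ennreal (x powr (m + 1/2 - 1) * q powr (- (m + 1/2 + 1/2)))"
        using rho by (subst (1 2) ennreal_mult[symmetric]) auto
      moreover have "indicator {0<..} x = (1::ennreal)" using True by simp
      ultimately show ?thesis unfolding e_def[symmetric] w1 w2 unfolding q_def by (simp only: mult_1_right)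
    qed simp
  qed
  also have "\<dots> = ennreal (\<rho> powr (-1/2)) * ennreal (Beta (m + 1/2) (1/2))"
    using m by (subst nn_integral_cmult, measurable, subst nn_integral_Beta_infinite) auto
  also have "\<dots> = ennreal (\<rho> powr (-1/2) * Beta (m + 1/2) (1/2))"
    by (rule ennreal_mult'[symmetric]) simp
  finally show ?thesis unfolding im .
qed

text \<open>The left side V^m is the integral of m v^(m - 1) over 0 < v < V, reparametrised by v =
  \<sigma> w / (1 - \<sigma> + \<sigma> w). The purpose is to move r from the integrand into the
  range of \<sigma>: for fixed \<sigma> the w-integral is then
  \<open>nn_integral_beta_quotient\<close>.\<close>

lemma powr_moebius_eq_nn_integral:
  assumes m: "m > 0" and r: "0 < r" "r < 1" and w: "0 < w" "w < 1"
  shows "ennreal (((1 - r) * w / (r + (1 - r) * w)) powr m) =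
    (\<integral>\<^sup>+\<sigma>. ennreal (m * \<sigma> powr (m - 1) * w powr m * (1 - \<sigma> + \<sigma> * w) powr (- (m + 1))) * indicator {0<..<1 - r} \<sigma> \<partial>lborel)"
proof -
  let ?g = "\<lambda>\<sigma>. \<sigma> * w / (1 - \<sigma> + \<sigma> * w)"
  define V where "V = (1 - r) * w / (r + (1 - r) * w)"
  have pos: "1 - \<sigma> + \<sigma> * w > 0" if "0 < \<sigma>" "\<sigma> < 1" for \<sigma> using w that by (intro add_pos_pos) auto
  have rw: "r + (1 - r) * w > 0" using r w by (intro add_pos_pos) auto
  have V: "V > 0" "V < 1" using r w rw by (simp_all add: V_def)
  have im: "?g ` {0<..<1 - r} = {0<..<V}"
  proof (intro subset_antisym subsetI)
    fix y assume "y \<in> ?g ` {0<..<1 - r}"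
    then obtain s where s: "0 < s" "s < 1 - r" "y = ?g s" by auto
    have p: "1 - s + s * w > 0" using pos s r by simp
    have "(1 - r) * w * (1 - s + s * w) - s * w * (r + (1 - r) * w) = w * (1 - r - s)"
      by (simp add: algebra_simps)
    moreover have "w * (1 - r - s) > 0" using s w by simp
    ultimately have "s * w * (r + (1 - r) * w) < (1 - r) * w * (1 - s + s * w)" by linarith
    moreover have "a / e < b / f" if "0 < e" "0 < f" "a * f < b * e" for a b e f :: real
      using that by (simp add: divide_simps mult.commute)
    ultimately have "y < V" unfolding s(3) V_def using p rw by blast
    moreover have "y > 0" unfolding s(3) using s(1) w(1) p by (intro divide_pos_pos mult_pos_pos)
    ultimately show "y \<in> {0<..<V}" by simp
  next
    fix y assume y: "y \<in> {0<..<V}"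
    \<comment> \<open>Solving y = \<sigma> w / (1 - \<sigma> + \<sigma> w) for \<sigma> gives y /
      q.\<close>
    define q where "q = w + y - y * w"
    have "q = w + y * (1 - w)" by (simp add: q_def algebra_simps)
    then have q: "q > 0" using y w by (simp add: add_pos_pos)
    have "y * (r + (1 - r) * w) < (1 - r) * w" using y rw by (simp add: V_def pos_less_divide_eq)
    then have lt: "y < (1 - r) * q" by (simp add: q_def algebra_simps)
    show "y \<in> ?g ` {0<..<1 - r}"
    proof (rule image_eqI)
      have "1 - y / q + y / q * w = (q - y + y * w) / q" using q by (simp add: field_simps)
      also have "q - y + y * w = w" by (simp add: q_def)
      finally have "1 - y / q + y / q * w = w / q" .
      then show "y = ?g (y / q)" using q w by simp
      show "y / q \<in> {0<..<1 - r}" using y q lt by (simp add: pos_divide_less_eq)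
    qed
  qed
  have "ennreal (V powr m) = ennreal m * ennreal (V powr (m - 1 + 1) / (m - 1 + 1))"
    using m by (simp flip: ennreal_mult)
  also have "ennreal (V powr (m - 1 + 1) / (m - 1 + 1)) = (\<integral>\<^sup>+v. ennreal (v powr (m - 1)) * indicator {0<..<V} v \<partial>lborel)"
    using m V by (intro nn_integral_powr_from_0[symmetric]) auto
  also have "\<dots> = (\<integral>\<^sup>+\<sigma>. ennreal (?g \<sigma> powr (m - 1)) * ennreal (w / (1 - \<sigma> + \<sigma> * w)\<^sup>2) * indicator {0<..<1 - r} \<sigma> \<partial>lborel)"
    unfolding im[symmetric]
  proof (rule nn_integral_substitution_open[where a="ereal 0" and b="ereal (1 - r)"])
    show "{0<..<1 - r} = einterval (ereal 0) (ereal (1 - r))" by (auto simp: einterval_def)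
    fix s assume "s \<in> {0<..<1 - r}"
    then have p: "1 - s + s * w > 0" using pos r by simp
    have "(?g has_real_derivative (w * (1 - s + s * w) - s * w * (-1 + w)) / ((1 - s + s * w) * (1 - s + s * w))) (at s)"
      using p by (auto intro!: derivative_eq_intros)
    then show "(?g has_real_derivative w / (1 - s + s * w)\<^sup>2) (at s)"
      by (simp add: power2_eq_square algebra_simps)
    show "0 \<le> w / (1 - s + s * w)\<^sup>2" using w by simp
  next
    show "continuous_on {0<..<1 - r} (\<lambda>s. w / (1 - s + s * w)\<^sup>2)"
      using pos r by (intro continuous_intros) (auto, smt (verit))
  qed (use r in auto)
  also have "ennreal m * \<dots> = (\<integral>\<^sup>+\<sigma>. ennreal m * (ennreal (?g \<sigma> powr (m - 1)) * ennreal (w / (1 - \<sigma> + \<sigma> * w)\<^sup>2) * indicator {0<..<1 - r} \<sigma>) \<partial>lborel)"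
    by (rule nn_integral_cmult[symmetric]) measurable
  also have "\<dots> = (\<integral>\<^sup>+\<sigma>. ennreal (m * \<sigma> powr (m - 1) * w powr m * (1 - \<sigma> + \<sigma> * w) powr (- (m + 1))) * indicator {0<..<1 - r} \<sigma> \<partial>lborel)"
  proof (rule nn_integral_cong)
    fix s
    show "ennreal m * (ennreal (?g s powr (m - 1)) * ennreal (w / (1 - s + s * w)\<^sup>2) * indicator {0<..<1 - r} s)
      = ennreal (m * s powr (m - 1) * w powr m * (1 - s + s * w) powr (- (m + 1))) * indicator {0<..<1 - r} s"
    proof (cases "s \<in> {0<..<1 - r}")
      case True
      define e where "e = 1 - s + s * w"
      have e: "e > 0" "s > 0" using pos r True by (auto simp: e_def)
      have "m * ((s * w / e) powr (m - 1) * (w / e\<^sup>2)) = m * s powr (m - 1) * w powr m * e powr (- (m + 1))"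
        by (rule eq_via_ln) (use True e w m in \<open>auto simp: ln_mult ln_div ln_powr ln_realpow algebra_simps intro!: mult_pos_pos divide_pos_pos\<close>)
      then have "ennreal m * (ennreal ((s * w / e) powr (m - 1)) * ennreal (w / e\<^sup>2)) = ennreal (m * s powr (m - 1) * w powr m * e powr (- (m + 1)))"
        using m w by (simp flip: ennreal_mult)
      moreover have "indicator {0<..<1 - r} s = (1::ennreal)" using True by simp
      ultimately show ?thesis unfolding e_def[symmetric] by (simp only: mult_1_right)
    qed simp
  qed
  finally show ?thesis unfolding V_def .
qed

text \<open>The map y = k w with k = (1 - r) / r takes (0, 1) to the range of y, and the powers of y
  and 1 + y combine to the m-th power of a Moebius image of w. Expanding that power by
  \<open>powr_moebius_eq_nn_integral\<close> and exchanging the order leaves a truncated Beta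
  integrand in \<sigma>.\<close>

lemma nn_integral_mass_fibre:
  assumes m: "m > 0" and r: "0 < r" "r < 1"
  shows "(\<integral>\<^sup>+y. ennreal (y powr (m - 1/2) * (1 + y) powr (- m) / sqrt (1 - r - r * y)) * indicator {y. 0 < y \<and> r * (1 + y) < 1} y \<partial>lborel)
   = ennreal (r powr (-1/2)) * (ennreal (m * Beta (m + 1/2) (1/2)) *
     (\<integral>\<^sup>+\<sigma>. ennreal (\<sigma> powr (m - 1) * (1 - \<sigma>) powr (-1/2)) * indicator {0<..<1 - r} \<sigma> \<partial>lborel))"
proof -
  define k where "k = (1 - r) / r"
  have k: "k > 0" using r by (simp add: k_def)
  let ?F = "\<lambda>y. ennreal (y powr (m - 1/2) * (1 + y) powr (- m) / sqrt (1 - r - r * y)) * indicator {y. 0 < y \<and> r * (1 + y) < 1} y"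
  let ?T = "\<lambda>w \<sigma>. ennreal (w powr (-1/2) * (1 - w) powr (-1/2)) * indicator {0<..<1} w *
      (ennreal (m * \<sigma> powr (m - 1) * w powr m * (1 - \<sigma> + \<sigma> * w) powr (- (m + 1))) * indicator {0<..<1 - r} \<sigma>)"
  have "(\<integral>\<^sup>+y. ?F y \<partial>lborel) = ennreal k * (\<integral>\<^sup>+w. ?F (k * w) \<partial>lborel)"
    using nn_integral_real_affine[of ?F k 0] k by simp
  also have "\<dots> = (\<integral>\<^sup>+w. ennreal k * ?F (k * w) \<partial>lborel)"
    by (rule nn_integral_cmult[symmetric]) measurable
  also have "\<dots> = (\<integral>\<^sup>+w. ennreal (r powr (-1/2)) * (\<integral>\<^sup>+\<sigma>. ?T w \<sigma> \<partial>lborel) \<partial>lborel)"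
  proof (rule nn_integral_cong)
    fix w :: real
    have kw: "0 < k * w \<and> r * (1 + k * w) < 1 \<longleftrightarrow> 0 < w \<and> w < 1"
    proof -
      have "r * (1 + k * w) = r + (1 - r) * w" using r by (simp add: k_def field_simps)
      moreover have "r + (1 - r) * w < 1 \<longleftrightarrow> (1 - r) * w < (1 - r) * 1" by auto
      ultimately show ?thesis using k r by (simp only: mult_less_cancel_left_pos zero_less_mult_iff) auto
    qed
    show "ennreal k * ?F (k * w) = ennreal (r powr (-1/2)) * (\<integral>\<^sup>+\<sigma>. ?T w \<sigma> \<partial>lborel)"
    proof (cases "0 < w \<and> w < 1")
      case True
      define e where "e = r + (1 - r) * w"
      define q where "q = 1 - r"
      define v where "v = 1 - w"
      have e: "e > 0" using True r by (auto simp: e_def intro: add_pos_pos)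
      have q: "q > 0" "v > 0" "w > 0" using r True by (auto simp: q_def v_def)
      have k1: "1 + k * w = e / r" using r by (simp add: k_def e_def field_simps)
      have k2: "1 - r - r * (k * w) = q * v" using r by (simp add: k_def q_def v_def field_simps)
      have kq: "k = q / r" by (simp add: k_def q_def)
      have "k * ((k * w) powr (m - 1/2) * (e / r) powr (- m) / sqrt (q * v)) = r powr (-1/2) * ((w powr (-1/2) * v powr (-1/2)) * (q * w / e) powr m)"
        unfolding kq by (rule eq_via_ln) (use q e r in \<open>auto simp: ln_mult ln_div ln_powr ln_sqrt algebra_simps add_divide_distrib intro!: mult_pos_pos divide_pos_pos\<close>)
      then have "ennreal k * ennreal ((k * w) powr (m - 1/2) * (1 + k * w) powr (- m) / sqrt (1 - r - r * (k * w))) =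
         ennreal (r powr (-1/2) * ((w powr (-1/2) * (1 - w) powr (-1/2)) * ((1 - r) * w / (r + (1 - r) * w)) powr m))"
        unfolding k1 k2 unfolding v_def[symmetric] q_def[symmetric] e_def[unfolded q_def[symmetric], symmetric]
        using k q by (subst ennreal_mult[symmetric]) auto
      also have "\<dots> = ennreal (r powr (-1/2)) * (ennreal (w powr (-1/2) * (1 - w) powr (-1/2)) * ennreal (((1 - r) * w / (r + (1 - r) * w)) powr m))"
        by (simp add: ennreal_mult')
      also have "ennreal (w powr (-1/2) * (1 - w) powr (-1/2)) * ennreal (((1 - r) * w / (r + (1 - r) * w)) powr m) = (\<integral>\<^sup>+\<sigma>. ?T w \<sigma> \<partial>lborel)"
        using True unfolding powr_moebius_eq_nn_integral[OF m r conjunct1[OF True] conjunct2[OF True]]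
        by (subst nn_integral_cmult[symmetric]) simp_all
      finally show ?thesis using kw True by simp
    qed (use kw in auto)
  qed
  also have "\<dots> = ennreal (r powr (-1/2)) * (\<integral>\<^sup>+w. (\<integral>\<^sup>+\<sigma>. ?T w \<sigma> \<partial>lborel) \<partial>lborel)"
    by (rule nn_integral_cmult) measurable
  also have "(\<integral>\<^sup>+w. (\<integral>\<^sup>+\<sigma>. ?T w \<sigma> \<partial>lborel) \<partial>lborel) = (\<integral>\<^sup>+\<sigma>. (\<integral>\<^sup>+w. ?T w \<sigma> \<partial>lborel) \<partial>lborel)"
    by (rule lborel_pair.Fubini'[symmetric]) measurable
  also have "\<dots> = (\<integral>\<^sup>+\<sigma>. ennreal (m * Beta (m + 1/2) (1/2)) * (ennreal (\<sigma> powr (m - 1) * (1 - \<sigma>) powr (-1/2)) * indicator {0<..<1 - r} \<sigma>) \<partial>lborel)"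
  proof (rule nn_integral_cong)
    fix \<sigma> :: real
    show "(\<integral>\<^sup>+w. ?T w \<sigma> \<partial>lborel) = ennreal (m * Beta (m + 1/2) (1/2)) * (ennreal (\<sigma> powr (m - 1) * (1 - \<sigma>) powr (-1/2)) * indicator {0<..<1 - r} \<sigma>)"
    proof (cases "\<sigma> \<in> {0<..<1 - r}")
      case True
      let ?R = "\<lambda>w. ennreal (w powr (m - 1/2) * (1 - w) powr (-1/2) * ((1 - \<sigma>) + (1 - (1 - \<sigma>)) * w) powr (- (m + 1))) * indicator {0<..<1} w"
      have "(\<integral>\<^sup>+w. ?T w \<sigma> \<partial>lborel) = (\<integral>\<^sup>+w. ennreal (m * \<sigma> powr (m - 1)) * ?R w \<partial>lborel)"
      proof (rule nn_integral_cong)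
        fix w :: real
        have ind: "indicator {0<..<1 - r} \<sigma> = (1::ennreal)" using True by simp
        show "?T w \<sigma> = ennreal (m * \<sigma> powr (m - 1)) * ?R w"
        proof (cases "w \<in> {0<..<1}")
          case w: True
          have ww: "w powr (-1/2) * w powr m = w powr (m - 1/2)"
            unfolding powr_add[symmetric] by (rule arg_cong[where f="(powr) w"]) simp
          have "(w powr (-1/2) * (1 - w) powr (-1/2)) * (m * \<sigma> powr (m - 1) * w powr m * (1 - \<sigma> + \<sigma> * w) powr (- (m + 1)))
            = m * \<sigma> powr (m - 1) * (w powr (m - 1/2) * (1 - w) powr (-1/2) * ((1 - \<sigma>) + (1 - (1 - \<sigma>)) * w) powr (- (m + 1)))"
            unfolding ww[symmetric] by simp
          moreover have "indicator {0<..<1} w = (1::ennreal)" using w by simp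
          ultimately show ?thesis
            unfolding ind using m by (simp only: mult_1_right) (subst (1 2) ennreal_mult[symmetric], auto)
        qed simp
      qed
      also have "\<dots> = ennreal (m * \<sigma> powr (m - 1)) * ennreal ((1 - \<sigma>) powr (-1/2) * Beta (m + 1/2) (1/2))"
        using True r by (subst nn_integral_cmult, measurable, subst nn_integral_beta_quotient[OF m]) auto
      also have "\<dots> = ennreal (m * Beta (m + 1/2) (1/2)) * ennreal (\<sigma> powr (m - 1) * (1 - \<sigma>) powr (-1/2))"
      proof -
        have "Beta (m + 1/2) (1/2) > 0" unfolding Beta_def using m by (intro divide_pos_pos mult_pos_pos Gamma_real_pos) auto
        then show ?thesis using m by (subst (1 2) ennreal_mult[symmetric]) (auto simp: mult_ac)
      qed
      finally show ?thesis using True by simp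
    qed simp
  qed
  also have "\<dots> = ennreal (m * Beta (m + 1/2) (1/2)) * (\<integral>\<^sup>+\<sigma>. ennreal (\<sigma> powr (m - 1) * (1 - \<sigma>) powr (-1/2)) * indicator {0<..<1 - r} \<sigma> \<partial>lborel)"
    by (rule nn_integral_cmult) measurable
  finally show ?thesis .
qed

lemma incomplete_Beta_integrable:
  fixes a b z :: real
  assumes "a > 0" "b > 0" "0 \<le> z" "z \<le> 1"
  shows "(\<lambda>t. t powr (a - 1) * (1 - t) powr (b - 1)) integrable_on {0..z}"
  using has_integral_Beta_real[OF assms(1,2)] assms(3,4)
  by (auto intro: integrable_on_subinterval)

text \<open>The substitution u = (1 + y) r makes the truncation s0 < r free of y, so y can be
  integrated first, by \<open>nn_integral_mass_fibre\<close>. Then r runs from s0 to 1 - \<sigma>,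
  and the two endpoint values of r^(m + 1/2) / (m + 1/2) produce the two incomplete Beta functions
  of the angle equation.\<close>

lemma nn_integral_mass:
  assumes m: "m > 0" and D: "real D = 2 * m + 2" "3 \<le> D" and s0: "0 < s0" "s0 < 1"
  shows "(\<integral>\<^sup>+y. head_beta m (2 * s0) (2 / (1 + y)) * ennreal (sqrt y ^ (D - 3) / (1 + y) ^ (D - 1)) * indicator {0<..} y \<partial>lborel)
    = ennreal (m * Beta (m + 1/2) (1/2) / (m + 1/2) *
       (incomplete_Beta (1 - s0) m (m + 1) - s0 powr (m + 1/2) * incomplete_Beta (1 - s0) m (1/2)))"
proof -
  let ?H = "\<lambda>r y. ennreal (r powr m) * (indicator {s0<..} r * (ennreal (y powr (m - 1/2) * (1 + y) powr (- m) / sqrt (1 - r - r * y)) * indicator {y. 0 < y \<and> r * (1 + y) < 1} y))"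
  let ?B = "m * Beta (m + 1/2) (1/2)"
  let ?J = "\<lambda>\<sigma>. ennreal (\<sigma> powr (m - 1) * (1 - \<sigma>) powr (-1/2))"
  have mH: "(\<lambda>(r, y). ?H r y) \<in> borel_measurable (borel \<Otimes>\<^sub>M borel)"
    unfolding indicator_def mem_Collect_eq greaterThan_iff by measurable
  have Bpos: "?B > 0" unfolding Beta_def using m by (intro divide_pos_pos mult_pos_pos Gamma_real_pos) auto
  have H: "head_beta m (2 * s0) (2 / (1 + y)) * ennreal (sqrt y ^ (D - 3) / (1 + y) ^ (D - 1)) * indicator {0<..} y = (\<integral>\<^sup>+r. ?H r y \<partial>lborel)" for y
  proof (cases "y > 0")
    case y: True
    define c where "c = 1 + y"
    have c: "c > 0" using y by (simp add: c_def)
    let ?G = "\<lambda>u. ennreal (u powr m / sqrt (1 - u)) * indicator {u. 0 < u \<and> u < 1 \<and> 2 * s0 < u * (2 / c)} u"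
    have mG: "?G \<in> borel_measurable borel" unfolding indicator_def mem_Collect_eq by measurable
    have "head_beta m (2 * s0) (2 / c) * ennreal (sqrt y ^ (D - 3) / c ^ (D - 1)) = (\<integral>\<^sup>+u. ?G u \<partial>lborel) * ennreal (sqrt y ^ (D - 3) / c ^ (D - 1))"
      by (simp add: head_beta_def)
    also have "(\<integral>\<^sup>+u. ?G u \<partial>lborel) = ennreal c * (\<integral>\<^sup>+r. ?G (c * r) \<partial>lborel)"
      using nn_integral_real_affine[OF mG, of c 0] c by simp
    also have "\<dots> * ennreal (sqrt y ^ (D - 3) / c ^ (D - 1)) = (\<integral>\<^sup>+r. ennreal c * ?G (c * r) * ennreal (sqrt y ^ (D - 3) / c ^ (D - 1)) \<partial>lborel)"
      using mG by (subst nn_integral_multc, simp_all, subst nn_integral_cmult, simp_all)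
    also have "\<dots> = (\<integral>\<^sup>+r. ?H r y \<partial>lborel)"
    proof (rule nn_integral_cong)
      fix r
      have iff: "0 < c * r \<and> c * r < 1 \<and> 2 * s0 < c * r * (2 / c) \<longleftrightarrow> s0 < r \<and> r * (1 + y) < 1"
        using c s0 by (auto simp: c_def[symmetric] mult.commute)
      show "ennreal c * ?G (c * r) * ennreal (sqrt y ^ (D - 3) / c ^ (D - 1)) = ?H r y"
      proof (cases "s0 < r \<and> r * (1 + y) < 1")
        case True
        have r: "r > 0" "1 - c * r > 0" using True s0 by (auto simp: c_def mult.commute)
        have e1: "sqrt y ^ (D - 3) = y powr (m - 1/2)"
          using y D by (simp add: sqrt_power_eq_powr of_nat_diff field_simps)
        have e2: "c ^ (D - 1) = c powr (2 * m + 1)"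
          using c D by (simp add: powr_realpow[symmetric] of_nat_diff add.commute)
        have e3: "1 - r - r * y = 1 - c * r" by (simp add: c_def algebra_simps)
        have "c * ((c * r) powr m / sqrt (1 - c * r)) * (y powr (m - 1/2) / c powr (2 * m + 1)) = r powr m * (y powr (m - 1/2) * c powr (- m) / sqrt (1 - c * r))"
        proof -
          define v where "v = 1 - c * r"
          have v: "v > 0" using r by (simp add: v_def)
          show ?thesis unfolding v_def[symmetric]
            by (rule eq_via_ln) (use c r y v in \<open>auto simp: ln_mult ln_div ln_powr ln_sqrt algebra_simps intro!: mult_pos_pos divide_pos_pos\<close>)
        qed
        then have "ennreal c * ennreal ((c * r) powr m / sqrt (1 - c * r)) * ennreal (sqrt y ^ (D - 3) / c ^ (D - 1))
          = ennreal (r powr m) * ennreal (y powr (m - 1/2) * (1 + y) powr (- m) / sqrt (1 - r - r * y))"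
          unfolding e1 e2 e3 c_def[symmetric] using c r by (simp only: ennreal_mult[symmetric] mult_nonneg_nonneg divide_nonneg_nonneg powr_ge_zero real_sqrt_ge_zero less_imp_le)
        moreover have "indicator {u. 0 < u \<and> u < 1 \<and> 2 * s0 < u * (2 / c)} (c * r) = (1::ennreal)" using True iff by simp
        moreover have "indicator {s0<..} r = (1::ennreal)" "indicator {y. 0 < y \<and> r * (1 + y) < 1} y = (1::ennreal)" using True y by auto
        ultimately show ?thesis by (simp only: mult_1_right mult_1_left)
      next
        case False
        then have "indicator {u. 0 < u \<and> u < 1 \<and> 2 * s0 < u * (2 / c)} (c * r) = (0::ennreal)" using iff by simp
        moreover have "indicator {s0<..} r * indicator {y. 0 < y \<and> r * (1 + y) < 1} y = (0::ennreal)" using False by (auto simp: indicator_def)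
        ultimately show ?thesis by auto
      qed
    qed
    finally show ?thesis using y by (simp add: c_def)
  qed simp
  have Hr: "(\<integral>\<^sup>+y. ?H r y \<partial>lborel) = (\<integral>\<^sup>+\<sigma>. ennreal ?B * (ennreal (r powr (m - 1/2)) * indicator {s0<..} r * (?J \<sigma> * indicator {0<..<1 - r} \<sigma>)) \<partial>lborel)" for r
  proof (cases "s0 < r \<and> r < 1")
    case True
    then have r: "0 < r" "r < 1" using s0 by auto
    have rr: "r powr m * r powr (-1/2) = r powr (m - 1/2)"
      unfolding powr_add[symmetric] by (rule arg_cong[where f="(powr) r"]) simp
    have ind: "indicator {s0<..} r = (1::ennreal)" using True by simp
    have "(\<integral>\<^sup>+y. ?H r y \<partial>lborel) = ennreal (r powr m) * (ennreal (r powr (-1/2)) * (ennreal ?B * (\<integral>\<^sup>+\<sigma>. ?J \<sigma> * indicator {0<..<1 - r} \<sigma> \<partial>lborel)))"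
      unfolding nn_integral_mass_fibre[OF m r, symmetric] ind mult_1_left by (rule nn_integral_cmult) (unfold indicator_def mem_Collect_eq, measurable)
    also have "\<dots> = (ennreal ?B * ennreal (r powr (m - 1/2))) * (\<integral>\<^sup>+\<sigma>. ?J \<sigma> * indicator {0<..<1 - r} \<sigma> \<partial>lborel)"
      unfolding rr[symmetric] by (simp add: ennreal_mult mult_ac)
    also have "\<dots> = (\<integral>\<^sup>+\<sigma>. (ennreal ?B * ennreal (r powr (m - 1/2))) * (?J \<sigma> * indicator {0<..<1 - r} \<sigma>) \<partial>lborel)"
      by (rule nn_integral_cmult[symmetric]) measurable
    finally show ?thesis unfolding ind by (simp only: mult.assoc mult_1_left)
  next
    case False
    have z: "?H r y = 0" for y
    proof (cases "s0 < r")
      case r: True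
      then have "r \<ge> 1" using False by simp
      then have "\<not> (0 < y \<and> r * (1 + y) < 1)" by (smt (verit) mult_less_cancel_left1 mult_mono)
      then show ?thesis by simp
    qed simp
    have z': "indicator {s0<..} r * indicator {0<..<1 - r} \<sigma> = (0::ennreal)" for \<sigma> using False by (auto simp: indicator_def)
    have zz: "ennreal ?B * (ennreal (r powr (m - 1/2)) * indicator {s0<..} r * (?J \<sigma> * indicator {0<..<1 - r} \<sigma>)) = 0" for \<sigma>
      using z'[of \<sigma>] by auto
    show ?thesis unfolding z zz ..
  qed
  have inner: "(\<integral>\<^sup>+r. ennreal ?B * (ennreal (r powr (m - 1/2)) * indicator {s0<..} r * (?J \<sigma> * indicator {0<..<1 - r} \<sigma>)) \<partial>lborel) =
     ennreal (?B / (m + 1/2)) * ennreal (indicator {0..1 - s0} \<sigma> * (\<sigma> powr (m - 1) * (1 - \<sigma>) powr (m + 1 - 1) - s0 powr (m + 1/2) * (\<sigma> powr (m - 1) * (1 - \<sigma>) powr (1/2 - 1))))"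
    if "\<sigma> \<noteq> 0" "\<sigma> \<noteq> 1 - s0" for \<sigma>
  proof (cases "0 < \<sigma> \<and> \<sigma> < 1 - s0")
    case True
    have i: "ennreal ?B * (ennreal (r powr (m - 1/2)) * indicator {s0<..} r * (?J \<sigma> * indicator {0<..<1 - r} \<sigma>)) =
      (ennreal ?B * ?J \<sigma>) * (ennreal (r powr (m - 1/2)) * indicator {s0<..<1-\<sigma>} r)" for r
      using True by (auto simp: indicator_def mult_ac)
    have "(\<integral>\<^sup>+r. ennreal ?B * (ennreal (r powr (m - 1/2)) * indicator {s0<..} r * (?J \<sigma> * indicator {0<..<1 - r} \<sigma>)) \<partial>lborel)
       = (ennreal ?B * ?J \<sigma>) * (\<integral>\<^sup>+r. ennreal (r powr (m - 1/2)) * indicator {s0<..<1-\<sigma>} r \<partial>lborel)"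
      unfolding i by (rule nn_integral_cmult) measurable
    also have "(\<integral>\<^sup>+r. ennreal (r powr (m - 1/2)) * indicator {s0<..<1-\<sigma>} r \<partial>lborel) = (\<integral>\<^sup>+r. ennreal (r powr (m - 1/2)) * indicator {s0..1-\<sigma>} r \<partial>lborel)"
      by (intro nn_integral_cong_AE eventually_mono[OF eventually_conj[OF AE_lborel_singleton[of s0] AE_lborel_singleton[of "1 - \<sigma>"]]])
        (auto simp: indicator_def)
    also have "\<dots> = ennreal ((1 - \<sigma>) powr (m + 1/2) / (m + 1/2) - s0 powr (m + 1/2) / (m + 1/2))"
    proof (rule nn_integral_FTC_Icc[where F="\<lambda>r. r powr (m + 1/2) / (m + 1/2)"])
      fix x assume "x \<in> {s0..1 - \<sigma>}"
      then have "x > 0" using s0 by simp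
      then have "((\<lambda>r. r powr (m + 1/2)) has_real_derivative (m + 1/2) * x powr (m + 1/2 - 1)) (at x)"
        by (rule has_real_derivative_powr)
      from DERIV_cdivide[OF this, of "m + 1/2"]
      have "((\<lambda>r. r powr (m + 1/2) / (m + 1/2)) has_real_derivative (m + 1/2) * x powr (m + 1/2 - 1) / (m + 1/2)) (at x)" .
      also have "(m + 1/2) * x powr (m + 1/2 - 1) / (m + 1/2) = x powr (m + 1/2 - 1)" using m by simp
      also have "m + 1/2 - 1 = m - 1/2" by simp
      finally show "((\<lambda>r. r powr (m + 1/2) / (m + 1/2)) has_real_derivative x powr (m - 1/2)) (at x)" .
    qed (use True in auto)
    also have "ennreal ?B * ?J \<sigma> * \<dots> = ennreal (?B / (m + 1/2)) * ennreal (\<sigma> powr (m - 1) * (1 - \<sigma>) powr (m + 1 - 1) - s0 powr (m + 1/2) * (\<sigma> powr (m - 1) * (1 - \<sigma>) powr (1/2 - 1)))"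
    proof -
      define v where "v = 1 - \<sigma>"
      define Z where "Z = v powr (m + 1/2) - s0 powr (m + 1/2)"
      have v: "v > 0" "s0 < v" using True s0 by (auto simp: v_def)
      have Z: "Z \<ge> 0" unfolding Z_def using v s0 m by (simp add: powr_mono2)
      have p1: "v powr (-1/2) * v powr (m + 1/2) = v powr (m + 1 - 1)"
        unfolding powr_add[symmetric] by (rule arg_cong[where f="(powr) v"]) simp
      have p2: "v powr (1/2 - 1) = v powr (-1/2)" by (rule arg_cong[where f="(powr) v"]) simp
      have r1: "\<sigma> powr (m - 1) * v powr (m + 1 - 1) - s0 powr (m + 1/2) * (\<sigma> powr (m - 1) * v powr (1/2 - 1)) = \<sigma> powr (m - 1) * v powr (-1/2) * Z"
        unfolding p1[symmetric] p2 Z_def by (simp only: algebra_simps)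
      have r2: "v powr (m + 1/2) / (m + 1/2) - s0 powr (m + 1/2) / (m + 1/2) = Z / (m + 1/2)"
        by (simp only: Z_def diff_divide_distrib)
      have "ennreal ?B * ennreal (\<sigma> powr (m - 1) * v powr (-1/2)) * ennreal (Z / (m + 1/2)) = ennreal (?B * (\<sigma> powr (m - 1) * v powr (-1/2)) * (Z / (m + 1/2)))"
        using Bpos Z m by (simp only: ennreal_mult[symmetric] mult_nonneg_nonneg divide_nonneg_nonneg powr_ge_zero less_imp_le add_nonneg_nonneg zero_le_divide_1_iff zero_le_numeral)
      also have "?B * (\<sigma> powr (m - 1) * v powr (-1/2)) * (Z / (m + 1/2)) = (?B / (m + 1/2)) * (\<sigma> powr (m - 1) * v powr (-1/2) * Z)"
        by (simp only: times_divide_eq_left times_divide_eq_right mult_ac)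
      also have "ennreal \<dots> = ennreal (?B / (m + 1/2)) * ennreal (\<sigma> powr (m - 1) * v powr (-1/2) * Z)"
        using Bpos Z m by (intro ennreal_mult) auto
      finally show ?thesis unfolding v_def[symmetric] r1 r2 .
    qed
    moreover have "indicator {0..1 - s0} \<sigma> = (1::real)" using True by simp
    ultimately show ?thesis by (simp only: mult_1_left)
  next
    case False
    have z: "indicator {s0<..} r * indicator {0<..<1 - r} \<sigma> = (0::ennreal)" for r using False by (auto simp: indicator_def)
    have zz: "ennreal ?B * (ennreal (r powr (m - 1/2)) * indicator {s0<..} r * (?J \<sigma> * indicator {0<..<1 - r} \<sigma>)) = 0" for r
      using z[of r] by auto
    have "indicator {0..1 - s0} \<sigma> = (0::real)" using False that by (auto simp: indicator_def)
    then show ?thesis unfolding zz by simp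
  qed
  have "(\<integral>\<^sup>+y. head_beta m (2 * s0) (2 / (1 + y)) * ennreal (sqrt y ^ (D - 3) / (1 + y) ^ (D - 1)) * indicator {0<..} y \<partial>lborel)
    = (\<integral>\<^sup>+y. (\<integral>\<^sup>+r. ?H r y \<partial>lborel) \<partial>lborel)" by (simp only: H)
  also have "\<dots> = (\<integral>\<^sup>+r. (\<integral>\<^sup>+y. ?H r y \<partial>lborel) \<partial>lborel)"
    using lborel_pair.Fubini'[of "\<lambda>r y. ?H r y"] mH by simp
  also have "\<dots> = (\<integral>\<^sup>+r. (\<integral>\<^sup>+\<sigma>. ennreal ?B * (ennreal (r powr (m - 1/2)) * indicator {s0<..} r * (?J \<sigma> * indicator {0<..<1 - r} \<sigma>)) \<partial>lborel) \<partial>lborel)"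
    by (simp only: Hr)
  also have "\<dots> = (\<integral>\<^sup>+\<sigma>. (\<integral>\<^sup>+r. ennreal ?B * (ennreal (r powr (m - 1/2)) * indicator {s0<..} r * (?J \<sigma> * indicator {0<..<1 - r} \<sigma>)) \<partial>lborel) \<partial>lborel)"
    by (rule lborel_pair.Fubini'[symmetric]) (unfold indicator_def mem_Collect_eq greaterThan_iff greaterThanLessThan_iff, measurable)
  also have "\<dots> = (\<integral>\<^sup>+\<sigma>. ennreal (?B / (m + 1/2)) * ennreal (indicator {0..1 - s0} \<sigma> * (\<sigma> powr (m - 1) * (1 - \<sigma>) powr (m + 1 - 1) - s0 powr (m + 1/2) * (\<sigma> powr (m - 1) * (1 - \<sigma>) powr (1/2 - 1)))) \<partial>lborel)"
    by (intro nn_integral_cong_AE eventually_mono[OF eventually_conj[OF AE_lborel_singleton[of 0] AE_lborel_singleton[of "1 - s0"]]])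
      (use inner in blast)
  also have "\<dots> = ennreal (?B / (m + 1/2)) * (\<integral>\<^sup>+\<sigma>. ennreal (indicator {0..1 - s0} \<sigma> * (\<sigma> powr (m - 1) * (1 - \<sigma>) powr (m + 1 - 1) - s0 powr (m + 1/2) * (\<sigma> powr (m - 1) * (1 - \<sigma>) powr (1/2 - 1)))) \<partial>lborel)"
    by (rule nn_integral_cmult) measurable
  also have "(\<integral>\<^sup>+\<sigma>. ennreal (indicator {0..1 - s0} \<sigma> * (\<sigma> powr (m - 1) * (1 - \<sigma>) powr (m + 1 - 1) - s0 powr (m + 1/2) * (\<sigma> powr (m - 1) * (1 - \<sigma>) powr (1/2 - 1)))) \<partial>lborel)
     = ennreal (incomplete_Beta (1 - s0) m (m + 1) - s0 powr (m + 1/2) * incomplete_Beta (1 - s0) m (1/2))"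
  proof (rule nn_integral_has_integral_lebesgue)
    fix \<sigma> assume s: "\<sigma> \<in> {0..1 - s0}"
    define v where "v = 1 - \<sigma>"
    have v: "v > 0" "s0 \<le> v" using s s0 by (auto simp: v_def)
    have "s0 powr (m + 1/2) * v powr (1/2 - 1) \<le> v powr (m + 1/2) * v powr (1/2 - 1)"
      using v s0 m by (intro mult_right_mono powr_mono2) auto
    also have "\<dots> = v powr (m + 1 - 1)"
      unfolding powr_add[symmetric] by (rule arg_cong[where f="(powr) v"]) simp
    finally have "\<sigma> powr (m - 1) * (s0 powr (m + 1/2) * v powr (1/2 - 1)) \<le> \<sigma> powr (m - 1) * v powr (m + 1 - 1)"
      by (rule mult_left_mono) simp
    then show "0 \<le> \<sigma> powr (m - 1) * (1 - \<sigma>) powr (m + 1 - 1) - s0 powr (m + 1/2) * (\<sigma> powr (m - 1) * (1 - \<sigma>) powr (1/2 - 1))"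
      unfolding v_def[symmetric] by (simp only: mult.left_commute diff_ge_0_iff_ge)
  next
    have i: "(\<lambda>t. t powr (m - 1) * (1 - t) powr (m + 1 - 1)) integrable_on {0..1 - s0}"
      "(\<lambda>t. t powr (m - 1) * (1 - t) powr (1/2 - 1)) integrable_on {0..1 - s0}"
      by (rule incomplete_Beta_integrable; use m s0 in simp)+
    show "((\<lambda>\<sigma>. \<sigma> powr (m - 1) * (1 - \<sigma>) powr (m + 1 - 1) - s0 powr (m + 1/2) * (\<sigma> powr (m - 1) * (1 - \<sigma>) powr (1/2 - 1))) has_integral
      (incomplete_Beta (1 - s0) m (m + 1) - s0 powr (m + 1/2) * incomplete_Beta (1 - s0) m (1/2))) {0..1 - s0}"
      unfolding incomplete_Beta_def
      by (intro has_integral_diff has_integral_mult_right integrable_integral i)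
  qed
  also have "ennreal (?B / (m + 1/2)) * \<dots> = ennreal (?B / (m + 1/2) * (incomplete_Beta (1 - s0) m (m + 1) - s0 powr (m + 1/2) * incomplete_Beta (1 - s0) m (1/2)))"
    using Bpos m by (intro ennreal_mult'[symmetric]) simp
  finally show ?thesis .
qed

section \<open>The angle equation\<close>

lemma incomplete_Beta_combine:
  assumes "a > 0" "b > 0" "0 \<le> z" "z \<le> z'" "z' \<le> 1"
  shows "incomplete_Beta z' a b = incomplete_Beta z a b + integral {z..z'} (\<lambda>t. t powr (a - 1) * (1 - t) powr (b - 1))"
  unfolding incomplete_Beta_def
  using Henstock_Kurzweil_Integration.integral_combine[OF assms(3,4) incomplete_Beta_integrable[OF assms(1,2)]] assms by simp

lemma incomplete_Beta_mono:
  assumes "a > 0" "b > 0" "0 \<le> z" "z \<le> z'" "z' \<le> 1"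
  shows "incomplete_Beta z a b \<le> incomplete_Beta z' a b"
proof -
  have "0 \<le> integral {z..z'} (\<lambda>t. t powr (a - 1) * (1 - t) powr (b - 1))"
    by (rule integral_nonneg)
      (use assms in \<open>auto intro!: integrable_on_subinterval[OF incomplete_Beta_integrable[of a b 1]]\<close>)
  then show ?thesis using incomplete_Beta_combine[OF assms] by simp
qed

lemma incomplete_Beta_pos:
  assumes "a > 0" "b > 0" "0 < z" "z \<le> 1"
  shows "0 < incomplete_Beta z a b"
proof -
  let ?f = "\<lambda>t. t powr (a - 1) * (1 - t) powr (b - 1)"
  have hi: "(?f has_integral incomplete_Beta z a b) {0..z}"
    unfolding incomplete_Beta_def by (rule integrable_integral, rule incomplete_Beta_integrable) (use assms in auto)
  then have nn: "(\<integral>\<^sup>+t. ennreal (indicator {0..z} t * ?f t) \<partial>lborel) = ennreal (incomplete_Beta z a b)"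
    by (intro nn_integral_has_integral_lebesgue) auto
  have "(\<integral>\<^sup>+t. ennreal (indicator {0..z} t * ?f t) \<partial>lborel) \<noteq> 0"
  proof
    assume "(\<integral>\<^sup>+t. ennreal (indicator {0..z} t * ?f t) \<partial>lborel) = 0"
    then have "AE t in lborel. ennreal (indicator {0..z} t * ?f t) = 0"
      by (subst (asm) nn_integral_0_iff_AE) auto
    then have "AE t in lborel. t \<notin> {0<..<z}"
    proof (rule eventually_mono)
      fix t assume t: "ennreal (indicator {0..z} t * ?f t) = 0"
      show "t \<notin> {0<..<z}"
      proof
        assume "t \<in> {0<..<z}"
        then have "0 < ?f t" "indicator {0..z} t = (1::real)" using assms by auto
        then show False using t by (simp add: ennreal_eq_0_iff)
      qed
    qed
    then have "emeasure lborel {0<..<z} = 0" by (subst (asm) AE_iff_measurable[of "{0<..<z}"]) auto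
    then show False using assms by simp
  qed
  then show ?thesis unfolding nn by (simp add: ennreal_eq_0_iff not_le)
qed

lemma incomplete_Beta_continuous:
  assumes "a > 0" "b > 0"
  shows "continuous_on {0..1} (\<lambda>z. incomplete_Beta z a b)"
  unfolding incomplete_Beta_def
  by (rule indefinite_integral_continuous_1, rule incomplete_Beta_integrable) (use assms in auto)

text \<open>The left-hand side of the angle equation in the variable \<open>s = (sin (\<alpha> / 2))\<^sup>2\<close>.\<close>

definition cap_function :: "real \<Rightarrow> real \<Rightarrow> real"
  where "cap_function m s = incomplete_Beta (1 - s) m (m + 1) / s powr (m + 1/2) - incomplete_Beta (1 - s) m (1/2)"

text \<open>From s to s' both incomplete Beta functions lose their part over [1 - s', 1 - s]. There
  1 - t \<ge> s, so the loss of the second is at most the loss of the first divided by s^(m + 1/2).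
  Strictness comes from the growing denominator.\<close>

lemma cap_function_strict_antimono:
  assumes m: "m > 0" and s: "0 < s" "s < s'" "s' < 1"
  shows "cap_function m s' < cap_function m s"
proof -
  let ?f1 = "\<lambda>t. t powr (m - 1) * (1 - t) powr (m + 1 - 1)" and ?f2 = "\<lambda>t. t powr (m - 1) * (1 - t) powr (1/2 - 1)"
  let ?I1 = "integral {1 - s'..1 - s} ?f1" and ?I2 = "integral {1 - s'..1 - s} ?f2"
  define k where "k = m + 1/2"
  have k: "k > 0" using m by (simp add: k_def)
  have c1: "incomplete_Beta (1 - s) m (m + 1) = incomplete_Beta (1 - s') m (m + 1) + ?I1"
    by (rule incomplete_Beta_combine) (use m s in auto)
  have c2: "incomplete_Beta (1 - s) m (1/2) = incomplete_Beta (1 - s') m (1/2) + ?I2"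
    by (rule incomplete_Beta_combine) (use m s in auto)
  have sk: "0 < s powr k" "s powr k < s' powr k" using s k by (auto intro: powr_less_mono2)
  have i: "?f1 integrable_on {1 - s'..1 - s}" "?f2 integrable_on {1 - s'..1 - s}"
    by (rule integrable_on_subinterval[OF incomplete_Beta_integrable[of _ _ 1]]; use m s in simp)+
  have "?I2 \<le> integral {1 - s'..1 - s} (\<lambda>t. ?f1 t / s powr k)"
  proof (rule integral_le)
    fix t assume t: "t \<in> {1 - s'..1 - s}"
    define v where "v = 1 - t"
    have v: "v > 0" "s \<le> v" using t s by (auto simp: v_def)
    have "s powr k * v powr (1/2 - 1) \<le> v powr k * v powr (1/2 - 1)"
      using v s k by (intro mult_right_mono powr_mono2) auto
    also have "\<dots> = v powr (m + 1 - 1)"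
      unfolding powr_add[symmetric] k_def by (rule arg_cong[where f="(powr) v"]) simp
    finally have "v powr (1/2 - 1) \<le> v powr (m + 1 - 1) / s powr k"
      using sk by (simp add: pos_le_divide_eq mult.commute)
    then show "?f2 t \<le> ?f1 t / s powr k"
      unfolding v_def[symmetric] times_divide_eq_right[symmetric] by (rule mult_left_mono) simp
  qed (use i in \<open>auto intro!: integrable_on_divide\<close>)
  also have "\<dots> = ?I1 / s powr k" by simp
  finally have I: "?I2 \<le> ?I1 / s powr k" .
  have "incomplete_Beta (1 - s') m (m + 1) > 0" using m s by (intro incomplete_Beta_pos) auto
  then have "incomplete_Beta (1 - s') m (m + 1) / s' powr k < incomplete_Beta (1 - s') m (m + 1) / s powr k"
    using sk by (intro divide_strict_left_mono mult_pos_pos) (auto intro: less_trans)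
  then show ?thesis
    unfolding cap_function_def k_def[symmetric] c1 c2 add_divide_distrib using I by linarith
qed

lemma cap_function_surj:
  assumes m: "m > 0" and T: "T > 0"
  obtains s where "0 < s" "s < 1" "cap_function m s = T"
proof -
  define k where "k = m + 1/2"
  have k: "k > 0" using m by (simp add: k_def)
  define c where "c = incomplete_Beta (1/2) m (m + 1)"
  define b where "b = incomplete_Beta 1 m (1/2)"
  have c: "c > 0" unfolding c_def using m by (intro incomplete_Beta_pos) auto
  have b: "b > 0" unfolding b_def using m by (intro incomplete_Beta_pos) auto
  \<comment> \<open>With 1 - e \<ge> 1/2 the first term of \<open>cap_function\<close> at e is at
    least c / e^k \<ge> T + b, while the second is at most b. The function vanishes at 1, so T lies
    between its values at 1 and e.\<close>
  define e where "e = min (1/2) ((c / (T + b)) powr (1 / k))"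
  have e: "0 < e" "e \<le> 1/2" using c b T by (auto simp: e_def)
  have "e powr k \<le> ((c / (T + b)) powr (1 / k)) powr k"
    using e k by (intro powr_mono2) (auto simp: e_def)
  also have "\<dots> = c / (T + b)" using k c b T by (simp add: powr_powr)
  finally have "T + b \<le> c / e powr k" using e c b T by (simp add: field_simps)
  also have "\<dots> \<le> incomplete_Beta (1 - e) m (m + 1) / e powr k"
    unfolding c_def using e m by (intro divide_right_mono incomplete_Beta_mono) auto
  finally have "T + b \<le> incomplete_Beta (1 - e) m (m + 1) / e powr k" .
  moreover have "incomplete_Beta (1 - e) m (1/2) \<le> b"
    unfolding b_def using e m by (intro incomplete_Beta_mono) auto
  ultimately have lo: "T \<le> cap_function m e" unfolding cap_function_def k_def by linarith
  have hi: "cap_function m 1 \<le> T" using T by (simp add: cap_function_def incomplete_Beta_def)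
  have "continuous_on {e..1} (cap_function m)"
  proof -
    have im: "(\<lambda>s. 1 - s) ` {e..1} \<subseteq> {0..1}" using e by auto
    have "continuous_on {e..1} (\<lambda>s. incomplete_Beta (1 - s) m b)" if "b > 0" for b
      by (rule continuous_on_compose2[OF incomplete_Beta_continuous[OF m that] _ im]) (intro continuous_intros)
    then show ?thesis unfolding cap_function_def[abs_def]
      using e m by (intro continuous_intros) auto
  qed
  then obtain s where s: "e \<le> s" "s \<le> 1" "cap_function m s = T"
    using IVT2'[of "cap_function m" 1 T e] lo hi e by auto
  moreover have "s \<noteq> 1" using s(3) T by (auto simp: cap_function_def incomplete_Beta_def)
  ultimately show ?thesis using e that[of s] by auto
qed

lemma sin_half_pos: "0 < \<alpha> \<Longrightarrow> \<alpha> < pi \<Longrightarrow> 0 < sin (\<alpha> / 2)"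
  by (rule sin_gt_zero) auto

lemma angle_equation_iff:
  assumes d: "d \<ge> 3" and q: "q > 0" and \<alpha>: "0 < \<alpha>" "\<alpha> < pi"
  shows "angle_equation d q \<alpha> \<longleftrightarrow> cap_function ((real d - 2) / 2) ((sin (\<alpha> / 2))\<^sup>2) =
    sqrt pi * Gamma (real d / 2 - 1) / (q * 2 powr ((real d - 2) / 2) * Gamma ((real d - 1) / 2))"
proof -
  have s: "sin (\<alpha> / 2) > 0" using \<alpha> by (rule sin_half_pos)
  have 1: "(cos (\<alpha> / 2))\<^sup>2 = 1 - (sin (\<alpha> / 2))\<^sup>2" by (rule cos_squared_eq)
  have 2: "((sin (\<alpha> / 2))\<^sup>2) powr ((real d - 2) / 2 + 1/2) = sin (\<alpha> / 2) ^ (d - 1)"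
  proof -
    have "((sin (\<alpha> / 2))\<^sup>2) powr ((real d - 2) / 2 + 1/2) = sin (\<alpha> / 2) powr (2 * ((real d - 2) / 2 + 1/2))"
      using s by (simp only: powr_powr powr_numeral[symmetric])
    also have "2 * ((real d - 2) / 2 + 1/2) = real (d - 1)" using d by (simp add: field_simps of_nat_diff)
    finally show ?thesis using s by (simp add: powr_realpow)
  qed
  have 3: "real d / 2 = (real d - 2) / 2 + 1" by (simp add: field_simps)
  have "(1 / sin (\<alpha> / 2)) ^ (d - 1) * incomplete_Beta (1 - (sin (\<alpha> / 2))\<^sup>2) ((real d - 2) / 2) (real d / 2)
      - incomplete_Beta (1 - (sin (\<alpha> / 2))\<^sup>2) ((real d - 2) / 2) (1 / 2) = cap_function ((real d - 2) / 2) ((sin (\<alpha> / 2))\<^sup>2)"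
    unfolding cap_function_def 2 by (simp only: power_one_over 3) simp
  then show ?thesis unfolding angle_equation_def 1 by simp
qed

lemma angle_equation_unique_solution:
  assumes d: "d \<ge> 3" and q: "q > 0"
  obtains \<alpha> where "0 < \<alpha>" "\<alpha> < pi" "angle_equation d q \<alpha>"
    "\<And>\<beta>. 0 < \<beta> \<Longrightarrow> \<beta> < pi \<Longrightarrow> angle_equation d q \<beta> \<Longrightarrow> \<beta> = \<alpha>"
proof -
  define m where "m = (real d - 2) / 2"
  have m: "m > 0" using d by (simp add: m_def)
  define T where "T = sqrt pi * Gamma (real d / 2 - 1) / (q * 2 powr ((real d - 2) / 2) * Gamma ((real d - 1) / 2))"
  have T: "T > 0" unfolding T_def using d q by (intro divide_pos_pos mult_pos_pos Gamma_real_pos) auto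
  from cap_function_surj[OF m T] obtain s where s: "0 < s" "s < 1" "cap_function m s = T" .
  define \<alpha> where "\<alpha> = 2 * arcsin (sqrt s)"
  have rs: "0 < sqrt s" "sqrt s < 1" using s by auto
  have m1: "-1 < sqrt s" using rs by linarith
  have "0 < arcsin (sqrt s)" "arcsin (sqrt s) < pi / 2"
    using arcsin_less_arcsin[of 0 "sqrt s"] arcsin_lt_bounded[OF m1 rs(2)] rs by simp_all
  then have \<alpha>: "0 < \<alpha>" "\<alpha> < pi" by (simp_all add: \<alpha>_def)
  have "(sin (\<alpha> / 2))\<^sup>2 = s" using sin_arcsin[OF less_imp_le[OF m1] less_imp_le[OF rs(2)]] s by (simp add: \<alpha>_def)
  then have eq: "angle_equation d q \<alpha>" using s(3) angle_equation_iff[OF d q \<alpha>] by (simp add: m_def T_def)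
  have "\<beta> = \<alpha>" if \<beta>: "0 < \<beta>" "\<beta> < pi" "angle_equation d q \<beta>" for \<beta>
  proof -
    have lt: "(sin (x / 2))\<^sup>2 < (sin (y / 2))\<^sup>2" "0 < (sin (x / 2))\<^sup>2" "(sin (y / 2))\<^sup>2 < 1"
      if "0 < x" "x < y" "y < pi" for x y
    proof -
      have sy: "sin (y / 2) < sin (pi / 2)" using that by (intro sin_monotone_2pi) auto
      have "0 < sin (x / 2)" "sin (x / 2) < sin (y / 2)" using that by (auto intro!: sin_half_pos sin_monotone_2pi)
      then show "(sin (x / 2))\<^sup>2 < (sin (y / 2))\<^sup>2" "0 < (sin (x / 2))\<^sup>2" "(sin (y / 2))\<^sup>2 < 1"
        using sy by (auto intro: power_strict_mono simp: power_less_one_iff abs_square_less_1)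
    qed
    have c: "cap_function m ((sin (\<beta> / 2))\<^sup>2) = T" "cap_function m ((sin (\<alpha> / 2))\<^sup>2) = T"
      using \<beta> eq angle_equation_iff[OF d q] \<alpha> by (auto simp: m_def T_def)
    show ?thesis
    proof (rule linorder_cases[of \<beta> \<alpha>])
      assume "\<beta> < \<alpha>"
      then show ?thesis using cap_function_strict_antimono[OF m lt(2,1,3)[OF \<beta>(1) _ \<alpha>(2)]] c by simp
    next
      assume "\<alpha> < \<beta>"
      then show ?thesis using cap_function_strict_antimono[OF m lt(2,1,3)[OF \<alpha>(1) _ \<beta>(2)]] c by simp
    qed simp
  qed
  then show ?thesis using that \<alpha> eq by blast
qed

section \<open>The hypergeometric series\<close>

definition hyp_coeff :: "real \<Rightarrow> nat \<Rightarrow> real"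
  where "hyp_coeff b n = pochhammer b n / pochhammer (1/2) n"

lemma hyp2F1_eq_suminf: "hyp2F1 1 b (1/2) z = (\<Sum>n. hyp_coeff b n * z ^ n)"
  unfolding hyp2F1_def hyp_coeff_def
  by (intro suminf_cong) (simp add: pochhammer_fact[symmetric])

context
  fixes b :: real
  assumes b: "b > 0"
begin

lemma hyp_coeff_pos: "hyp_coeff b n > 0"
  unfolding hyp_coeff_def using b by (intro divide_pos_pos pochhammer_pos) auto

lemma hyp_coeff_Suc: "(real n + 1/2) * hyp_coeff b (Suc n) = (real n + b) * hyp_coeff b n"
proof -
  define h where "h = 1/2 + real n"
  have h: "h \<noteq> 0" "real n + 1/2 = h" by (simp_all add: h_def)
  show ?thesis
    unfolding hyp_coeff_def pochhammer_Suc h_def[symmetric] h(2) using h(1) by (simp add: add.commute)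
qed

lemma hyp_coeff_summable:
  assumes "norm z < 1"
  shows "summable (\<lambda>n. hyp_coeff b n * z ^ n)"
proof (rule summable_in_conv_radius)
  have "(\<lambda>n. norm (hyp_coeff b n) / norm (hyp_coeff b (Suc n))) \<longlonglongrightarrow> 1"
  proof -
    have "norm (hyp_coeff b n) / norm (hyp_coeff b (Suc n)) = (real n + 1/2) / (real n + b)" for n
      using hyp_coeff_Suc[of n] hyp_coeff_pos[of n] hyp_coeff_pos[of "Suc n"] b
      by (simp add: divide_simps)
    moreover have "(\<lambda>n. (real n + 1/2) / (real n + b)) \<longlonglongrightarrow> 1" by real_asymp
    ultimately show ?thesis by simp
  qed
  then have "conv_radius (hyp_coeff b) = ereal 1"
    by (intro conv_radius_ratio_limit[of _ 1]) (auto simp: hyp_coeff_pos[THEN less_imp_neq, symmetric])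
  then show "ereal (norm z) < conv_radius (hyp_coeff b)" using assms by simp
qed

text \<open>With first parameter 1 the coefficients obey the recursion \<open>hyp_coeff_Suc\<close>,
  so the hypergeometric equation drops to a first-order equation with an inhomogeneous term.\<close>

lemma hyp2F1_ode:
  assumes z: "\<bar>z\<bar> < 1" "z \<noteq> 0"
  obtains F' where "(hyp2F1 1 b (1/2) has_real_derivative F') (at z)"
    "z * (1 - z) * F' = b * z * hyp2F1 1 b (1/2) z + (hyp2F1 1 b (1/2) z - 1) / 2"
    and "hyp2F1 1 b (1/2) z - 1 = z * (\<Sum>n. hyp_coeff b (Suc n) * z ^ n)"
proof -
  let ?F = "hyp2F1 1 b (1/2)"
  let ?A = "hyp_coeff b"
  have Fe: "?F = (\<lambda>z. \<Sum>n. ?A n * z ^ n)" by (simp add: hyp2F1_eq_suminf fun_eq_iff)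
  define F' where "F' = (\<Sum>n. diffs ?A n * z ^ n)"
  have nz: "norm z < 1" using z by simp
  have der: "(?F has_real_derivative F') (at z)"
    unfolding Fe F'_def by (rule termdiffs_strong'[where K=1]) (use hyp_coeff_summable nz in auto)
  have s0: "summable (\<lambda>n. ?A n * z ^ n)" by (rule hyp_coeff_summable[OF nz])
  have s1: "summable (\<lambda>n. ?A (Suc n) * z ^ n)"
  proof -
    have "summable (\<lambda>n. ?A (Suc n) * z ^ Suc n)" using s0 by (subst summable_Suc_iff)
    from summable_mult[OF this, of "1 / z"] show ?thesis using z(2) by (simp add: field_simps)
  qed
  have sd: "summable (\<lambda>n. diffs ?A n * z ^ n)"
    using termdiff_converges[of z 1 ?A] hyp_coeff_summable nz by auto
  have sn: "summable (\<lambda>n. real n * ?A n * z ^ n)"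
  proof -
    have "summable (\<lambda>n. z * (diffs ?A n * z ^ n))" by (rule summable_mult[OF sd])
    then have "summable (\<lambda>n. real (Suc n) * ?A (Suc n) * z ^ Suc n)" by (simp add: diffs_def mult_ac)
    then show ?thesis by (subst (asm) summable_Suc_iff)
  qed
  have G: "?F z - 1 = z * (\<Sum>n. ?A (Suc n) * z ^ n)"
    using suminf_split_head[OF s0] suminf_mult[OF s1, of z]
    by (simp add: hyp2F1_eq_suminf mult_ac) (simp add: hyp_coeff_def)
  have zF: "(\<Sum>n. real n * ?A n * z ^ n) = z * F'"
    using suminf_split_head[OF sn] suminf_mult[OF sd, of z] by (simp add: F'_def diffs_def mult_ac)
  have "F' = (\<Sum>n. real n * ?A n * z ^ n + b * (?A n * z ^ n) + 1/2 * (?A (Suc n) * z ^ n))"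
    unfolding F'_def
  proof (rule suminf_cong)
    fix n
    have "diffs ?A n = real n * ?A n + b * ?A n + 1/2 * ?A (Suc n)"
      using hyp_coeff_Suc[of n] by (simp add: diffs_def algebra_simps)
    then show "diffs ?A n * z ^ n = real n * ?A n * z ^ n + b * (?A n * z ^ n) + 1/2 * (?A (Suc n) * z ^ n)"
      by (simp only: distrib_right mult.assoc)
  qed
  also have "\<dots> = z * F' + b * ?F z + 1/2 * (\<Sum>n. ?A (Suc n) * z ^ n)"
    unfolding zF[symmetric] hyp2F1_eq_suminf
    by (simp only: suminf_add[symmetric] suminf_mult summable_add summable_mult sn s0 s1)
  finally have "F' = z * F' + b * ?F z + 1/2 * (\<Sum>n. ?A (Suc n) * z ^ n)" .
  then have "z * F' = z * (z * F' + b * ?F z + 1/2 * (\<Sum>n. ?A (Suc n) * z ^ n))" by (rule arg_cong)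
  also have "\<dots> = z * (z * F') + b * z * ?F z + (z * (\<Sum>n. ?A (Suc n) * z ^ n)) / 2" by (simp add: algebra_simps)
  finally have "z * (1 - z) * F' = b * z * ?F z + (?F z - 1) / 2" unfolding G by (simp add: algebra_simps)
  with der G that show ?thesis by blast
qed

text \<open>By the first-order equation of \<open>hyp2F1_ode\<close> the right side, as a function
  of z, has the integrand as its derivative.\<close>

lemma hyp2F1_integral:
  assumes z: "0 \<le> z" "z < 1"
  shows "((\<lambda>w. (1 - w) powr (b - 1/2) / sqrt w) has_integral
    (1 - z) powr (b + 1/2) / sqrt z * (hyp2F1 1 b (1/2) z - 1) / b) {0..z}"
proof -
  let ?F = "hyp2F1 1 b (1/2)"
  \<comment> \<open>The quotient (F - 1) / sqrt w is written as sqrt w times a power series, which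
    makes the antiderivative continuous at w = 0.\<close>
  let ?G = "\<lambda>w. \<Sum>n. hyp_coeff b (Suc n) * w ^ n"
  let ?f = "\<lambda>w. (1 - w) powr (b + 1/2) * (sqrt w * ?G w) / b"
  have F1: "?F w - 1 = w * ?G w" if "0 \<le> w" "w < 1" for w
  proof (cases "w = 0")
    case True
    show ?thesis unfolding True hyp2F1_eq_suminf powser_zero by (simp add: hyp_coeff_def)
  next
    case False then show ?thesis using hyp2F1_ode[of w] that by (metis abs_of_nonneg)
  qed
  have feq: "?f w = (1 - w) powr (b + 1/2) / sqrt w * (?F w - 1) / b" if "0 \<le> w" "w < 1" for w
  proof -
    have "sqrt w * ?G w = (w * ?G w) / sqrt w"
      using that real_div_sqrt[of w] by (metis times_divide_eq_left)
    then show ?thesis unfolding F1[OF that] by simp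
  qed
  have contG: "continuous_on {0..z} ?G"
  proof (rule continuous_on_subset)
    have "continuous_on (cball 0 z) ?G"
    proof (cases "z = 0")
      case False
      have "summable (\<lambda>n. hyp_coeff b (Suc n) * w ^ n)" if "norm w < 1" for w
      proof (cases "w = 0")
        case False
        have "summable (\<lambda>n. hyp_coeff b (Suc n) * w ^ Suc n)" using hyp_coeff_summable[OF that] by (subst summable_Suc_iff)
        from summable_mult[OF this, of "1 / w"] show ?thesis using False by (simp add: field_simps)
      qed (auto intro: summable_finite[of "{0}"])
      then have "?G field_differentiable (at w)" if "norm w < 1" for w
        using termdiffs_strong'[of 1 "\<lambda>n. hyp_coeff b (Suc n)" w] that unfolding field_differentiable_def by blast
      then show ?thesis using z
        by (intro continuous_at_imp_continuous_on ballI field_differentiable_imp_continuous_at) auto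
    qed auto
    then show "continuous_on (cball 0 z) ?G" .
  qed auto
  have "((\<lambda>w. (1 - w) powr (b - 1/2) / sqrt w) has_integral ?f z - ?f 0) {0..z}"
  proof (rule fundamental_theorem_of_calculus_interior)
    show "continuous_on {0..z} ?f"
      using z b by (intro continuous_intros contG) auto
    fix w assume w: "w \<in> {0<..<z}"
    then have w1: "0 < w" "w < 1" using z by auto
    obtain F' where F': "(?F has_real_derivative F') (at w)"
      "w * (1 - w) * F' = b * w * ?F w + (?F w - 1) / 2"
      by (rule hyp2F1_ode[of w]) (use w1 in simp_all)
    define P where "P = (1 - w) powr (b - 1/2)"
    have P: "(1 - w) powr (b + 1/2) = P * (1 - w)" "(1 - w) powr (b + 1/2 - 1) = P"
    proof -
      have "(1 - w) powr (b + 1/2) = (1 - w) powr (b - 1/2 + 1)" by (rule arg_cong[where f="(powr) (1 - w)"]) simp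
      then show "(1 - w) powr (b + 1/2) = P * (1 - w)" unfolding P_def powr_add using w1 by simp
      show "(1 - w) powr (b + 1/2 - 1) = P" unfolding P_def by (rule arg_cong[where f="(powr) (1 - w)"]) simp
    qed
    have d1: "((\<lambda>w. (1 - w) powr (b + 1/2)) has_real_derivative - (b + 1/2) * P) (at w)"
      using w1 by (auto intro!: derivative_eq_intros simp: P_def algebra_simps)
    have d2: "((\<lambda>w. (?F w - 1) / sqrt w) has_real_derivative (F' * sqrt w - (?F w - 1) * (inverse (sqrt w) / 2)) / (sqrt w * sqrt w)) (at w)"
      using w1 by (auto intro!: derivative_eq_intros F'(1) DERIV_real_sqrt)
    have d3: "((\<lambda>w. (1 - w) powr (b + 1/2) * ((?F w - 1) / sqrt w) / b) has_real_derivative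
      ((- (b + 1/2) * P) * ((?F w - 1) / sqrt w) + ((F' * sqrt w - (?F w - 1) * (inverse (sqrt w) / 2)) / (sqrt w * sqrt w)) * (1 - w) powr (b + 1/2)) / b) (at w)"
      by (rule DERIV_cdivide[OF DERIV_mult[OF d1 d2]])
    define v where "v = sqrt w"
    define E where "E = ?F w - 1"
    have v: "v > 0" and wv: "w = v * v" using w1 by (auto simp: v_def)
    have ode: "w * (1 - w) * F' = b * w * (E + 1) + E / 2" using F'(2) by (simp add: E_def)
    have "((- (b + 1/2) * P) * (E / v) + ((F' * v - E * (inverse v / 2)) / (v * v)) * (P * (1 - w))) / b = P / v"
    proof -
      \<comment> \<open>Multiplication by w v clears the denominators; the differential equation
        then eliminates F'.\<close>
      have a1: "w * v * ((- (b + 1/2) * P) * (E / v)) = - (b + 1/2) * P * E * w" using v by simp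
      have "v * (F' * v - E * (inverse v / 2)) = F' * w - E / 2"
        using v by (simp add: right_diff_distrib wv)
      then have a2: "w * v * (((F' * v - E * (inverse v / 2)) / (v * v)) * (P * (1 - w))) = (F' * w - E / 2) * (P * (1 - w))"
        using v unfolding wv[symmetric] using w1 by (simp add: mult.assoc[symmetric])
      have "w * v * ((- (b + 1/2) * P) * (E / v) + ((F' * v - E * (inverse v / 2)) / (v * v)) * (P * (1 - w)))
        = P * (w * (1 - w) * F' - (b + 1/2) * E * w - E * (1 - w) / 2)"
        unfolding distrib_left[of "w * v"] a1 a2 by (simp add: algebra_simps)
      also have "\<dots> = P * (b * w)" unfolding ode by (simp add: algebra_simps add_divide_distrib diff_divide_distrib)
      also have "\<dots> = w * v * (b * (P / v))" using v by simp
      finally have "(- (b + 1/2) * P) * (E / v) + ((F' * v - E * (inverse v / 2)) / (v * v)) * (P * (1 - w)) = b * (P / v)"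
        by (rule mult_left_cancel[THEN iffD1, rotated]) (use v w1 in simp)
      then show ?thesis using b by simp
    qed
    with d3 have d4: "((\<lambda>w. (1 - w) powr (b + 1/2) * ((?F w - 1) / sqrt w) / b) has_real_derivative (1 - w) powr (b - 1/2) / sqrt w) (at w)"
      unfolding P(1) E_def[symmetric] v_def[symmetric] P_def[symmetric] by simp
    have "(?f has_real_derivative (1 - w) powr (b - 1/2) / sqrt w) (at w)"
    proof (rule has_field_derivative_transform_within_open[OF d4, of "{0<..<1}"])
      fix x :: real assume "x \<in> {0<..<1}"
      then show "(1 - x) powr (b + 1/2) * ((?F x - 1) / sqrt x) / b = ?f x" using feq[of x] by simp
    qed (use w1 in auto)
    then show "(?f has_vector_derivative (1 - w) powr (b - 1/2) / sqrt w) (at w)"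
      by (simp only: has_real_derivative_iff_has_vector_derivative)
  qed (use z in auto)
  then show ?thesis using feq[OF z] by simp
qed

end

text \<open>After u = 1 - w this is \<open>hyp2F1_integral\<close>. The subtracted 1 becomes the
  second term of the density formula. At p = c both sides are 0, the right one through division by
  zero.\<close>

lemma head_beta_eq_hyp2F1:
  assumes m: "m > -1/2" and c: "0 < c" "c \<le> p"
  shows "head_beta m c p = ennreal ((c / p) powr (m + 1) / sqrt (1 - c / p) * (hyp2F1 1 (m + 1/2) (1/2) (1 - c / p) - 1) / (m + 1/2))"
proof -
  let ?G = "\<lambda>u. ennreal (u powr m / sqrt (1 - u)) * indicator {u. 0 < u \<and> u < 1 \<and> c < u * p} u"
  define z where "z = 1 - c / p"
  have z: "0 \<le> z" "z < 1" using c by (auto simp: z_def field_simps)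
  have mG: "?G \<in> borel_measurable borel" unfolding indicator_def mem_Collect_eq by measurable
  have "head_beta m c p = (\<integral>\<^sup>+u. ?G u \<partial>lborel)" by (simp add: head_beta_def)
  also have "\<dots> = (\<integral>\<^sup>+w. ?G (1 + (-1) * w) \<partial>lborel)"
    using nn_integral_real_affine[OF mG, of "-1" 1] by simp
  also have "\<dots> = (\<integral>\<^sup>+w. ennreal (indicator {0..z} w * ((1 - w) powr (m + 1/2 - 1/2) / sqrt w)) \<partial>lborel)"
  proof (intro nn_integral_cong_AE eventually_mono[OF eventually_conj[OF AE_lborel_singleton[of 0] AE_lborel_singleton[of z]]])
    fix w :: real assume w: "w \<noteq> 0 \<and> w \<noteq> z"
    have "0 < 1 - w \<and> 1 - w < 1 \<and> c < (1 - w) * p \<longleftrightarrow> w \<in> {0..z}"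
    proof -
      have "c < (1 - w) * p \<longleftrightarrow> w < z" using c by (simp add: z_def field_simps)
      then show ?thesis using w z by auto
    qed
    then show "?G (1 + (-1) * w) = ennreal (indicator {0..z} w * ((1 - w) powr (m + 1/2 - 1/2) / sqrt w))"
      by (simp add: indicator_def)
  qed
  also have "\<dots> = ennreal ((1 - z) powr (m + 1/2 + 1/2) / sqrt z * (hyp2F1 1 (m + 1/2) (1/2) z - 1) / (m + 1/2))"
    using hyp2F1_integral[of "m + 1/2" z] m z by (intro nn_integral_has_integral_lebesgue) auto
  finally show ?thesis by (simp add: z_def add.commute)
qed

section \<open>Positive definiteness of the kernel\<close>

lemma nn_integral_gauss_moment_finite: "(\<integral>\<^sup>+s. ennreal (s ^ k * exp (- s\<^sup>2)) * indicator {0<..} s \<partial>lborel) < \<infinity>"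
proof -
  have fin: "(\<integral>\<^sup>+s. ennreal (indicator {0..} s *\<^sub>R (exp (- s\<^sup>2) * s ^ k)) \<partial>lborel) < \<infinity>" for k
  proof -
    have int: "integrable lborel (\<lambda>s::real. indicator {0..} s *\<^sub>R (exp (- s\<^sup>2) * s ^ k))"
    proof (cases "even k")
      case True
      then show ?thesis using gaussian_moment_even_pos[of "k div 2"] by (auto simp: has_bochner_integral_iff)
    next
      case False
      then show ?thesis using gaussian_moment_odd_pos[of "k div 2"] by (auto simp: has_bochner_integral_iff)
    qed
    then have "(\<integral>\<^sup>+s. ennreal (norm (indicator {0..} s *\<^sub>R (exp (- s\<^sup>2) * s ^ k))) \<partial>(lborel :: real measure)) < \<infinity>"
      unfolding integrable_iff_bounded by (rule conjunct2)
    also have "(\<lambda>s::real. ennreal (norm (indicator {0..} s *\<^sub>R (exp (- s\<^sup>2) * s ^ k)))) = (\<lambda>s. ennreal (indicator {0..} s *\<^sub>R (exp (- s\<^sup>2) * s ^ k)))"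
      by (auto simp: fun_eq_iff indicator_def)
    finally show ?thesis .
  qed
  have "(\<integral>\<^sup>+s. ennreal (s ^ k * exp (- s\<^sup>2)) * indicator {0<..} s \<partial>lborel) \<le> (\<integral>\<^sup>+s. ennreal (indicator {0..} s *\<^sub>R (exp (- s\<^sup>2) * s ^ k)) \<partial>lborel)"
    by (intro nn_integral_mono) (auto simp: indicator_def mult.commute)
  also have "\<dots> < \<infinity>" by (rule fin)
  finally show ?thesis .
qed

text \<open>Layer-cake: exp (-|z|^2) is the integral of 2 s exp (-s^2) over s \<ge> |z|, so Fubini
  leaves volumes of balls against a one-dimensional moment.\<close>

lemma nn_integral_gauss_finite: "(\<integral>\<^sup>+z. ennreal (exp (- (norm z)\<^sup>2)) \<partial>(lborel :: 'a::euclidean_space measure)) < \<infinity>"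
proof -
  let ?H = "\<lambda>s z::'a. ennreal (2 * s * exp (- s\<^sup>2)) * indicator {p. norm (snd p) \<le> fst p} (s, z)"
  have e: "ennreal (exp (- (norm z)\<^sup>2)) = (\<integral>\<^sup>+s. ?H s z \<partial>lborel)" for z :: 'a
  proof -
    have "(\<integral>\<^sup>+s. ?H s z \<partial>lborel) = (\<integral>\<^sup>+s. ennreal (2 * s * exp (- s\<^sup>2)) * indicator {norm z..} s \<partial>lborel)"
      by (intro nn_integral_cong) (auto simp: indicator_def)
    also have "\<dots> = ennreal (0 - (- exp (- (norm z)\<^sup>2)))"
    proof (rule nn_integral_FTC_atLeast[where F="\<lambda>s. - exp (- s\<^sup>2)"])
      fix x :: real assume "norm z \<le> x"
      show "((\<lambda>s. - exp (- s\<^sup>2)) has_real_derivative 2 * x * exp (- x\<^sup>2)) (at x)"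
        by (auto intro!: derivative_eq_intros)
      show "0 \<le> 2 * x * exp (- x\<^sup>2)" using order_trans[OF norm_ge_zero \<open>norm z \<le> x\<close>] by simp
    next
      show "((\<lambda>s::real. - exp (- s\<^sup>2)) \<longlongrightarrow> 0) at_top" by real_asymp
    qed simp
    finally show ?thesis by simp
  qed
  have "(\<integral>\<^sup>+z. ennreal (exp (- (norm z)\<^sup>2)) \<partial>(lborel :: 'a measure)) = (\<integral>\<^sup>+s. (\<integral>\<^sup>+z. ?H s z \<partial>lborel) \<partial>lborel)"
    unfolding e by (rule lborel_pair.Fubini') measurable
  also have "\<dots> = (\<integral>\<^sup>+s. ennreal (2 * unit_ball_vol DIM('a)) * (ennreal (s ^ (DIM('a) + 1) * exp (- s\<^sup>2)) * indicator {0<..} s) \<partial>lborel)"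
  proof (intro nn_integral_cong_AE eventually_mono[OF AE_lborel_singleton[of 0]])
    fix s :: real assume "s \<noteq> 0"
    show "(\<integral>\<^sup>+z. ?H s z \<partial>lborel) = ennreal (2 * unit_ball_vol DIM('a)) * (ennreal (s ^ (DIM('a) + 1) * exp (- s\<^sup>2)) * indicator {0<..} s)"
    proof (cases "s > 0")
      case True
      have "(\<integral>\<^sup>+z. ?H s z \<partial>lborel) = (\<integral>\<^sup>+z. ennreal (2 * s * exp (- s\<^sup>2)) * indicator (cball (0::'a) s) z \<partial>lborel)"
        by (intro nn_integral_cong) (auto simp: indicator_def)
      also have "\<dots> = ennreal (2 * s * exp (- s\<^sup>2)) * emeasure lborel (cball (0::'a) s)"
        by (rule nn_integral_cmult_indicator) simp
      also have "\<dots> = ennreal (2 * s * exp (- s\<^sup>2) * (unit_ball_vol DIM('a) * s ^ DIM('a)))"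
        using True by (subst emeasure_cball) (auto simp: ennreal_mult)
      also have "2 * s * exp (- s\<^sup>2) * (unit_ball_vol DIM('a) * s ^ DIM('a)) = 2 * unit_ball_vol DIM('a) * (s ^ (DIM('a) + 1) * exp (- s\<^sup>2))"
        by simp
      also have "ennreal \<dots> = ennreal (2 * unit_ball_vol DIM('a)) * ennreal (s ^ (DIM('a) + 1) * exp (- s\<^sup>2))"
        using True by (intro ennreal_mult) auto
      finally show ?thesis using True by simp
    next
      case False
      then have "\<not> norm z \<le> s" for z :: 'a using \<open>s \<noteq> 0\<close> norm_ge_zero[of z] by linarith
      then have z: "?H s z = 0" for z :: 'a by simp
      show ?thesis unfolding z using False by simp
    qed
  qed
  also have "\<dots> = ennreal (2 * unit_ball_vol DIM('a)) * (\<integral>\<^sup>+s. ennreal (s ^ (DIM('a) + 1) * exp (- s\<^sup>2)) * indicator {0<..} s \<partial>lborel)"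
    by (rule nn_integral_cmult) measurable
  also have "\<dots> < \<infinity>" using nn_integral_gauss_moment_finite[of "DIM('a) + 1"]
    by (simp add: ennreal_mult_less_top)
  finally show ?thesis .
qed

section \<open>The kernel as a superposition of Gaussians\<close>

definition gauss :: "real \<times> 'a::euclidean_space \<Rightarrow> 'a \<Rightarrow> real"
  where "gauss p x = exp (- ((fst p)\<^sup>2 * (norm (x - snd p))\<^sup>2))"

text \<open>The exponent makes the Gaussian superposition homogeneous of degree \<open>2 - DIM('a)\<close> in \<open>x - y\<close>.\<close>

definition gauss_weight :: "real \<times> 'a::euclidean_space \<Rightarrow> real"
  where "gauss_weight p = indicator {0<..} (fst p) * fst p ^ (2 * DIM('a) - 3)"

lemma gauss_measurable [measurable]: "(\<lambda>q. gauss (fst q) (snd q)) \<in> borel_measurable (borel \<Otimes>\<^sub>M borel)"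
  unfolding gauss_def borel_prod
  by (intro borel_measurable_continuous_onI continuous_intros)

lemma gauss_measurable1 [measurable]: "(\<lambda>p. gauss p x) \<in> borel_measurable borel"
  unfolding gauss_def by (intro borel_measurable_continuous_onI continuous_intros)

lemma gauss_measurable2 [measurable]: "gauss p \<in> borel_measurable borel"
  unfolding gauss_def[abs_def] by (intro borel_measurable_continuous_onI continuous_intros)

lemma gauss_weight_measurable [measurable]: "gauss_weight \<in> borel_measurable borel"
proof -
  have "(fst :: real \<times> 'a \<Rightarrow> real) \<in> borel_measurable borel"
    by (intro borel_measurable_continuous_onI continuous_intros)
  moreover have "(\<lambda>t::real. indicator {0<..} t * t ^ (2 * DIM('a) - 3) :: real) \<in> borel_measurable borel"
    by measurable
  ultimately show ?thesis unfolding gauss_weight_def[abs_def] by (rule measurable_compose)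
qed

lemma gauss_pos: "0 < gauss p x" and gauss_le_1: "gauss p x \<le> 1"
  by (simp_all add: gauss_def)

lemma gauss_weight_nonneg: "0 \<le> gauss_weight p"
  by (simp add: gauss_weight_def indicator_def)

text \<open>The first factor is the integral over the centre after recentring at the midpoint of x
  and y and rescaling; the second is the integral over the width for points at distance 1.\<close>

definition gauss_const :: "'a::euclidean_space itself \<Rightarrow> ennreal"
  where "gauss_const _ = (\<integral>\<^sup>+z. ennreal (exp (- (2 * (norm (z::'a))\<^sup>2))) \<partial>lborel) *
     (\<integral>\<^sup>+t. ennreal (t ^ (DIM('a) - 3) * exp (- (t\<^sup>2 / 2))) * indicator {0<..} t \<partial>lborel)"

lemma gauss_const_pos: "gauss_const TYPE('a::euclidean_space) > 0"
proof -
  have "(\<integral>\<^sup>+z. ennreal (exp (- (2 * (norm (z::'a))\<^sup>2))) \<partial>lborel) \<noteq> 0"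
  proof
    assume "(\<integral>\<^sup>+z. ennreal (exp (- (2 * (norm (z::'a))\<^sup>2))) \<partial>lborel) = 0"
    then have "AE z::'a in lborel. False" by (subst (asm) nn_integral_0_iff_AE) auto
    then have "emeasure lborel (UNIV :: 'a set) = 0" by (subst (asm) AE_iff_measurable[of UNIV]) auto
    then show False by (simp add: emeasure_lborel_UNIV)
  qed
  moreover have "(\<integral>\<^sup>+t. ennreal (t ^ (DIM('a) - 3) * exp (- (t\<^sup>2 / 2))) * indicator {0<..} t \<partial>lborel) \<noteq> 0"
  proof
    assume "(\<integral>\<^sup>+t. ennreal (t ^ (DIM('a) - 3) * exp (- (t\<^sup>2 / 2))) * indicator {0<..} t \<partial>lborel) = 0"
    then have "AE t in lborel. ennreal (t ^ (DIM('a) - 3) * exp (- (t\<^sup>2 / 2))) * indicator {0<..} t = 0"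
      by (subst (asm) nn_integral_0_iff_AE) auto
    then have "AE t::real in lborel. t \<notin> {0<..<1}"
    proof (rule eventually_mono)
      fix t :: real assume t: "ennreal (t ^ (DIM('a) - 3) * exp (- (t\<^sup>2 / 2))) * indicator {0<..} t = 0"
      show "t \<notin> {0<..<1}"
      proof
        assume "t \<in> {0<..<1}"
        then have "0 < t ^ (DIM('a) - 3) * exp (- (t\<^sup>2 / 2))" "indicator {0<..} t = (1::ennreal)" by auto
        then show False using t by (simp add: ennreal_eq_0_iff)
      qed
    qed
    then have "emeasure lborel {0<..<1::real} = 0" by (subst (asm) AE_iff_measurable[of "{0<..<1}"]) auto
    then show False by simp
  qed
  ultimately show ?thesis unfolding gauss_const_def by (simp add: zero_less_iff_neq_zero)
qed

lemma gauss_const_finite: "gauss_const TYPE('a::euclidean_space) < \<infinity>"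
proof -
  have "(\<integral>\<^sup>+z. ennreal (exp (- (2 * (norm (z::'a))\<^sup>2))) \<partial>lborel) \<le> (\<integral>\<^sup>+z. ennreal (exp (- (norm (z::'a))\<^sup>2)) \<partial>lborel)"
    by (intro nn_integral_mono) auto
  then have 1: "(\<integral>\<^sup>+z. ennreal (exp (- (2 * (norm (z::'a))\<^sup>2))) \<partial>lborel) < \<infinity>"
    using nn_integral_gauss_finite by (rule le_less_trans)
  let ?k = "DIM('a) - 3"
  let ?G = "\<lambda>t. ennreal (t ^ ?k * exp (- (t\<^sup>2 / 2))) * indicator {0<..} t"
  have "(\<integral>\<^sup>+t. ?G t \<partial>lborel) = ennreal (sqrt 2) * (\<integral>\<^sup>+t. ?G (sqrt 2 * t) \<partial>lborel)"
    using nn_integral_real_affine[of ?G "sqrt 2" 0] by simp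
  also have "(\<integral>\<^sup>+t. ?G (sqrt 2 * t) \<partial>lborel) = (\<integral>\<^sup>+t. ennreal (sqrt 2 ^ ?k) * (ennreal (t ^ ?k * exp (- t\<^sup>2)) * indicator {0<..} t) \<partial>lborel)"
    by (intro nn_integral_cong) (auto simp: power_mult_distrib zero_less_mult_iff indicator_def mult.assoc ennreal_mult')
  also have "\<dots> = ennreal (sqrt 2 ^ ?k) * (\<integral>\<^sup>+t. ennreal (t ^ ?k * exp (- t\<^sup>2)) * indicator {0<..} t \<partial>lborel)"
    by (rule nn_integral_cmult) measurable
  finally have 2: "(\<integral>\<^sup>+t. ?G t \<partial>lborel) < \<infinity>"
    using nn_integral_gauss_moment_finite[of ?k] by (simp add: ennreal_mult_less_top)
  show ?thesis unfolding gauss_const_def using 1 2 by (simp add: ennreal_mult_less_top)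
qed

text \<open>By the parallelogram law the product of the two Gaussians is a Gaussian around the
  midpoint of x and y times exp (-t^2 r^2 / 2), where r = |x - y|. Integrating out the centre leaves
  t^(DIM - 3), and the integral of this against the remaining factor scales as r^(2 - DIM). A kernel
  of this form is positive definite.\<close>

lemma kernel_eq_gauss:
  fixes x y :: "'a::euclidean_space"
  assumes d: "3 \<le> DIM('a)"
  shows "(\<integral>\<^sup>+p. ennreal (gauss_weight p * gauss p x * gauss p y) \<partial>lborel)
    = gauss_const TYPE('a) * (1 / ennreal (norm (x - y) ^ (DIM('a) - 2)))"
proof -
  define D where "D = DIM('a)"
  define r where "r = norm (x - y)"
  let ?C = "\<integral>\<^sup>+z. ennreal (exp (- (2 * (norm (z::'a))\<^sup>2))) \<partial>lborel"
  let ?M = "\<lambda>r t. ennreal (t ^ (D - 3) * exp (- (t\<^sup>2 * r\<^sup>2 / 2))) * indicator {0<..} t"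
  have inner: "(\<integral>\<^sup>+z. ennreal (gauss_weight (t, z) * gauss (t, z) x * gauss (t, z) y) \<partial>lborel) = ?C * ?M r t" for t
  proof (cases "t > 0")
    case t: True
    define c where "c = (1/2) *\<^sub>R (x + y)"
    have par: "(norm (x - (z + c)))\<^sup>2 + (norm (y - (z + c)))\<^sup>2 = 2 * (norm z)\<^sup>2 + r\<^sup>2 / 2" for z
    proof -
      define h where "h = (1/2) *\<^sub>R (x - y)"
      have e: "x - (z + c) = h - z" "y - (z + c) = - (h + z)"
        by (simp_all add: h_def c_def algebra_simps) (simp_all flip: scaleR_add_left)
      have "(norm (h - z))\<^sup>2 + (norm (h + z))\<^sup>2 = 2 * (norm z)\<^sup>2 + 2 * (norm h)\<^sup>2"
        unfolding power2_norm_eq_inner by (simp add: inner_add_left inner_add_right inner_diff_left inner_diff_right)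
      moreover have "2 * (norm h)\<^sup>2 = r\<^sup>2 / 2" by (simp add: h_def r_def power_mult_distrib power2_eq_square)
      ultimately show ?thesis unfolding e norm_minus_cancel by linarith
    qed
    let ?F = "\<lambda>z. ennreal (t ^ (2 * D - 3) * exp (- (t\<^sup>2 * ((norm (x - z))\<^sup>2 + (norm (y - z))\<^sup>2))))"
    have "(\<integral>\<^sup>+z. ennreal (gauss_weight (t, z) * gauss (t, z) x * gauss (t, z) y) \<partial>lborel) = (\<integral>\<^sup>+z. ?F z \<partial>lborel)"
      using t by (intro nn_integral_cong) (simp add: gauss_weight_def gauss_def D_def distrib_left exp_add[symmetric] mult.assoc)
    also have "\<dots> = (\<integral>\<^sup>+z. ?F (z + c) \<partial>lborel)"
      by (rule nn_integral_lborel_translate[symmetric]) measurable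
    also have "\<dots> = (\<integral>\<^sup>+z. ennreal (t ^ (2 * D - 3) * exp (- (t\<^sup>2 * (2 * (norm z)\<^sup>2 + r\<^sup>2 / 2)))) \<partial>(lborel::'a measure))"
      unfolding par ..
    also have "\<dots> = ennreal ((1 / t) ^ D) * (\<integral>\<^sup>+z. ennreal (t ^ (2 * D - 3) * exp (- (t\<^sup>2 * (2 * (norm ((1 / t) *\<^sub>R z))\<^sup>2 + r\<^sup>2 / 2)))) \<partial>(lborel::'a measure))"
      unfolding D_def by (rule nn_integral_lborel_scale) (use t in auto)
    also have "(\<integral>\<^sup>+z. ennreal (t ^ (2 * D - 3) * exp (- (t\<^sup>2 * (2 * (norm ((1 / t) *\<^sub>R z))\<^sup>2 + r\<^sup>2 / 2)))) \<partial>(lborel::'a measure))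
       = (\<integral>\<^sup>+z. ennreal (t ^ (2 * D - 3) * exp (- (t\<^sup>2 * r\<^sup>2 / 2))) * ennreal (exp (- (2 * (norm z)\<^sup>2))) \<partial>(lborel::'a measure))"
    proof (rule nn_integral_cong)
      fix z :: 'a
      have "- (t\<^sup>2 * (2 * (norm ((1 / t) *\<^sub>R z))\<^sup>2 + r\<^sup>2 / 2)) = - (t\<^sup>2 * r\<^sup>2 / 2) + - (2 * (norm z)\<^sup>2)"
        using t by (simp add: field_simps power_mult_distrib power_divide)
      then have "exp (- (t\<^sup>2 * (2 * (norm ((1 / t) *\<^sub>R z))\<^sup>2 + r\<^sup>2 / 2))) = exp (- (t\<^sup>2 * r\<^sup>2 / 2)) * exp (- (2 * (norm z)\<^sup>2))"
        by (simp only: exp_add)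
      then show "ennreal (t ^ (2 * D - 3) * exp (- (t\<^sup>2 * (2 * (norm ((1 / t) *\<^sub>R z))\<^sup>2 + r\<^sup>2 / 2)))) =
         ennreal (t ^ (2 * D - 3) * exp (- (t\<^sup>2 * r\<^sup>2 / 2))) * ennreal (exp (- (2 * (norm z)\<^sup>2)))"
        using t by (simp only: mult.assoc[symmetric]) (rule ennreal_mult, auto)
    qed
    also have "\<dots> = ennreal (t ^ (2 * D - 3) * exp (- (t\<^sup>2 * r\<^sup>2 / 2))) * ?C"
      by (rule nn_integral_cmult) measurable
    also have "ennreal ((1 / t) ^ D) * \<dots> = ?C * ?M r t"
    proof -
      obtain k where k: "D = k + 3" using d by (metis D_def add.commute le_Suc_ex)
      have "(1 / t) ^ D * (t ^ (2 * D - 3) * exp (- (t\<^sup>2 * r\<^sup>2 / 2))) = t ^ (D - 3) * exp (- (t\<^sup>2 * r\<^sup>2 / 2))"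
        using t by (simp add: k power_add power_divide mult_2 eval_nat_numeral)
      then have "ennreal ((1 / t) ^ D) * ennreal (t ^ (2 * D - 3) * exp (- (t\<^sup>2 * r\<^sup>2 / 2))) = ?M r t"
        using t by (simp flip: ennreal_mult)
      then show ?thesis by (simp only: mult.assoc[symmetric]) (simp only: mult_ac)
    qed
    finally show ?thesis .
  next
    case False
    then show ?thesis by (simp add: gauss_weight_def)
  qed
  have "(\<integral>\<^sup>+p. ennreal (gauss_weight p * gauss p x * gauss p y) \<partial>lborel) =
    (\<integral>\<^sup>+t. (\<integral>\<^sup>+z. ennreal (gauss_weight (t, z) * gauss (t, z) x * gauss (t, z) y) \<partial>lborel) \<partial>lborel)"
    unfolding lborel_prod[symmetric]
  proof (rule lborel.nn_integral_fst[symmetric])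
    have "(\<lambda>p. ennreal (gauss_weight p * gauss p x * gauss p y)) \<in> borel_measurable borel"
      by measurable
    then show "(\<lambda>p. ennreal (gauss_weight p * gauss p x * gauss p y)) \<in> borel_measurable (lborel \<Otimes>\<^sub>M lborel)"
      by (simp add: lborel_prod)
  qed
  also have "\<dots> = ?C * (\<integral>\<^sup>+t. ?M r t \<partial>lborel)"
    unfolding inner by (rule nn_integral_cmult) measurable
  also have "\<dots> = gauss_const TYPE('a) * (1 / ennreal (r ^ (D - 2)))"
  proof (cases "r = 0")
    case False
    then have r: "r > 0" by (simp add: r_def)
    have "(\<integral>\<^sup>+t. ?M r t \<partial>lborel) = ennreal (1 / r) * (\<integral>\<^sup>+t. ?M r (1 / r * t) \<partial>lborel)"
      using nn_integral_real_affine[of "?M r" "1 / r" 0] r by simp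
    also have "(\<integral>\<^sup>+t. ?M r (1 / r * t) \<partial>lborel) = (\<integral>\<^sup>+t. ennreal ((1 / r) ^ (D - 3)) * (ennreal (t ^ (D - 3) * exp (- (t\<^sup>2 / 2))) * indicator {0<..} t) \<partial>lborel)"
      using r by (intro nn_integral_cong) (auto simp: power_divide zero_less_divide_iff indicator_def simp flip: ennreal_mult')
    also have "\<dots> = ennreal ((1 / r) ^ (D - 3)) * (\<integral>\<^sup>+t. ennreal (t ^ (D - 3) * exp (- (t\<^sup>2 / 2))) * indicator {0<..} t \<partial>lborel)"
      by (rule nn_integral_cmult) measurable
    finally have 1: "(\<integral>\<^sup>+t. ?M r t \<partial>lborel) = ennreal (1 / r) * (ennreal ((1 / r) ^ (D - 3)) * (\<integral>\<^sup>+t. ennreal (t ^ (D - 3) * exp (- (t\<^sup>2 / 2))) * indicator {0<..} t \<partial>lborel))" .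
    have "1 / r * (1 / r) ^ (D - 3) = 1 / r ^ (D - 2)"
    proof -
      obtain k where k: "D = k + 3" using d by (metis D_def add.commute le_Suc_ex)
      show ?thesis using r by (simp add: k power_divide)
    qed
    then have 2: "ennreal (1 / r) * ennreal ((1 / r) ^ (D - 3)) = 1 / ennreal (r ^ (D - 2))"
    proof -
      have "ennreal (1 / r) * ennreal ((1 / r) ^ (D - 3)) = ennreal (1 / r * (1 / r) ^ (D - 3))"
        using r by (intro ennreal_mult[symmetric]) auto
      also assume "1 / r * (1 / r) ^ (D - 3) = 1 / r ^ (D - 2)"
      also have "ennreal (1 / r ^ (D - 2)) = 1 / ennreal (r ^ (D - 2))"
        using divide_ennreal[of 1 "r ^ (D - 2)"] r by simp
      finally show ?thesis .
    qed
    show ?thesis unfolding 1 gauss_const_def D_def[symmetric] 2[symmetric] by (simp only: mult_ac)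
  next
    \<comment> \<open>On the diagonal both sides are infinite: without Gaussian decay the integral
      of t^(D - 3) diverges.\<close>
    case True
    have "(\<integral>\<^sup>+t. ?M 0 t \<partial>lborel) = \<infinity>"
    proof -
      have "(\<integral>\<^sup>+t. indicator {1..} t \<partial>(lborel::real measure)) \<le> (\<integral>\<^sup>+t. ?M 0 t \<partial>lborel)"
        by (intro nn_integral_mono) (auto simp: indicator_def)
      moreover have "emeasure lborel {1::real..} = \<infinity>"
      proof (rule ccontr)
        assume "emeasure lborel {1::real..} \<noteq> \<infinity>"
        then obtain c where c: "c \<ge> 0" "emeasure lborel {1::real..} = ennreal c"
          by (cases "emeasure lborel {1::real..}") auto
        have "emeasure lborel {1..1 + (c + 1)} \<le> emeasure lborel {1::real..}"
          by (rule emeasure_mono) auto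
        then show False using c by (simp add: ennreal_le_iff)
      qed
      ultimately show ?thesis by (simp add: top_unique)
    qed
    then have M: "(\<integral>\<^sup>+t. ?M r t \<partial>lborel) = \<top>" unfolding True by simp
    have C: "?C \<noteq> 0" "gauss_const TYPE('a) \<noteq> 0" using gauss_const_pos[where 'a='a] by (auto simp: gauss_const_def)
    have k: "1 / ennreal (r ^ (D - 2)) = \<top>" using True d by (simp add: D_def power_0_left)
    show ?thesis unfolding M k using C by (simp add: ennreal_mult_top)
  qed
  finally show ?thesis by (simp only: r_def D_def)
qed

section \<open>Mutual energies of probability measures\<close>

definition mutual_energy :: "'a::euclidean_space measure \<Rightarrow> 'a measure \<Rightarrow> ennreal"
  where "mutual_energy M N = (\<integral>\<^sup>+x. (\<integral>\<^sup>+y. 1 / ennreal (norm (x - y) ^ (DIM('a) - 2)) \<partial>N) \<partial>M)"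

definition gauss_transform :: "'a::euclidean_space measure \<Rightarrow> real \<times> 'a \<Rightarrow> real"
  where "gauss_transform M p = (\<integral>x. gauss p x \<partial>M)"

lemma gauss_measurable_raw [measurable (raw)]:
  "f \<in> M \<rightarrow>\<^sub>M borel \<Longrightarrow> g \<in> M \<rightarrow>\<^sub>M borel \<Longrightarrow> (\<lambda>x. gauss (f x) (g x)) \<in> borel_measurable M"
  using measurable_compose[OF measurable_Pair gauss_measurable, of f M g] by simp

locale two_probs =
  M: prob_space M + N: prob_space N for M N :: "'a::euclidean_space measure" +
  assumes sets_M [measurable_cong]: "sets M = sets borel" and sets_N [measurable_cong]: "sets N = sets borel"
begin

lemma gauss_integrable: "integrable M (gauss p)" "integrable N (gauss p)"
  by (rule M.integrable_const_bound[where B=1] N.integrable_const_bound[where B=1];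
      use gauss_pos[of p] gauss_le_1[of p] in \<open>auto simp: less_imp_le\<close>)+

lemma gauss_transform_nn: "(\<integral>\<^sup>+x. ennreal (gauss p x) \<partial>M) = ennreal (gauss_transform M p)"
    "(\<integral>\<^sup>+x. ennreal (gauss p x) \<partial>N) = ennreal (gauss_transform N p)"
  unfolding gauss_transform_def
  by (rule nn_integral_eq_integral; use gauss_integrable[of p] gauss_pos[of p] in \<open>auto simp: less_imp_le\<close>)+

lemma gauss_transform_nonneg: "0 \<le> gauss_transform M p" "0 \<le> gauss_transform N p"
  unfolding gauss_transform_def using gauss_pos[of p] by (auto intro!: integral_nonneg_AE simp: less_imp_le)

lemma gauss_transform_measurable [measurable]:
  "gauss_transform M \<in> borel_measurable borel" "gauss_transform N \<in> borel_measurable borel"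
  unfolding gauss_transform_def[abs_def]
  by (rule M.borel_measurable_lebesgue_integral N.borel_measurable_lebesgue_integral; measurable)+

text \<open>All integrands are nonnegative, so the orders of integration may be exchanged whether or
  not the energies are finite.\<close>

lemma mutual_energy_gauss:
  assumes d: "3 \<le> DIM('a)"
  shows "gauss_const TYPE('a) * mutual_energy M N =
    (\<integral>\<^sup>+p. ennreal (gauss_weight p * gauss_transform M p * gauss_transform N p) \<partial>lborel)"
proof -
  interpret P1: pair_sigma_finite N "lborel :: (real \<times> 'a) measure" ..
  interpret P2: pair_sigma_finite M "lborel :: (real \<times> 'a) measure" ..
  let ?k = "\<lambda>x y::'a. 1 / ennreal (norm (x - y) ^ (DIM('a) - 2))"
  let ?F = "\<lambda>x y p. ennreal (gauss_weight p * gauss p x * gauss p y)"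
  have "gauss_const TYPE('a) * mutual_energy M N = (\<integral>\<^sup>+x. gauss_const TYPE('a) * (\<integral>\<^sup>+y. ?k x y \<partial>N) \<partial>M)"
    unfolding mutual_energy_def by (rule nn_integral_cmult[symmetric]) measurable
  also have "\<dots> = (\<integral>\<^sup>+x. (\<integral>\<^sup>+y. gauss_const TYPE('a) * ?k x y \<partial>N) \<partial>M)"
    by (intro nn_integral_cong nn_integral_cmult[symmetric]) measurable
  also have "\<dots> = (\<integral>\<^sup>+x. (\<integral>\<^sup>+y. (\<integral>\<^sup>+p. ?F x y p \<partial>lborel) \<partial>N) \<partial>M)"
    unfolding kernel_eq_gauss[OF d] ..
  also have "\<dots> = (\<integral>\<^sup>+x. (\<integral>\<^sup>+p. (\<integral>\<^sup>+y. ?F x y p \<partial>N) \<partial>lborel) \<partial>M)"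
    by (rule nn_integral_cong, rule P1.Fubini'[symmetric]) measurable
  also have "\<dots> = (\<integral>\<^sup>+x. (\<integral>\<^sup>+p. ennreal (gauss_weight p * gauss p x * gauss_transform N p) \<partial>lborel) \<partial>M)"
  proof (intro nn_integral_cong)
    fix x p
    have "(\<integral>\<^sup>+y. ?F x y p \<partial>N) = (\<integral>\<^sup>+y. ennreal (gauss_weight p * gauss p x) * ennreal (gauss p y) \<partial>N)"
      using gauss_weight_nonneg[of p] gauss_pos[of p] by (intro nn_integral_cong ennreal_mult) (auto simp: less_imp_le)
    also have "\<dots> = ennreal (gauss_weight p * gauss p x) * (\<integral>\<^sup>+y. ennreal (gauss p y) \<partial>N)"
      by (rule nn_integral_cmult) measurable
    also have "\<dots> = ennreal (gauss_weight p * gauss p x * gauss_transform N p)"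
      unfolding gauss_transform_nn using gauss_weight_nonneg[of p] gauss_pos[of p x] gauss_transform_nonneg[of p]
      by (intro ennreal_mult[symmetric]) auto
    finally show "(\<integral>\<^sup>+y. ?F x y p \<partial>N) = ennreal (gauss_weight p * gauss p x * gauss_transform N p)" .
  qed
  also have "\<dots> = (\<integral>\<^sup>+p. (\<integral>\<^sup>+x. ennreal (gauss_weight p * gauss p x * gauss_transform N p) \<partial>M) \<partial>lborel)"
    by (rule P2.Fubini'[symmetric]) measurable
  also have "\<dots> = (\<integral>\<^sup>+p. ennreal (gauss_weight p * gauss_transform M p * gauss_transform N p) \<partial>lborel)"
  proof (intro nn_integral_cong)
    fix p
    have "(\<integral>\<^sup>+x. ennreal (gauss_weight p * gauss p x * gauss_transform N p) \<partial>M) = (\<integral>\<^sup>+x. ennreal (gauss_weight p * gauss_transform N p) * ennreal (gauss p x) \<partial>M)"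
    proof (rule nn_integral_cong)
      fix x
      have "gauss_weight p * gauss p x * gauss_transform N p = (gauss_weight p * gauss_transform N p) * gauss p x" by simp
      then show "ennreal (gauss_weight p * gauss p x * gauss_transform N p) = ennreal (gauss_weight p * gauss_transform N p) * ennreal (gauss p x)"
        using gauss_weight_nonneg[of p] gauss_pos[of p x] gauss_transform_nonneg[of p] by (simp add: ennreal_mult mult_ac)
    qed
    also have "\<dots> = ennreal (gauss_weight p * gauss_transform N p) * (\<integral>\<^sup>+x. ennreal (gauss p x) \<partial>M)"
      by (rule nn_integral_cmult) measurable
    also have "\<dots> = ennreal (gauss_weight p * gauss_transform M p * gauss_transform N p)"
      unfolding gauss_transform_nn using gauss_weight_nonneg[of p] gauss_transform_nonneg[of p]
      by (subst ennreal_mult[symmetric]) (auto simp: mult_ac)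
    finally show "(\<integral>\<^sup>+x. ennreal (gauss_weight p * gauss p x * gauss_transform N p) \<partial>M) = ennreal (gauss_weight p * gauss_transform M p * gauss_transform N p)" .
  qed
  finally show ?thesis .
qed

end

context two_probs
begin

interpretation MM: two_probs M M by standard (rule sets_M)+
interpretation NN: two_probs N N by standard (rule sets_N)+

text \<open>This is a^2 + b^2 = 2 a b + (a - b)^2 under the integral, kept as a sum because infinite
  energies rule out subtraction.\<close>

lemma energy_polarisation:
  assumes d: "3 \<le> DIM('a)"
  shows "gauss_const TYPE('a) * (mutual_energy M M + mutual_energy N N) = gauss_const TYPE('a) * (2 * mutual_energy M N)
    + (\<integral>\<^sup>+p. ennreal (gauss_weight p * (gauss_transform M p - gauss_transform N p)\<^sup>2) \<partial>lborel)"
proof -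
  let ?w = "gauss_weight :: real \<times> 'a \<Rightarrow> real" and ?a = "gauss_transform M" and ?b = "gauss_transform N"
  have "gauss_const TYPE('a) * (mutual_energy M M + mutual_energy N N) =
     (\<integral>\<^sup>+p. ennreal (?w p * ?a p * ?a p) \<partial>lborel) + (\<integral>\<^sup>+p. ennreal (?w p * ?b p * ?b p) \<partial>lborel)"
    unfolding distrib_left MM.mutual_energy_gauss[OF d] NN.mutual_energy_gauss[OF d] ..
  also have "\<dots> = (\<integral>\<^sup>+p. ennreal (?w p * ?a p * ?a p) + ennreal (?w p * ?b p * ?b p) \<partial>lborel)"
    by (rule nn_integral_add[symmetric]) measurable
  also have "\<dots> = (\<integral>\<^sup>+p. 2 * ennreal (?w p * ?a p * ?b p) + ennreal (?w p * (?a p - ?b p)\<^sup>2) \<partial>lborel)"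
  proof (rule nn_integral_cong)
    fix p
    have n: "0 \<le> ?w p" "0 \<le> ?a p" "0 \<le> ?b p" using gauss_weight_nonneg[of p] gauss_transform_nonneg[of p] by simp_all
    have "ennreal (?w p * ?a p * ?a p) + ennreal (?w p * ?b p * ?b p) = ennreal (?w p * ?a p * ?a p + ?w p * ?b p * ?b p)"
      using n by (intro ennreal_plus[symmetric]) auto
    also have "?w p * ?a p * ?a p + ?w p * ?b p * ?b p = 2 * (?w p * ?a p * ?b p) + ?w p * (?a p - ?b p)\<^sup>2"
      by (simp add: power2_eq_square algebra_simps)
    also have "ennreal \<dots> = ennreal (2 * (?w p * ?a p * ?b p)) + ennreal (?w p * (?a p - ?b p)\<^sup>2)"
      using n by (intro ennreal_plus) auto
    also have "ennreal (2 * (?w p * ?a p * ?b p)) = 2 * ennreal (?w p * ?a p * ?b p)"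
      by (simp add: ennreal_mult')
    finally show "ennreal (?w p * ?a p * ?a p) + ennreal (?w p * ?b p * ?b p) = 2 * ennreal (?w p * ?a p * ?b p) + ennreal (?w p * (?a p - ?b p)\<^sup>2)" .
  qed
  also have "\<dots> = (\<integral>\<^sup>+p. 2 * ennreal (?w p * ?a p * ?b p) \<partial>lborel) + (\<integral>\<^sup>+p. ennreal (?w p * (?a p - ?b p)\<^sup>2) \<partial>lborel)"
    by (rule nn_integral_add) measurable
  also have "(\<integral>\<^sup>+p. 2 * ennreal (?w p * ?a p * ?b p) \<partial>lborel) = 2 * (\<integral>\<^sup>+p. ennreal (?w p * ?a p * ?b p) \<partial>lborel)"
    by (rule nn_integral_cmult) measurable
  finally show ?thesis unfolding mutual_energy_gauss[OF d, symmetric] by (simp only: mult.left_commute)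
qed

lemma mutual_energy_le:
  assumes d: "3 \<le> DIM('a)"
  shows "2 * mutual_energy M N \<le> mutual_energy M M + mutual_energy N N"
proof -
  have "gauss_const TYPE('a) * (2 * mutual_energy M N) \<le> gauss_const TYPE('a) * (mutual_energy M M + mutual_energy N N)"
    unfolding energy_polarisation[OF d] by (simp add: add_increasing2)
  then show ?thesis using gauss_const_pos[where 'a='a] gauss_const_finite[where 'a='a]
    by (subst (asm) ennreal_mult_le_mult_iff) auto
qed

text \<open>Finiteness of the energies permits the cancellation in
  \<open>energy_polarisation\<close> that leaves the integral of the weighted squared difference
  equal to 0.\<close>

lemma energy_equality_AE:
  assumes d: "3 \<le> DIM('a)" and le: "mutual_energy M M + mutual_energy N N \<le> 2 * mutual_energy M N"
    and fin: "mutual_energy M M < \<infinity>" "mutual_energy N N < \<infinity>"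
  shows "AE p in lborel. fst p > 0 \<longrightarrow> gauss_transform M p = gauss_transform N p"
proof -
  let ?R = "\<integral>\<^sup>+p. ennreal (gauss_weight p * (gauss_transform M p - gauss_transform N p)\<^sup>2) \<partial>lborel"
  have eq: "mutual_energy M M + mutual_energy N N = 2 * mutual_energy M N"
    using le mutual_energy_le[OF d] by (rule order_antisym)
  have "gauss_const TYPE('a) * (2 * mutual_energy M N) < \<infinity>"
    unfolding eq[symmetric] using fin gauss_const_finite[where 'a='a] by (simp add: ennreal_mult_less_top)
  moreover have "gauss_const TYPE('a) * (2 * mutual_energy M N) + ?R = gauss_const TYPE('a) * (2 * mutual_energy M N) + 0"
    using energy_polarisation[OF d] unfolding eq by simp
  ultimately have "?R = 0" by (auto simp: ennreal_add_left_cancel)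
  then have "AE p in lborel. ennreal (gauss_weight p * (gauss_transform M p - gauss_transform N p)\<^sup>2) = 0"
    by (subst (asm) nn_integral_0_iff_AE) auto
  then show ?thesis
  proof (rule eventually_mono, intro impI)
    fix p :: "real \<times> 'a"
    assume 0: "ennreal (gauss_weight p * (gauss_transform M p - gauss_transform N p)\<^sup>2) = 0" and p: "fst p > 0"
    have "gauss_weight p > 0" using p by (simp add: gauss_weight_def)
    moreover have "gauss_weight p * (gauss_transform M p - gauss_transform N p)\<^sup>2 \<le> 0"
      using 0 by (simp add: ennreal_eq_0_iff)
    ultimately show "gauss_transform M p = gauss_transform N p"
      by (simp add: mult_le_0_iff)
  qed
qed

lemma gauss_transform_continuous: "isCont (\<lambda>z. gauss_transform M (t, z)) z"
  unfolding continuous_at_sequentially comp_def gauss_transform_def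
proof (intro allI impI)
  fix f assume f: "f \<longlonglongrightarrow> z"
  show "(\<lambda>i. \<integral>x. gauss (t, f i) x \<partial>M) \<longlonglongrightarrow> (\<integral>x. gauss (t, z) x \<partial>M)"
  proof (rule integral_dominated_convergence[where w="\<lambda>_. 1"])
    show "AE x in M. (\<lambda>i. gauss (t, f i) x) \<longlonglongrightarrow> gauss (t, z) x"
      unfolding gauss_def using f by (auto intro!: tendsto_intros)
    show "AE x in M. norm (gauss (t, f i) x) \<le> 1" for i
      using gauss_pos[of "(t, f i)"] gauss_le_1[of "(t, f i)"] by (auto simp: less_imp_le)
  qed auto
qed

end

section \<open>Exponential moments determine a measure on a compact set\<close>

inductive exp_sum :: "('a::real_inner \<Rightarrow> real) \<Rightarrow> bool" where
  exp: "exp_sum (\<lambda>x. c * exp (x \<bullet> w))"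
| add: "exp_sum f \<Longrightarrow> exp_sum g \<Longrightarrow> exp_sum (\<lambda>x. f x + g x)"

lemma exp_sum_mult:
  assumes "exp_sum f" "exp_sum g"
  shows "exp_sum (\<lambda>x. f x * g x)"
  using assms(1)
proof (induction rule: exp_sum.induct)
  case (exp c w)
  show ?case using assms(2)
  proof (induction rule: exp_sum.induct)
    case (exp c' w')
    have "(\<lambda>x. c * exp (x \<bullet> w) * (c' * exp (x \<bullet> w'))) = (\<lambda>x. (c * c') * exp (x \<bullet> (w + w')))"
      by (simp add: inner_add_right exp_add fun_eq_iff)
    then show ?case by (simp only: exp_sum.exp)
  next
    case (add f g)
    from exp_sum.add[OF add.IH] show ?case by (simp add: distrib_left)
  qed
next
  case (add f g)
  from exp_sum.add[OF add.IH] show ?case by (simp add: distrib_right)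
qed

lemma exp_sum_continuous: "exp_sum f \<Longrightarrow> continuous_on S f"
  by (induction rule: exp_sum.induct) (auto intro!: continuous_intros)

text \<open>Stone-Weierstrass: products of exponentials are exponentials, so the sums form an
  algebra, and the exponent w = x - y separates x from y.\<close>

lemma exp_sum_dense:
  fixes f :: "'a::euclidean_space \<Rightarrow> real"
  assumes "compact S" "continuous_on S f" "e > 0"
  obtains g where "exp_sum g" "\<And>x. x \<in> S \<Longrightarrow> \<bar>f x - g x\<bar> < e"
proof -
  have "\<exists>g. exp_sum g \<and> (\<forall>x\<in>S. \<bar>f x - g x\<bar> < e)"
  proof (rule Stone_Weierstrass_HOL[where P=exp_sum])
    show "exp_sum (\<lambda>x. c)" for c using exp_sum.exp[of c 0] by simp
    show "\<exists>f. exp_sum f \<and> f x \<noteq> f y" if "x \<in> S \<and> y \<in> S \<and> x \<noteq> y" for x y :: 'a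
    proof -
      have "(x - y) \<bullet> (x - y) \<noteq> 0" using that by simp
      then have "x \<bullet> (x - y) \<noteq> y \<bullet> (x - y)" by (simp add: inner_diff_left)
      then have "1 * exp (x \<bullet> (x - y)) \<noteq> 1 * exp (y \<bullet> (x - y))" by simp
      then show ?thesis using exp_sum.exp[of 1 "x - y"] by (intro exI conjI)
    qed
  qed (use assms exp_sum_continuous exp_sum.add exp_sum_mult in auto)
  then show ?thesis using that by blast
qed

context two_probs
begin

interpretation NM: two_probs N M by standard (rule sets_N sets_M)+

text \<open>Equality of integrals passes from exponentials to their sums, by uniform density on
  \<open>S\<close> to continuous functions, and by approximation of indicators to closed sets, which
  generate the Borel sets.\<close>

lemma measure_eqI_exp:
  assumes S: "compact S" "AE x in M. x \<in> S" "AE x in N. x \<in> S"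
    and eq: "\<And>w. (\<integral>x. exp (x \<bullet> w) \<partial>M) = (\<integral>x. exp (x \<bullet> w) \<partial>N)"
  shows "M = N"
proof -
  have bound: "\<exists>B. \<forall>x\<in>S. norm (f x) \<le> B" if "continuous_on S f" for f :: "'a \<Rightarrow> real"
    using compact_imp_bounded[OF compact_continuous_image[OF that S(1)]] by (auto simp: bounded_iff)
  have int: "integrable M f" "integrable N f"
    if c: "continuous_on S f" "f \<in> borel_measurable borel" for f :: "'a \<Rightarrow> real"
  proof -
    obtain B where B: "\<forall>x\<in>S. norm (f x) \<le> B" using bound[OF c(1)] by blast
    show "integrable M f" using S(2) B c(2) by (intro M.integrable_const_bound[where B=B]) (auto elim!: eventually_mono)
    show "integrable N f" using S(3) B c(2) by (intro N.integrable_const_bound[where B=B]) (auto elim!: eventually_mono)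
  qed
  have em: "exp_sum f \<Longrightarrow> f \<in> borel_measurable borel" for f :: "'a \<Rightarrow> real"
    using exp_sum_continuous[of f UNIV] by (rule borel_measurable_continuous_onI)
  have eqs: "integral\<^sup>L M f = integral\<^sup>L N f" if "exp_sum f" for f
    using that
  proof (induction rule: exp_sum.induct)
    case (exp c w)
    then show ?case using eq[of w] by simp
  next
    case (add f g)
    have "integrable M f" "integrable M g" "integrable N f" "integrable N g"
      using int exp_sum_continuous em add.hyps by blast+
    then show ?case using add.IH by simp
  qed
  have eqc: "integral\<^sup>L M f = integral\<^sup>L N f" if c: "continuous_on UNIV f" for f :: "'a \<Rightarrow> real"
  proof (rule ccontr)
    assume ne: "integral\<^sup>L M f \<noteq> integral\<^sup>L N f"
    \<comment> \<open>Uniform approximation within e costs at most e for either measure, while the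
      gap is 4 e.\<close>
    define e where "e = \<bar>integral\<^sup>L M f - integral\<^sup>L N f\<bar> / 4"
    have e: "e > 0" using ne by (simp add: e_def)
    have cS: "continuous_on S f" using c by (rule continuous_on_subset) simp
    obtain g where g: "exp_sum g" "\<And>x. x \<in> S \<Longrightarrow> \<bar>f x - g x\<bar> < e" using exp_sum_dense[OF S(1) cS e] by blast
    have fm: "f \<in> borel_measurable borel" using c by (rule borel_measurable_continuous_onI)
    have i: "integrable M f" "integrable N f" "integrable M g" "integrable N g"
      using int[OF cS fm] int[OF exp_sum_continuous[OF g(1)] em[OF g(1)]] by auto
    have "\<bar>integral\<^sup>L M f - integral\<^sup>L M g\<bar> \<le> e"
    proof -
      have "\<bar>\<integral>x. f x - g x \<partial>M\<bar> \<le> (\<integral>x. \<bar>f x - g x\<bar> \<partial>M)" by (rule integral_abs_bound)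
      also have "\<dots> \<le> (\<integral>x. e \<partial>M)"
        using i S(2) g(2) by (intro integral_mono_AE) (auto elim!: eventually_mono intro: less_imp_le)
      finally show ?thesis using i by (simp add: M.prob_space)
    qed
    moreover have "\<bar>integral\<^sup>L N f - integral\<^sup>L N g\<bar> \<le> e"
    proof -
      have "\<bar>\<integral>x. f x - g x \<partial>N\<bar> \<le> (\<integral>x. \<bar>f x - g x\<bar> \<partial>N)" by (rule integral_abs_bound)
      also have "\<dots> \<le> (\<integral>x. e \<partial>N)"
        using i S(3) g(2) by (intro integral_mono_AE) (auto elim!: eventually_mono intro: less_imp_le)
      finally show ?thesis using i by (simp add: N.prob_space)
    qed
    ultimately have "\<bar>integral\<^sup>L M f - integral\<^sup>L N f\<bar> \<le> 2 * e" using eqs[OF g(1)] by linarith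
    moreover have "\<bar>integral\<^sup>L M f - integral\<^sup>L N f\<bar> = 4 * e" by (simp add: e_def)
    ultimately show False using e by linarith
  qed
  have closed_eq: "emeasure M A = emeasure N A" if A: "closed A" for A
  proof (cases "A = {}")
    case False
    \<comment> \<open>Continuous cut-offs that are 1 on \<open>A\<close> and tend to 0 at every
      point of its complement.\<close>
    define f where "f n x = max 0 (1 - real n * infdist x A)" for n x
    have cf: "continuous_on UNIV (f n)" for n unfolding f_def by (intro continuous_intros)
    have fm: "f n \<in> borel_measurable borel" for n using cf by (rule borel_measurable_continuous_onI)
    have fb: "0 \<le> f n x" "f n x \<le> 1" for n x by (auto simp: f_def infdist_nonneg)
    have lim: "(\<lambda>n. f n x) \<longlonglongrightarrow> indicator A x" for x
    proof (cases "x \<in> A")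
      case True
      then have "f n x = 1" for n by (simp add: f_def infdist_zero)
      then show ?thesis using True by simp
    next
      case out: False
      then have pos: "infdist x A > 0" using infdist_pos_not_in_closed[OF A False] by blast
      obtain k where k: "real k * infdist x A > 1" using pos by (metis reals_Archimedean3)
      have "f n x = 0" if "n \<ge> k" for n
      proof -
        have "real k * infdist x A \<le> real n * infdist x A" using that pos by (intro mult_right_mono) auto
        then show ?thesis using k by (simp add: f_def)
      qed
      then have "eventually (\<lambda>n. f n x = indicator A x) sequentially" using out by (auto simp: eventually_sequentially)
      then show ?thesis by (rule tendsto_eventually)
    qed
    have Ab: "A \<in> sets borel" using A by simp
    have 1: "(\<lambda>n. integral\<^sup>L M (f n)) \<longlonglongrightarrow> integral\<^sup>L M (indicator A)"
      by (rule integral_dominated_convergence[where w="\<lambda>_. 1"]) (use lim fb fm Ab in auto)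
    have 2: "(\<lambda>n. integral\<^sup>L N (f n)) \<longlonglongrightarrow> integral\<^sup>L N (indicator A)"
      by (rule integral_dominated_convergence[where w="\<lambda>_. 1"]) (use lim fb fm Ab in auto)
    have "(\<lambda>n. integral\<^sup>L M (f n)) = (\<lambda>n. integral\<^sup>L N (f n))" using eqc[OF cf] by auto
    then have "integral\<^sup>L M (indicator A) = (integral\<^sup>L N (indicator A) :: real)"
      using 1 2 by (metis LIMSEQ_unique)
    then have "measure M A = measure N A" using Ab by (simp add: sets_M sets_N sets_eq_imp_space_eq[OF sets_M] sets_eq_imp_space_eq[OF sets_N])
    then show ?thesis by (simp add: M.emeasure_eq_measure N.emeasure_eq_measure)
  qed simp
  show ?thesis
  proof (rule measure_eqI_generator_eq[where E="Collect closed" and \<Omega>=UNIV and A="\<lambda>_. UNIV"])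
    show "Int_stable (Collect (closed :: 'a set \<Rightarrow> bool))" by (auto simp: Int_stable_def)
    show "sets M = sigma_sets UNIV (Collect closed)" "sets N = sigma_sets UNIV (Collect closed)"
      unfolding sets_M sets_N by (simp_all add: borel_eq_closed)
  qed (use closed_eq in auto)
qed

text \<open>On the unit sphere a Gaussian centred at \<open>z\<close> is a constant multiple of \<open>x \<mapsto> exp (x \<bullet> w)\<close> with \<open>w\<close> proportional to \<open>z\<close>,
  so a single width already determines all exponential moments.\<close>

lemma sphere_measure_eqI:
  assumes d: "3 \<le> DIM('a)" and le: "mutual_energy M M + mutual_energy N N \<le> 2 * mutual_energy M N"
    and fin: "mutual_energy M M < \<infinity>" "mutual_energy N N < \<infinity>"
    and S: "AE x in M. norm x = 1" "AE x in N. norm x = 1"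
  shows "M = N"
proof (rule measure_eqI_exp[where S="sphere 0 1"])
  \<comment> \<open>Fubini yields a single width t > 0 at which the transforms agree for almost
    every centre; continuity in the centre then gives all centres.\<close>
  have "AE p in lborel \<Otimes>\<^sub>M lborel. fst p > 0 \<longrightarrow> gauss_transform M p = gauss_transform N p"
    using energy_equality_AE[OF d le fin] unfolding lborel_prod[symmetric] .
  then have "AE t in lborel. AE z in lborel. t > 0 \<longrightarrow> gauss_transform M (t, z) = gauss_transform N (t, z)"
    using lborel_pair.AE_pair by fastforce
  moreover have "\<not> (AE t::real in lborel. t \<notin> {0<..<1})"
  proof
    assume "AE t::real in lborel. t \<notin> {0<..<1}"
    then have "emeasure lborel {0<..<1::real} = 0" by (subst (asm) AE_iff_measurable[of "{0<..<1}"]) auto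
    then show False by simp
  qed
  ultimately obtain t where t: "t > 0" "AE z in lborel. gauss_transform M (t, z) = gauss_transform N (t, z)"
    by (smt (verit, best) eventually_mono greaterThanLessThan_iff)
  have all: "gauss_transform M (t, z) = gauss_transform N (t, z)" for z
  proof (rule ccontr)
    assume ne: "gauss_transform M (t, z) \<noteq> gauss_transform N (t, z)"
    define U where "U = {z. gauss_transform M (t, z) \<noteq> gauss_transform N (t, z)}"
    have "open U" unfolding U_def
      by (intro open_Collect_neq continuous_at_imp_continuous_on ballI gauss_transform_continuous NM.gauss_transform_continuous)
    moreover have "U \<noteq> {}" using ne by (auto simp: U_def)
    ultimately have "\<not> negligible U" by (rule open_not_negligible)
    moreover have "AE z in lebesgue. z \<notin> U" using t(2) by (simp add: AE_completion U_def)
    ultimately show False by (simp add: negligible_iff_null_sets AE_iff_null_sets \<open>open U\<close>)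
  qed
  show "(\<integral>x. exp (x \<bullet> w) \<partial>M) = (\<integral>x. exp (x \<bullet> w) \<partial>N)" for w
  proof -
    \<comment> \<open>Completing the square with |x| = 1 gives x \<bullet> w = t^2 (1 + |z|^2) - t^2
      |x - z|^2 for this z.\<close>
    define z where "z = (1 / (2 * t\<^sup>2)) *\<^sub>R w"
    define c where "c = exp (t\<^sup>2 * (1 + (norm z)\<^sup>2))"
    have e: "exp (x \<bullet> w) = c * gauss (t, z) x" if "norm x = 1" for x
    proof -
      have "x \<bullet> w = 2 * t\<^sup>2 * (x \<bullet> z)" using t by (simp add: z_def)
      also have "\<dots> = t\<^sup>2 * (1 + (norm z)\<^sup>2) + - (t\<^sup>2 * (norm (x - z))\<^sup>2)"
        using that by (simp add: power2_norm_eq_inner inner_diff_left inner_diff_right inner_commute[of z x] norm_eq_1 algebra_simps)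
      finally show ?thesis by (simp add: c_def gauss_def exp_add[symmetric])
    qed
    have "(\<integral>x. exp (x \<bullet> w) \<partial>M) = (\<integral>x. c * gauss (t, z) x \<partial>M)"
      using S(1) by (intro integral_cong_AE) (auto elim!: eventually_mono simp: e)
    moreover have "(\<integral>x. exp (x \<bullet> w) \<partial>N) = (\<integral>x. c * gauss (t, z) x \<partial>N)"
      using S(2) by (intro integral_cong_AE) (auto elim!: eventually_mono simp: e)
    ultimately show ?thesis using all[of z] by (simp add: gauss_transform_def)
  qed
qed (use S in auto)

end

section \<open>Balayage of the point charge\<close>

lemma AE_lborel_not_sphere: "AE z in lborel. norm (z :: 'a::euclidean_space) \<noteq> 1"
proof -
  have "sphere (0::'a) 1 \<in> null_sets lebesgue"
    using negligible_sphere[of "0::'a" 1] by (simp add: negligible_iff_null_sets)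
  then have "AE z in lebesgue. z \<notin> sphere (0::'a) 1" by (rule AE_not_in)
  then have "AE z in lborel. z \<notin> sphere (0::'a) 1" by (simp add: AE_completion_iff)
  then show ?thesis by (rule eventually_mono) simp
qed

lemma sets_surface_measure [measurable_cong]: "sets surface_measure = sets sphere_borel"
  by (simp add: surface_measure_def)

lemma space_surface_measure: "space surface_measure = sphere 0 1"
  using sets_eq_imp_space_eq[OF sets_surface_measure] by (simp add: space_sphere_borel)

lemma borel_measurable_sphere_borel:
  assumes "G \<in> borel_measurable borel" "sets M = sets sphere_borel"
  shows "G \<in> borel_measurable M"
proof -
  have "G \<in> borel_measurable sphere_borel"
    unfolding sphere_borel_def using assms(1) by (rule measurable_restrict_space1)
  then show ?thesis unfolding measurable_cong_sets[OF assms(2) refl] .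
qed

lemma nn_integral_surface_measure:
  fixes G :: "real ^ 'n \<Rightarrow> ennreal"
  assumes [measurable]: "G \<in> borel_measurable borel"
  shows "(\<integral>\<^sup>+y. G y \<partial>surface_measure) = sphere_int G"
proof -
  have GS: "G \<in> borel_measurable sphere_borel" by (rule borel_measurable_sphere_borel) simp_all
  have "(\<integral>\<^sup>+y. G y \<partial>surface_measure) = of_nat CARD('n) * (\<integral>\<^sup>+z. G (z /\<^sub>R norm z) \<partial>restrict_space lborel (ball 0 1 - {0}))"
    unfolding surface_measure_def using GS
    by (simp add: nn_integral_scale_measure nn_integral_distr[OF measurable_radial_projection])
  also have "(\<integral>\<^sup>+z. G (z /\<^sub>R norm z) \<partial>restrict_space lborel (ball 0 1 - {0})) = (\<integral>\<^sup>+z. G (z /\<^sub>R norm z) * indicator (ball 0 1 - {0}) z \<partial>lborel)"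
    by (rule nn_integral_restrict_space) simp
  also have "\<dots> = (\<integral>\<^sup>+z. G (sgn z) * indicator {z. norm z \<le> 1} z \<partial>lborel)"
    by (intro nn_integral_cong_AE eventually_mono[OF eventually_conj[OF AE_lborel_not_sphere AE_lborel_singleton[of 0]]])
      (auto simp: sgn_div_norm indicator_def)
  finally show ?thesis by (simp add: sphere_int_def ennreal_of_nat_eq_real_of_nat)
qed

text \<open>The vectors with direction a lie on the line spanned by a, which is a null set.\<close>

lemma sphere_int_cong_except:
  fixes a :: "'a::euclidean_space"
  assumes a: "norm a = 1" and d: "2 \<le> DIM('a)" and eq: "\<And>y. norm y = 1 \<Longrightarrow> y \<noteq> a \<Longrightarrow> G y = H y"
  shows "sphere_int G = sphere_int H"
proof -
  have "sgn z \<noteq> a \<and> norm (sgn z) = 1" if "perp a z \<noteq> 0" for z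
  proof -
    have z: "z \<noteq> 0" using that by (auto simp: perp_def)
    have zz: "z = norm z *\<^sub>R sgn z" using z by (simp add: sgn_div_norm)
    have "sgn z \<noteq> a"
    proof
      assume s: "sgn z = a"
      have "perp a z = perp a (norm z *\<^sub>R a)" using zz unfolding s by (rule arg_cong)
      then show False using that a by (simp add: perp_def norm_eq_1)
    qed
    then show ?thesis using z by (simp add: norm_sgn)
  qed
  then show ?thesis unfolding sphere_int_def
    by (intro arg_cong[where f="\<lambda>x. _ * x"] nn_integral_cong_AE eventually_mono[OF AE_perp_nonzero[OF a d]]) (simp add: eq)
qed

lemma sphere_int_cmult:
  assumes [measurable]: "G \<in> borel_measurable borel"
  shows "sphere_int (\<lambda>x. c * G x) = c * sphere_int G"
  unfolding sphere_int_def by (simp add: nn_integral_cmult mult.assoc mult.left_commute[of _ c])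

lemma sphere_int_add:
  assumes [measurable]: "G \<in> borel_measurable borel" "H \<in> borel_measurable borel"
  shows "sphere_int (\<lambda>x. G x + H x) = sphere_int G + sphere_int H"
  unfolding sphere_int_def by (simp add: nn_integral_add distrib_left distrib_right)

text \<open>The Jacobian identity with g = 1 absorbs the kernel altogether. This constant is the one
  behind \<open>potential_sum\<close>.\<close>

lemma sphere_int_kernel_one:
  assumes x: "norm (x::'a::euclidean_space) = 1" and d: "2 \<le> DIM('a)"
  shows "sphere_int (\<lambda>y. ennreal (1 / norm (x - y) ^ (DIM('a) - 2))) = sphere_int (\<lambda>_::'a. 1)"
  using sphere_int_kernel_reflect[OF _ x d, of "\<lambda>_. 1"] by simp

lemma inner_less_one:
  fixes x n :: "'a::euclidean_space"
  assumes "norm x = 1" "norm n = 1" "x \<noteq> n"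
  shows "0 < 1 - x \<bullet> n"
  using chord_pos[OF assms] .

text \<open>The inner quotient is the coefficient of the second term of the density formula. The
  factor (d - 1)/2 and the power of p cancel those left by the line integral, so that the potential
  of the \<open>tail_beta\<close> density equals the field on the cap.\<close>

definition charge_const :: "nat \<Rightarrow> real \<Rightarrow> real \<Rightarrow> real"
  where "charge_const d q p = (real d - 1) / 2 * (q * Gamma ((real d - 1) / 2) / (sqrt 2 * pi powr ((real d + 1) / 2))) * p powr (- ((real d - 1) / 2))"

lemma charge_const_pos: "3 \<le> d \<Longrightarrow> q > 0 \<Longrightarrow> p > 0 \<Longrightarrow> charge_const d q p > 0"
  unfolding charge_const_def by (intro mult_pos_pos divide_pos_pos Gamma_real_pos) auto

text \<open>In the formula of \<open>potential_tail_beta\<close> the minimum is at most p, which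
  gives the inequality; for x in the cap it equals p by \<open>chord_form_ge\<close>.\<close>

lemma balayage_potential:
  fixes x n :: "'a::euclidean_space"
  assumes d: "3 \<le> DIM('a)" and q: "q > 0" and p: "p > 0" and x: "norm x = 1" and n: "norm n = 1" and xn: "x \<noteq> n"
  defines "V \<equiv> ennreal (charge_const DIM('a) q p) * sphere_int (\<lambda>y. tail_beta ((real DIM('a) - 2) / 2) p (1 - y \<bullet> n) * ennreal (1 / norm (x - y) ^ (DIM('a) - 2)))"
  shows "V \<le> ennreal (q * (1 - x \<bullet> n) powr (- ((real DIM('a) - 2) / 2)))"
    and "p \<le> 1 - x \<bullet> n \<Longrightarrow> V = ennreal (q * (1 - x \<bullet> n) powr (- ((real DIM('a) - 2) / 2)))"
proof -
  define D where "D = real DIM('a)"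
  define m where "m = (D - 2) / 2"
  define l where "l = 1 - x \<bullet> n"
  define e where "e = chord_dir x n"
  have D: "D \<ge> 3" using d by (simp add: D_def)
  have d2: "2 \<le> DIM('a)" using d by simp
  note [simp] = D_def[symmetric]
  have l: "l > 0" unfolding l_def by (rule inner_less_one[OF x n xn])
  have e1: "norm e = 1" unfolding e_def by (rule norm_chord_dir[OF x n xn])
  let ?Q = "chord_form x n"
  let ?h = "\<lambda>z. ennreal (pi * sqrt (?Q z) * (min p (?Q z / (norm (perp e z))\<^sup>2) powr ((D - 1) / 2) / ((D - 1) / 2))) * indicator (slab e \<inter> {z. ?Q z \<le> 1}) z"
  let ?g = "\<lambda>z. ennreal (pi * (p powr ((D - 1) / 2) / ((D - 1) / 2))) * (ennreal (sqrt (?Q z)) * indicator (slab e \<inter> {z. ?Q z \<le> 1}) z)"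
  define C where "C = charge_const DIM('a) q p"
  have C: "C > 0" unfolding C_def by (rule charge_const_pos[OF d q p])
  have G: "Gamma ((D - 1) / 2) > 0" using D by (intro Gamma_real_pos) auto
  have V: "V = ennreal C * (ennreal D * (\<integral>\<^sup>+z. ?h z \<partial>lborel))"
    unfolding V_def C_def using potential_tail_beta[OF x n xn d2 p] by (simp add: e_def)
  \<comment> \<open>With the minimum replaced by p the integral is that of
    \<open>nn_integral_sqrt_chord_form\<close>, and the constants collapse to the field.\<close>
  have full: "ennreal C * (ennreal D * (\<integral>\<^sup>+z. ?g z \<partial>lborel)) = ennreal (q * l powr (- m))"
  proof -
    have "ennreal D * (\<integral>\<^sup>+z. ?g z \<partial>lborel) = ennreal (pi * (p powr ((D - 1) / 2) / ((D - 1) / 2))) * (ennreal D * (\<integral>\<^sup>+z. ennreal (sqrt (?Q z)) * indicator (slab e \<inter> {z. ?Q z \<le> 1}) z \<partial>lborel))"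
      by (subst nn_integral_cmult) (simp_all add: mult_ac)
    also have "ennreal D * (\<integral>\<^sup>+z. ennreal (sqrt (?Q z)) * indicator (slab e \<inter> {z. ?Q z \<le> 1}) z \<partial>lborel)
      = ennreal (l powr (- m) / sqrt 2) * ennreal (2 * pi powr ((D - 1) / 2) / Gamma ((D - 1) / 2))"
      using nn_integral_sqrt_chord_form[OF x n xn] equator_int_one[OF e1 d2] by (simp add: e_def l_def m_def)
    finally have "ennreal C * (ennreal D * (\<integral>\<^sup>+z. ?g z \<partial>lborel)) = ennreal (C * (pi * (p powr ((D - 1) / 2) / ((D - 1) / 2)) * (l powr (- m) / sqrt 2 * (2 * pi powr ((D - 1) / 2) / Gamma ((D - 1) / 2)))))"
    proof -
      assume S: "ennreal D * (\<integral>\<^sup>+z. ?g z \<partial>lborel) = ennreal (pi * (p powr ((D - 1) / 2) / ((D - 1) / 2))) * (ennreal (l powr (- m) / sqrt 2) * ennreal (2 * pi powr ((D - 1) / 2) / Gamma ((D - 1) / 2)))"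
      have m4: "ennreal a * (ennreal b * (ennreal c * ennreal e)) = ennreal (a * (b * (c * e)))" if "0 \<le> a" "0 \<le> b" "0 \<le> c" "0 \<le> e" for a b c e
        using that by (simp add: ennreal_mult)
      show ?thesis unfolding S by (rule m4) (use C D G in auto)
    qed
    also have "C * (pi * (p powr ((D - 1) / 2) / ((D - 1) / 2)) * (l powr (- m) / sqrt 2 * (2 * pi powr ((D - 1) / 2) / Gamma ((D - 1) / 2)))) = q * l powr (- m)"
    proof -
      define N where "N = (D - 1) / 2"
      define P where "P = p powr N"
      define T where "T = pi powr N"
      have N: "N > 0" using D by (simp add: N_def)
      have P: "P > 0" using p by (simp add: P_def)
      have T: "T > 0" by (simp add: T_def)
      have Gn: "Gamma N \<noteq> 0" using G unfolding N_def by linarith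
      have "(D + 1) / 2 = N + 1" by (simp add: N_def field_simps)
      then have pp: "pi powr ((D + 1) / 2) = T * pi" by (simp only: powr_add T_def) simp
      have Cq: "C = N * (q * Gamma N / (sqrt 2 * (T * pi))) * (1 / P)"
        unfolding C_def charge_const_def D_def[symmetric] pp unfolding N_def[symmetric] powr_minus_divide P_def ..
      have s2: "sqrt 2 * sqrt 2 = (2::real)" by simp
      have "C * (pi * (P / N) * (l powr (- m) / sqrt 2 * (2 * T / Gamma N))) = q * l powr (- m) * (2 / (sqrt 2 * sqrt 2))"
        unfolding Cq using N P T Gn by simp
      then show ?thesis unfolding s2 by (simp add: P_def T_def N_def)
    qed
    finally show ?thesis .
  qed
  have split: "?g z = ennreal (pi * sqrt (?Q z) * (p powr ((D - 1) / 2) / ((D - 1) / 2))) * indicator (slab e \<inter> {z. ?Q z \<le> 1}) z" if "?Q z \<ge> 0" for z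
  proof -
    have e: "pi * sqrt (?Q z) * (p powr ((D - 1) / 2) / ((D - 1) / 2)) = pi * (p powr ((D - 1) / 2) / ((D - 1) / 2)) * sqrt (?Q z)" by simp
    have "ennreal (pi * (p powr ((D - 1) / 2) / ((D - 1) / 2)) * sqrt (?Q z)) = ennreal (pi * (p powr ((D - 1) / 2) / ((D - 1) / 2))) * ennreal (sqrt (?Q z))"
      using that D by (intro ennreal_mult) auto
    then show ?thesis unfolding e by (simp only: mult.assoc)
  qed
  have Q0: "AE z in lborel. perp e z \<noteq> 0 \<and> ?Q z > 0"
    by (rule eventually_mono[OF AE_perp_nonzero[OF e1 d2]]) (use chord_form_pos[OF x n xn] in \<open>simp add: e_def\<close>)
  have "(\<integral>\<^sup>+z. ?h z \<partial>lborel) \<le> (\<integral>\<^sup>+z. ?g z \<partial>lborel)"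
  proof (intro nn_integral_mono_AE eventually_mono[OF Q0])
    fix z assume z: "perp e z \<noteq> 0 \<and> ?Q z > 0"
    have "min p (?Q z / (norm (perp e z))\<^sup>2) powr ((D - 1) / 2) \<le> p powr ((D - 1) / 2)"
      using D p z by (intro powr_mono2) auto
    then have "pi * sqrt (?Q z) * (min p (?Q z / (norm (perp e z))\<^sup>2) powr ((D - 1) / 2) / ((D - 1) / 2)) \<le> pi * sqrt (?Q z) * (p powr ((D - 1) / 2) / ((D - 1) / 2))"
      using z D by (intro mult_left_mono divide_right_mono) auto
    then show "?h z \<le> ?g z" using z split[of z] by (simp add: ennreal_leI mult_right_mono)
  qed
  then have "V \<le> ennreal (q * l powr (- m))" unfolding full[symmetric] V by (intro mult_left_mono) auto
  then show "V \<le> ennreal (q * (1 - x \<bullet> n) powr (- ((real DIM('a) - 2) / 2)))" by (simp add: l_def m_def)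
  assume pl: "p \<le> 1 - x \<bullet> n"
  have "(\<integral>\<^sup>+z. ?h z \<partial>lborel) = (\<integral>\<^sup>+z. ?g z \<partial>lborel)"
  proof (intro nn_integral_cong_AE eventually_mono[OF Q0])
    fix z assume z: "perp e z \<noteq> 0 \<and> ?Q z > 0"
    have "p * (norm (perp e z))\<^sup>2 \<le> l * (norm (perp e z))\<^sup>2" using pl by (intro mult_right_mono) (auto simp: l_def)
    also have "\<dots> \<le> ?Q z" using chord_form_ge[OF x n xn, of z] by (simp add: e_def l_def)
    finally have "min p (?Q z / (norm (perp e z))\<^sup>2) = p" using z by (simp add: min_def field_simps)
    then show "?h z = ?g z" using split[of z] z by simp
  qed
  then have "V = ennreal (q * l powr (- m))" unfolding full[symmetric] V by simp
  then show "V = ennreal (q * (1 - x \<bullet> n) powr (- ((real DIM('a) - 2) / 2)))" by (simp add: l_def m_def)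
qed

lemma potential_sum:
  fixes x n :: "'a::euclidean_space"
  assumes d: "3 \<le> DIM('a)" and x: "norm x = 1" and n: "norm n = 1"
  defines "m \<equiv> (real DIM('a) - 2) / 2"
  shows "sphere_int (\<lambda>y. head_beta m p (1 - y \<bullet> n) * ennreal (1 / norm (x - y) ^ (DIM('a) - 2)))
    + sphere_int (\<lambda>y. tail_beta m p (1 - y \<bullet> n) * ennreal (1 / norm (x - y) ^ (DIM('a) - 2)))
    = ennreal (Beta (m + 1) (1/2)) * sphere_int (\<lambda>_::'a. 1)"
proof -
  have d2: "2 \<le> DIM('a)" and m: "m > -1" using d by (auto simp: m_def)
  let ?k = "\<lambda>y. ennreal (1 / norm (x - y) ^ (DIM('a) - 2))"
  have "sphere_int (\<lambda>y. head_beta m p (1 - y \<bullet> n) * ?k y) + sphere_int (\<lambda>y. tail_beta m p (1 - y \<bullet> n) * ?k y)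
    = sphere_int (\<lambda>y. head_beta m p (1 - y \<bullet> n) * ?k y + tail_beta m p (1 - y \<bullet> n) * ?k y)"
    by (rule sphere_int_add[symmetric]) measurable
  also have "\<dots> = sphere_int (\<lambda>y. ennreal (Beta (m + 1) (1/2)) * ?k y)"
  proof (rule sphere_int_cong_except[OF n d2])
    fix y assume y: "norm y = 1" "y \<noteq> n"
    show "head_beta m p (1 - y \<bullet> n) * ?k y + tail_beta m p (1 - y \<bullet> n) * ?k y = ennreal (Beta (m + 1) (1/2)) * ?k y"
      using head_plus_tail_beta[OF m inner_less_one[OF y(1) n y(2)]] by (simp only: distrib_right[symmetric])
  qed
  also have "\<dots> = ennreal (Beta (m + 1) (1/2)) * sphere_int ?k"
    by (rule sphere_int_cmult) measurable
  finally show ?thesis unfolding sphere_int_kernel_one[OF x d2] .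
qed

text \<open>The factor in front of \<open>cap_function\<close> is the reciprocal of the right side
  of the angle equation, so that equation says exactly that the normalised density has mass
  1.\<close>

lemma head_beta_mass:
  fixes n :: "'a::euclidean_space"
  assumes d: "3 \<le> DIM('a)" and q: "q > 0" and n: "norm n = 1" and s: "0 < s" "s < 1"
  defines "m \<equiv> (real DIM('a) - 2) / 2"
  shows "ennreal (charge_const DIM('a) q (2 * s)) * sphere_int (\<lambda>y. head_beta m (2 * s) (1 - y \<bullet> n)) =
    ennreal (q * 2 powr m * Gamma (m + 1/2) / (sqrt pi * Gamma m) * cap_function m s)"
proof -
  define D where "D = DIM('a)"
  have d2: "2 \<le> DIM('a)" using d by simp
  have m: "m > 0" using d by (simp add: m_def)
  have Dm: "real D = 2 * m + 2" by (simp add: m_def D_def field_simps)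
  define B where "B = Beta (m + 1/2) (1/2)"
  define L where "L = incomplete_Beta (1 - s) m (m + 1) - s powr (m + 1/2) * incomplete_Beta (1 - s) m (1/2)"
  define C where "C = charge_const D q (2 * s)"
  define W where "W = 2 * pi powr ((real D - 1) / 2) / Gamma ((real D - 1) / 2)"
  have C: "C > 0" unfolding C_def D_def by (rule charge_const_pos[OF d q]) (use s in simp)
  have B: "B > 0" unfolding B_def Beta_def using m by (intro divide_pos_pos mult_pos_pos Gamma_real_pos) auto
  have Gm: "Gamma m > 0" "Gamma (m + 1/2) > 0" using m by (auto intro: Gamma_real_pos)
  have N: "(real D - 1) / 2 = m + 1/2" by (simp add: Dm field_simps)
  have W: "W > 0" unfolding W_def N using Gm by simp
  have "sphere_int (\<lambda>y. head_beta m (2 * s) (1 - y \<bullet> n)) =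
    (\<integral>\<^sup>+t. head_beta m (2 * s) (1 - t / sqrt (1 + t\<^sup>2)) * ennreal (1 / sqrt (1 + t\<^sup>2) ^ D) \<partial>lborel) * equator_int n (\<lambda>_. 1)"
    unfolding D_def by (rule sphere_int_zonal[OF _ n d2]) measurable
  also have "(\<integral>\<^sup>+t. head_beta m (2 * s) (1 - t / sqrt (1 + t\<^sup>2)) * ennreal (1 / sqrt (1 + t\<^sup>2) ^ D) \<partial>lborel) =
    ennreal (2 ^ (D - 2)) * (\<integral>\<^sup>+y. head_beta m (2 * s) (1 - (1 - 2 / (1 + y))) * ennreal (sqrt y ^ (D - 3) / (1 + y) ^ (D - 1)) * indicator {0<..} y \<partial>lborel)"
    by (rule nn_integral_stereographic) (use d in \<open>auto simp: D_def\<close>)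
  also have "(\<integral>\<^sup>+y. head_beta m (2 * s) (1 - (1 - 2 / (1 + y))) * ennreal (sqrt y ^ (D - 3) / (1 + y) ^ (D - 1)) * indicator {0<..} y \<partial>lborel) = ennreal (m * B / (m + 1/2) * L)"
    using nn_integral_mass[OF m Dm _ s] d unfolding B_def L_def D_def by simp
  also have "equator_int n (\<lambda>_. 1) = ennreal W"
    unfolding W_def D_def by (rule equator_int_one[OF n d2])
  finally have S: "sphere_int (\<lambda>y. head_beta m (2 * s) (1 - y \<bullet> n)) = ennreal (2 ^ (D - 2)) * ennreal (m * B / (m + 1/2) * L) * ennreal W" .
  have "ennreal C * (ennreal (2 ^ (D - 2)) * ennreal (m * B / (m + 1/2) * L) * ennreal W) = ennreal (C * 2 ^ (D - 2) * W * (m * B / (m + 1/2) * L))"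
  proof -
    have "ennreal (C * 2 ^ (D - 2) * W * (m * B / (m + 1/2) * L)) = ennreal (C * 2 ^ (D - 2) * W) * ennreal (m * B / (m + 1/2) * L)"
      using C W by (intro ennreal_mult') auto
    also have "ennreal (C * 2 ^ (D - 2) * W) = ennreal C * ennreal (2 ^ (D - 2)) * ennreal W"
      using C W by (simp add: ennreal_mult)
    finally show ?thesis by (simp only: mult_ac)
  qed
  also have "C * 2 ^ (D - 2) * W * (m * B / (m + 1/2) * L) = q * 2 powr m * Gamma (m + 1/2) / (sqrt pi * Gamma m) * cap_function m s"
  proof -
    have cf: "cap_function m s = L / s powr (m + 1/2)"
      using s by (simp add: cap_function_def L_def diff_divide_distrib)
    have Bv: "B = Gamma (m + 1/2) * sqrt pi / (m * Gamma m)"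
    proof -
      have h: "m + 1/2 + 1/2 = m + 1" by simp
      have g: "Gamma (m + 1) = m * Gamma m" using m by (intro Gamma_plus1) auto
      show ?thesis unfolding B_def Beta_def h g Gamma_one_half_real ..
    qed
    have p2: "(2 * s) powr (m + 1/2) = 2 powr m * sqrt 2 * s powr (m + 1/2)"
      using s by (simp add: powr_mult powr_add powr_half_sqrt)
    have p4: "(2::real) ^ (D - 2) = 2 powr m * 2 powr m"
    proof -
      have "(2::real) ^ (D - 2) = 2 powr real (D - 2)" by (simp add: powr_realpow)
      also have "real (D - 2) = m + m" using d Dm by (simp add: D_def of_nat_diff)
      finally show ?thesis by (simp only: powr_add)
    qed
    have pp: "pi powr ((real D + 1) / 2) = pi powr (m + 1/2) * pi"
    proof -
      have "(real D + 1) / 2 = (m + 1/2) + 1" by (simp add: Dm field_simps)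
      then show ?thesis by (simp only: powr_add) simp
    qed
    define A where "A = 2 powr m" define P where "P = pi powr (m + 1/2)" define S where "S = s powr (m + 1/2)"
    define g where "g = Gamma (m + 1/2)" define h where "h = Gamma m" define u where "u = m + 1/2"
    have pos: "A > 0" "P > 0" "S > 0" "g > 0" "h > 0" "u > 0" using s Gm m by (auto simp: A_def P_def S_def g_def h_def u_def)
    have Ce: "C = u * (q * g / (sqrt 2 * (P * pi))) * (1 / (A * sqrt 2 * S))"
      unfolding C_def charge_const_def N pp powr_minus_divide p2 A_def P_def S_def g_def u_def ..
    have We: "W = 2 * P / g" unfolding W_def N P_def g_def ..
    have Be: "B = g * sqrt pi / (m * h)" unfolding Bv g_def h_def ..
    have pq: "pi = sqrt pi * sqrt pi" by simp
    define t where "t = sqrt pi" have t: "t > 0" "pi = t * t" by (simp_all add: t_def)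
    define w where "w = sqrt (2::real)" have w: "w > 0" "w * w = 2" by (simp_all add: w_def)
    have "C * 2 ^ (D - 2) * W * (m * B / (m + 1/2) * L) = u * (q * g / (w * (P * (t * t)))) * (1 / (A * w * S)) * (A * A) * (2 * P / g) * (m * (g * t / (m * h)) / u * L)"
      unfolding p4 Ce We Be A_def[symmetric] u_def[symmetric] t_def[symmetric] w_def[symmetric] t(2)[symmetric] ..
    also have "\<dots> = q * A * g / (t * h) * (L / S) * (2 / (w * w))"
      using pos m t(1) w(1) by (simp add: mult_ac)
    also have "\<dots> = q * A * g / (t * h) * (L / S)" unfolding w(2) by simp
    finally show ?thesis unfolding cf A_def g_def h_def S_def t_def .
  qed
  finally show ?thesis unfolding S C_def D_def by simp
qed

lemma head_beta_zero:
  assumes "p < c" "0 < c"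
  shows "head_beta m c p = 0"
proof -
  have "\<not> (0 < u \<and> u < 1 \<and> c < u * p)" for u
  proof
    assume u: "0 < u \<and> u < 1 \<and> c < u * p"
    then have "p > 0" using assms by (metis less_trans zero_less_mult_pos)
    then have "u * p \<le> p" using u by (simp add: mult_le_cancel_right2)
    then show False using u assms by simp
  qed
  then show ?thesis by (simp add: head_beta_def)
qed

lemma head_beta_pos:
  assumes "0 < c" "c < p"
  shows "head_beta m c p > 0"
proof -
  let ?G = "\<lambda>u. ennreal (u powr m / sqrt (1 - u)) * indicator {u. 0 < u \<and> u < 1 \<and> c < u * p} u"
  have mG: "?G \<in> borel_measurable borel" unfolding indicator_def mem_Collect_eq by measurable
  have "head_beta m c p \<noteq> 0"
  proof
    assume "head_beta m c p = 0"
    then have "AE u in lborel. ?G u = 0" unfolding head_beta_def using mG by (subst (asm) nn_integral_0_iff_AE) auto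
    then have "AE u in lborel. u \<notin> {c/p<..<1}"
    proof (rule eventually_mono)
      fix u assume 0: "?G u = 0"
      show "u \<notin> {c/p<..<1}"
      proof
        assume "u \<in> {c/p<..<1}"
        then have u: "c / p < u" "u < 1" by auto
        have p: "p > 0" "c / p > 0" using assms by auto
        have u0: "u > 0" using u p by linarith
        have "c < u * p" using u p by (simp add: pos_divide_less_eq)
        then have "indicator {u. 0 < u \<and> u < 1 \<and> c < u * p} u = (1::ennreal)" using u u0 by simp
        moreover have "0 < u powr m / sqrt (1 - u)" using u u0 by simp
        ultimately show False using 0 by (simp add: ennreal_eq_0_iff)
      qed
    qed
    then have "emeasure lborel {c/p<..<1} = 0" by (subst (asm) AE_iff_measurable[of "{c/p<..<1}"]) auto
    then show False using assms by simp
  qed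
  then show ?thesis by (simp add: zero_less_iff_neq_zero)
qed

lemma one_minus_cos_half: "1 - cos \<alpha> = 2 * (sin (\<alpha> / 2))\<^sup>2" for \<alpha> :: real
  using cos_double_sin[of "\<alpha> / 2"] by simp

text \<open>The angle equation gives both terms of the formula a common coefficient. Their
  difference is then a multiple of F - 1, which is \<open>head_beta\<close> by
  \<open>head_beta_eq_hyp2F1\<close>. At \<eta> = \<alpha> the zero denominators make both sides of
  the second conclusion 0.\<close>

lemma density_formula_eq:
  assumes d: "3 \<le> d" and q: "q > 0" and \<alpha>: "0 < \<alpha>" "\<alpha> < pi" and eq: "angle_equation d q \<alpha>"
    and \<eta>: "\<alpha> \<le> \<eta>" "\<eta> \<le> pi"
  shows "0 \<le> density_formula d q \<alpha> \<eta>"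
    and "ennreal (density_formula d q \<alpha> \<eta>) = ennreal (charge_const d q (1 - cos \<alpha>)) * head_beta ((real d - 2) / 2) (1 - cos \<alpha>) (1 - cos \<eta>)"
proof -
  define m where "m = (real d - 2) / 2"
  define s where "s = (sin (\<alpha> / 2))\<^sup>2"
  define p0 where "p0 = 1 - cos \<alpha>"
  define p where "p = 1 - cos \<eta>"
  define z where "z = 1 - p0 / p"
  have m: "m > 0" using d by (simp add: m_def)
  have s: "s > 0" using sin_half_pos[OF \<alpha>] by (simp add: s_def)
  have p0s: "p0 = 2 * s" by (simp add: p0_def s_def one_minus_cos_half)
  have p0: "p0 > 0" using s by (simp add: p0s)
  have "cos \<eta> \<le> cos \<alpha>" using \<eta> \<alpha> by (intro cos_monotone_0_pi_le) auto
  then have pp: "p0 \<le> p" by (simp add: p0_def p_def)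
  then have p: "p > 0" using p0 by simp
  have z: "0 \<le> z" "z < 1" using pp p p0 by (auto simp: z_def)
  have N: "(real d - 1) / 2 = m + 1/2" by (simp add: m_def field_simps)
  define D0 where "D0 = q * Gamma ((real d - 1) / 2) / (sqrt 2 * pi powr ((real d + 1) / 2))"
  define F where "F = hyp2F1 1 (m + 1/2) (1/2) z"
  \<comment> \<open>Here the angle equation enters: up to the power of p0, the constant of the first
    term equals the coefficient of the second.\<close>
  have dc: "density_const d q \<alpha> * p0 powr (m + 1/2) = D0"
  proof -
    define B1 where "B1 = incomplete_Beta (1 - s) m (m + 1)"
    define B2 where "B2 = incomplete_Beta (1 - s) m (1/2)"
    define K where "K = q * 2 powr m * Gamma (m + 1/2) / (sqrt pi * Gamma m)"
    have Gm: "Gamma m > 0" "Gamma (m + 1/2) > 0" using m by (auto intro: Gamma_real_pos)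
    have K: "K > 0" using q Gm by (simp add: K_def)
    have s1: "s < 1"
    proof -
      have "cos \<alpha> > - 1" using \<alpha> cos_monotone_0_pi[of \<alpha> pi] by simp
      then show ?thesis using p0s p0_def by simp
    qed
    have B1: "B1 > 0" unfolding B1_def using m s s1 by (intro incomplete_Beta_pos) auto
    have S: "s powr (m + 1/2) > 0" using s by simp
    have h: "real d / 2 = m + 1" "real d / 2 - 1 = m" "(real d - 2) / 2 = m" by (simp_all add: m_def field_simps)
    have "cap_function m s = 1 / K"
      using eq unfolding angle_equation_iff[OF d q \<alpha>] h N s_def[symmetric] by (simp add: K_def)
    then have "B1 / s powr (m + 1/2) - B2 = 1 / K" by (simp add: cap_function_def B1_def B2_def)
    \<comment> \<open>The left side is the last factor of \<open>density_const\<close>.\<close>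
    then have "1 + K * B2 = K * B1 / s powr (m + 1/2)" using K by (simp add: field_simps)
    moreover have "(cos (\<alpha> / 2))\<^sup>2 = 1 - s" by (simp add: s_def cos_squared_eq)
    ultimately have "density_const d q \<alpha> = Gamma m / (2 ^ (d - 1) * pi powr (m + 1)) * inverse B1 * (K * B1 / s powr (m + 1/2))"
      unfolding density_const_def h N by (simp add: B1_def B2_def K_def)
    also have "\<dots> = Gamma m * K / (2 ^ (d - 1) * pi powr (m + 1) * s powr (m + 1/2))"
      using B1 by simp
    finally have e: "density_const d q \<alpha> = Gamma m * K / (2 ^ (d - 1) * pi powr (m + 1) * s powr (m + 1/2))" .
    have pw: "p0 powr (m + 1/2) = 2 powr m * sqrt 2 * s powr (m + 1/2)"
      using s unfolding p0s by (simp add: powr_mult powr_add powr_half_sqrt)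
    have p4: "(2::real) ^ (d - 1) = 2 powr m * 2 powr m * 2"
    proof -
      have "(2::real) ^ (d - 1) = 2 powr real (d - 1)" by (simp add: powr_realpow)
      also have "real (d - 1) = m + m + 1" using d by (simp add: m_def of_nat_diff field_simps)
      finally show ?thesis by (simp only: powr_add) simp
    qed
    have p5: "pi powr ((real d + 1) / 2) = pi powr (m + 1) * sqrt pi"
    proof -
      have "(real d + 1) / 2 = (m + 1) + 1/2" by (simp add: m_def field_simps)
      then show ?thesis by (simp only: powr_add[of pi "m + 1"]) (simp add: powr_half_sqrt)
    qed
    define A where "A = 2 powr m" define P where "P = pi powr (m + 1)" define S where "S = s powr (m + 1/2)"
    define g where "g = Gamma (m + 1/2)" define h where "h = Gamma m" define t where "t = sqrt pi" define w where "w = sqrt (2::real)"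
    have pos: "A > 0" "P > 0" "S > 0" "g > 0" "h > 0" "t > 0" "w > 0" using s Gm by (auto simp: A_def P_def S_def g_def h_def t_def w_def)
    have ww: "w * w = 2" by (simp add: w_def)
    have Ke: "K = q * A * g / (t * h)" by (simp add: K_def A_def g_def t_def h_def)
    have "h * (q * A * g / (t * h)) / (A * A * 2 * P * S) * (A * w * S) = q * g / (2 * (P * t)) * w"
      using pos by (simp add: mult_ac)
    also have "\<dots> = q * g / (w * (P * t))"
      unfolding ww[symmetric] using pos by simp
    finally show ?thesis
      unfolding e D0_def pw p4 p5 N A_def[symmetric] P_def[symmetric] S_def[symmetric] g_def[symmetric] h_def[symmetric] t_def[symmetric] w_def[symmetric] Ke .
  qed
  have r1: "p0 / p = 1 - z" by (simp add: z_def)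
  have c1: "cos \<alpha> - cos \<eta> = p * z" using p by (simp add: z_def p_def p0_def field_simps)
  have c2: "(cos \<alpha> - cos \<eta>) / p = z" using p by (simp add: c1)
  have rt: "sqrt (p0 / (cos \<alpha> - cos \<eta>)) = sqrt (1 - z) / sqrt z"
    unfolding c1 using r1 by (simp add: real_sqrt_divide[symmetric] divide_divide_eq_left[symmetric])
  have b0: "m + 1/2 \<noteq> 0" using m by simp
  define X where "X = (1 - z) powr (m + 1) / sqrt z * (F - 1) / (m + 1/2)"
  have pz: "p0 powr (m + 1/2) = p powr (m + 1/2) * (1 - z) powr (m + 1/2)"
    using p p0 z by (simp add: powr_mult[symmetric] flip: r1)
  have df: "density_formula d q \<alpha> \<eta> = (m + 1/2) * D0 * p0 powr (- (m + 1/2)) * X"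
  proof -
    have "density_formula d q \<alpha> \<eta> = density_const d q \<alpha> * (p0 / p) powr (m + 1/2) * (sqrt (1 - z) / sqrt z) * F
       - D0 * (1 / p powr (m + 1/2)) * (sqrt (1 - z) / sqrt z)"
      unfolding density_formula_def p0_def[symmetric] p_def[symmetric] rt c2 F_def D0_def N ..
    also have "density_const d q \<alpha> * (p0 / p) powr (m + 1/2) = D0 * (1 / p powr (m + 1/2))"
      unfolding dc[symmetric] using p p0 by (simp add: powr_divide)
    also have "D0 * (1 / p powr (m + 1/2)) * (sqrt (1 - z) / sqrt z) * F - D0 * (1 / p powr (m + 1/2)) * (sqrt (1 - z) / sqrt z)
      = D0 * (1 / p powr (m + 1/2)) * (sqrt (1 - z) / sqrt z * (F - 1))" by (simp only: right_diff_distrib mult_1_right mult.assoc)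
    also have "1 / p powr (m + 1/2) = p0 powr (- (m + 1/2)) * (1 - z) powr (m + 1/2)"
      unfolding powr_minus_divide pz using p z by simp
    also have "D0 * (p0 powr (- (m + 1/2)) * (1 - z) powr (m + 1/2)) * (sqrt (1 - z) / sqrt z * (F - 1))
      = D0 * p0 powr (- (m + 1/2)) * (((1 - z) powr (m + 1/2) * sqrt (1 - z)) / sqrt z * (F - 1))" by simp
    also have "(1 - z) powr (m + 1/2) * sqrt (1 - z) = (1 - z) powr (m + 1)"
    proof -
      have "(1 - z) powr (m + 1) = (1 - z) powr (m + 1/2 + 1/2)" by (rule arg_cong[where f="(powr) (1 - z)"]) simp
      then show ?thesis unfolding powr_add[of _ "m + 1/2"] using z by (simp add: powr_half_sqrt)
    qed
    also have "(1 - z) powr (m + 1) / sqrt z * (F - 1) = (m + 1/2) * X" unfolding X_def using b0 by simp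
    finally show ?thesis by (simp only: mult_ac)
  qed
  have CC: "charge_const d q p0 = (m + 1/2) * D0 * p0 powr (- (m + 1/2))"
    unfolding charge_const_def D0_def N ..
  have Cpos: "charge_const d q p0 > 0" by (rule charge_const_pos[OF d q p0])
  have X0: "X \<ge> 0"
  proof -
    have "((\<lambda>w. (1 - w) powr (m + 1/2 - 1/2) / sqrt w) has_integral (1 - z) powr (m + 1/2 + 1/2) / sqrt z * (F - 1) / (m + 1/2)) {0..z}"
      unfolding F_def by (rule hyp2F1_integral) (use m z in auto)
    then have "0 \<le> (1 - z) powr (m + 1/2 + 1/2) / sqrt z * (F - 1) / (m + 1/2)"
      by (rule has_integral_nonneg) (use z in auto)
    then show ?thesis unfolding X_def by (simp add: add.assoc)
  qed
  have hb: "head_beta m p0 p = ennreal X"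
    unfolding X_def F_def r1[symmetric] z_def using head_beta_eq_hyp2F1[OF _ p0 pp, of m] m by simp
  show "0 \<le> density_formula d q \<alpha> \<eta>" unfolding df CC[symmetric] using Cpos X0 by simp
  show "ennreal (density_formula d q \<alpha> \<eta>) = ennreal (charge_const d q (1 - cos \<alpha>)) * head_beta ((real d - 2) / 2) (1 - cos \<alpha>) (1 - cos \<eta>)"
    unfolding df CC[symmetric] m_def[symmetric] p0_def[symmetric] p_def[symmetric] hb using Cpos X0 by (intro ennreal_mult) auto
qed

section \<open>The equilibrium measure of the cap\<close>

text \<open>Unit measures live on the sphere as a restricted space, whereas the energy results above
  concern Borel measures on the whole space; this is the image under the inclusion.\<close>

definition on_borel :: "(real ^ 'n) measure \<Rightarrow> (real ^ 'n) measure"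
  where "on_borel \<mu> = distr \<mu> borel (\<lambda>x. x)"

lemma ident_measurable_sphere: "sets \<mu> = sets sphere_borel \<Longrightarrow> (\<lambda>x. x) \<in> \<mu> \<rightarrow>\<^sub>M (borel :: (real ^ 'n) measure)"
  by (simp add: sphere_borel_def measurable_restrict_space1 cong: measurable_cong_sets)

lemma sets_on_borel [simp]: "sets (on_borel \<mu>) = sets borel"
  by (simp add: on_borel_def)

lemma nn_integral_on_borel:
  assumes "sets \<mu> = sets sphere_borel" "G \<in> borel_measurable borel"
  shows "(\<integral>\<^sup>+x. G x \<partial>on_borel \<mu>) = (\<integral>\<^sup>+x. G x \<partial>\<mu>)"
  unfolding on_borel_def using assms by (intro nn_integral_distr ident_measurable_sphere) auto

lemma on_borel_prob:
  assumes "prob_space \<mu>" "sets \<mu> = sets sphere_borel"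
  shows "prob_space (on_borel \<mu>)"
  unfolding on_borel_def by (rule prob_space.prob_space_distr[OF assms(1) ident_measurable_sphere[OF assms(2)]])

lemma AE_on_borel_sphere:
  assumes "sets \<mu> = sets sphere_borel"
  shows "AE x in on_borel \<mu>. norm x = 1"
proof -
  have "space \<mu> = sphere 0 1" using sets_eq_imp_space_eq[OF assms] by (simp add: space_sphere_borel)
  then have "AE x in \<mu>. norm x = 1" by (intro AE_I2) simp
  then show ?thesis unfolding on_borel_def
    by (subst AE_distr_iff[OF ident_measurable_sphere[OF assms]]) auto
qed

lemma on_borel_inject:
  assumes "sets \<mu> = sets sphere_borel" "sets \<nu> = sets sphere_borel" "on_borel \<mu> = on_borel \<nu>"
  shows "\<mu> = \<nu>"
proof (rule measure_eqI)
  show "sets \<mu> = sets \<nu>" using assms by simp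
  fix A assume A: "A \<in> sets \<mu>"
  have "A \<in> sets (restrict_space borel (sphere 0 1))" using A assms(1) by (simp add: sphere_borel_def)
  then have Ab: "A \<in> sets borel" and AS: "A \<subseteq> sphere 0 1"
    by (subst (asm) sets_restrict_space_iff, auto)+
  have "emeasure (on_borel \<kappa>) A = emeasure \<kappa> A" if "sets \<kappa> = sets sphere_borel" for \<kappa>
  proof -
    have "A \<subseteq> space \<kappa>" using sets_eq_imp_space_eq[OF that] AS by (simp add: space_sphere_borel)
    then have "(\<lambda>x. x) -` A \<inter> space \<kappa> = A" by auto
    then show ?thesis unfolding on_borel_def using emeasure_distr[OF ident_measurable_sphere[OF that] Ab] by simp
  qed
  then show "emeasure \<mu> A = emeasure \<nu> A" using assms by metis
qed

lemma riesz_energy_on_borel: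
  fixes \<mu> :: "(real ^ 'n) measure"
  assumes "sets \<mu> = sets sphere_borel" "prob_space \<mu>"
  shows "riesz_energy \<mu> = mutual_energy (on_borel \<mu>) (on_borel \<mu>)"
proof -
  interpret B: prob_space "on_borel \<mu>" using assms by (intro on_borel_prob)
  have [measurable_cong]: "sets (on_borel \<mu>) = sets borel" by simp
  have m1: "(\<lambda>y. riesz_kernel x y) \<in> borel_measurable borel" for x :: "real ^ 'n"
    unfolding riesz_kernel_def by measurable
  have m2: "(\<lambda>x. \<integral>\<^sup>+y. riesz_kernel x y \<partial>on_borel \<mu>) \<in> borel_measurable borel"
    unfolding riesz_kernel_def by measurable
  have "riesz_energy \<mu> = (\<integral>\<^sup>+x. (\<integral>\<^sup>+y. riesz_kernel x y \<partial>on_borel \<mu>) \<partial>\<mu>)"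
    unfolding riesz_energy_def nn_integral_on_borel[OF assms(1) m1] ..
  also have "\<dots> = (\<integral>\<^sup>+x. (\<integral>\<^sup>+y. riesz_kernel x y \<partial>on_borel \<mu>) \<partial>on_borel \<mu>)"
    by (rule nn_integral_on_borel[OF assms(1) m2, symmetric])
  finally show ?thesis by (simp add: mutual_energy_def riesz_kernel_def)
qed

lemma point_charge_field_measurable [measurable]: "point_charge_field k q \<in> borel_measurable borel"
  unfolding point_charge_field_def[abs_def] by measurable

section \<open>The candidate measure at a solution of the angle equation\<close>

locale cap_problem =
  fixes k :: "'n::finite" and q \<alpha> :: real
  assumes d: "3 \<le> CARD('n)" and q: "q > 0" and \<alpha>: "0 < \<alpha>" "\<alpha> < pi" and angle: "angle_equation CARD('n) q \<alpha>"
begin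

definition north :: "real ^ 'n" where "north = axis k 1"
definition m :: real where "m = (real CARD('n) - 2) / 2"
definition p0 :: real where "p0 = 1 - cos \<alpha>"
definition C :: real where "C = charge_const CARD('n) q p0"
definition dens :: "real ^ 'n \<Rightarrow> ennreal" where "dens x = ennreal C * head_beta m p0 (1 - x \<bullet> north)"
definition dens_real :: "real ^ 'n \<Rightarrow> real"
  where "dens_real x = (if \<alpha> \<le> polar_angle k x then density_formula CARD('n) q \<alpha> (polar_angle k x) else 0)"
definition eqm :: "(real ^ 'n) measure" where "eqm = density surface_measure dens"

lemma d2: "2 \<le> DIM(real ^ 'n)" and d3: "3 \<le> DIM(real ^ 'n)" and dimn: "DIM(real ^ 'n) = CARD('n)"
  using d by simp_all

lemma north: "norm north = 1" "x \<bullet> north = x $ k"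
  by (simp_all add: north_def inner_axis norm_axis_1)

lemma p0_pos: "p0 > 0"
  using sin_half_pos[OF \<alpha>] by (simp add: p0_def one_minus_cos_half)

lemma C_pos: "C > 0"
  unfolding C_def by (rule charge_const_pos[OF d q p0_pos])

lemma polar: 
  assumes "norm x = 1"
  shows "cos (polar_angle k x) = x $ k" "0 \<le> polar_angle k x" "polar_angle k x \<le> pi"
proof -
  have "\<bar>x $ k\<bar> \<le> 1" using component_le_norm_cart[of x k] assms by simp
  then show "cos (polar_angle k x) = x $ k" "0 \<le> polar_angle k x" "polar_angle k x \<le> pi"
    by (auto simp: polar_angle_def abs_le_iff arccos_lbound arccos_ubound)
qed

lemma cap_iff:
  assumes "norm x = 1"
  shows "\<alpha> \<le> polar_angle k x \<longleftrightarrow> x $ k \<le> cos \<alpha>"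
  using polar[OF assms] \<alpha> cos_mono_le_eq[of "polar_angle k x" \<alpha>] by simp

lemma dens_measurable [measurable]: "dens \<in> borel_measurable borel"
  unfolding dens_def[abs_def] by measurable

lemma dens_real:
  assumes x: "norm x = 1"
  shows "0 \<le> dens_real x" "ennreal (dens_real x) = dens x"
proof -
  have "0 \<le> dens_real x \<and> ennreal (dens_real x) = dens x"
  proof (cases "\<alpha> \<le> polar_angle k x")
    case True
    from density_formula_eq[OF d q \<alpha> angle True polar(3)[OF x]] show ?thesis
      using True polar(1)[OF x] by (simp add: dens_real_def dens_def north(2) p0_def m_def C_def)
  next
    case False
    then have "1 - x \<bullet> north < p0" using cap_iff[OF x] by (simp add: north(2) p0_def)
    then show ?thesis using False head_beta_zero[OF _ p0_pos] by (simp add: dens_real_def dens_def)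
  qed
  then show "0 \<le> dens_real x" "ennreal (dens_real x) = dens x" by auto
qed

lemma space_sphere: "x \<in> space surface_measure \<Longrightarrow> norm (x :: real ^ 'n) = 1"
  by (simp add: space_surface_measure)

lemma dens_real_measurable: "dens_real \<in> borel_measurable surface_measure"
proof -
  have "(\<lambda>x. enn2real (dens x)) \<in> borel_measurable surface_measure"
    by (rule borel_measurable_sphere_borel[OF _ sets_surface_measure]) measurable
  moreover have "enn2real (dens x) = dens_real x" if "x \<in> space surface_measure" for x
    using dens_real[OF space_sphere[OF that]] by (metis enn2real_ennreal)
  ultimately show ?thesis by (subst measurable_cong[of _ _ "\<lambda>x. enn2real (dens x)"]) auto
qed

lemma dens_measurable_surface: "dens \<in> borel_measurable surface_measure"
  by (rule borel_measurable_sphere_borel[OF dens_measurable sets_surface_measure])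

lemma eqm_density: "has_real_density eqm surface_measure dens_real"
proof -
  have "eqm = density surface_measure (\<lambda>x. ennreal (dens_real x))"
    unfolding eqm_def using dens_real dens_measurable_surface dens_real_measurable
    by (intro density_cong AE_I2) (auto dest!: space_sphere)
  moreover have "AE x in surface_measure. 0 \<le> dens_real x"
    using dens_real(1) space_sphere by (intro AE_I2) auto
  ultimately show ?thesis unfolding has_real_density_def using dens_real_measurable by blast
qed

lemma sets_eqm: "sets eqm = sets sphere_borel"
  by (simp add: eqm_def sets_surface_measure)

lemma nn_integral_eqm:
  assumes [measurable]: "G \<in> borel_measurable borel"
  shows "(\<integral>\<^sup>+x. G x \<partial>eqm) = ennreal C * sphere_int (\<lambda>y. head_beta m p0 (1 - y \<bullet> north) * G y)"
proof -
  have "(\<integral>\<^sup>+x. G x \<partial>eqm) = (\<integral>\<^sup>+x. dens x * G x \<partial>surface_measure)"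
    unfolding eqm_def
    by (rule nn_integral_density) (auto intro: dens_measurable_surface borel_measurable_sphere_borel[OF _ sets_surface_measure])
  also have "\<dots> = sphere_int (\<lambda>x. dens x * G x)"
    by (rule nn_integral_surface_measure) measurable
  also have "\<dots> = sphere_int (\<lambda>y. ennreal C * (head_beta m p0 (1 - y \<bullet> north) * G y))"
    by (simp only: dens_def mult.assoc)
  also have "\<dots> = ennreal C * sphere_int (\<lambda>y. head_beta m p0 (1 - y \<bullet> north) * G y)"
    by (rule sphere_int_cmult) measurable
  finally show ?thesis .
qed

text \<open>The angle equation makes the mass computed in \<open>head_beta_mass\<close> equal to
  1.\<close>

lemma eqm_prob: "prob_space eqm"
proof
  define s where "s = (sin (\<alpha> / 2))\<^sup>2"
  define K where "K = q * 2 powr m * Gamma (m + 1/2) / (sqrt pi * Gamma m)"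
  have m: "m > 0" using d by (simp add: m_def)
  have K: "K > 0" unfolding K_def using q m by (intro divide_pos_pos mult_pos_pos Gamma_real_pos) auto
  have ps: "p0 = 2 * s" by (simp add: p0_def s_def one_minus_cos_half)
  have "cos \<alpha> > - 1" using \<alpha> cos_monotone_0_pi[of \<alpha> pi] by simp
  then have s: "0 < s" "s < 1" using ps p0_pos by (auto simp: p0_def)
  have h: "real CARD('n) / 2 - 1 = m" "(real CARD('n) - 2) / 2 = m" "(real CARD('n) - 1) / 2 = m + 1/2"
    by (simp_all add: m_def field_simps)
  have cf: "cap_function m s = 1 / K"
    using angle unfolding angle_equation_iff[OF d q \<alpha>] h s_def[symmetric] by (simp add: K_def)
  have "emeasure eqm (space eqm) = (\<integral>\<^sup>+x. 1 \<partial>eqm)" by simp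
  also have "\<dots> = ennreal C * sphere_int (\<lambda>y. head_beta m p0 (1 - y \<bullet> north))"
    by (subst nn_integral_eqm) simp_all
  also have "\<dots> = ennreal (K * cap_function m s)"
    using head_beta_mass[OF d3 q north(1) s] unfolding dimn h C_def ps K_def .
  also have "\<dots> = 1" using K cf by simp
  finally show "emeasure eqm (space eqm) = 1" .
qed

lemma eqm_unit: "eqm \<in> unit_sphere_measures"
  using eqm_prob sets_eqm by (simp add: unit_sphere_measures_def)

section \<open>Potential of the candidate and comparison of energies\<close>

abbreviation "M0 \<equiv> on_borel eqm"
abbreviation "Q \<equiv> point_charge_field k q"

definition U :: "real ^ 'n \<Rightarrow> ennreal"
  where "U x = (\<integral>\<^sup>+y. 1 / ennreal (norm (x - y) ^ (DIM(real ^ 'n) - 2)) \<partial>M0)"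

text \<open>The modified Robin constant, the value of potential plus field on the cap. It arises as
  the potential of the uniform measure that the \<open>head_beta\<close> and
  \<open>tail_beta\<close> densities form together.\<close>

definition F :: ennreal
  where "F = ennreal C * (ennreal (Beta (m + 1) (1/2)) * sphere_int (\<lambda>_::real ^ 'n. 1))"

lemma F_finite: "F < \<infinity>"
  unfolding F_def sphere_int_one by (simp add: ennreal_mult_less_top)

lemma U_eq:
  assumes x: "norm x = 1"
  shows "U x = ennreal C * sphere_int (\<lambda>y. head_beta m p0 (1 - y \<bullet> north) * ennreal (1 / norm (x - y) ^ (DIM(real ^ 'n) - 2)))"
proof -
  let ?k = "\<lambda>y. 1 / ennreal (norm (x - y) ^ (DIM(real ^ 'n) - 2))"
  have mk: "?k \<in> borel_measurable borel" by measurable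
  have "U x = ennreal C * sphere_int (\<lambda>y. head_beta m p0 (1 - y \<bullet> north) * ?k y)"
    unfolding U_def nn_integral_on_borel[OF sets_eqm mk] by (rule nn_integral_eqm[OF mk])
  also have "sphere_int (\<lambda>y. head_beta m p0 (1 - y \<bullet> north) * ?k y) =
     sphere_int (\<lambda>y. head_beta m p0 (1 - y \<bullet> north) * ennreal (1 / norm (x - y) ^ (DIM(real ^ 'n) - 2)))"
  proof (rule sphere_int_cong_except[OF x d2])
    fix y assume "y \<noteq> x"
    then have "norm (x - y) ^ (DIM(real ^ 'n) - 2) > 0" by simp
    then have "?k y = ennreal (1 / norm (x - y) ^ (DIM(real ^ 'n) - 2))"
      using divide_ennreal[of 1 "norm (x - y) ^ (DIM(real ^ 'n) - 2)"] by simp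
    then show "head_beta m p0 (1 - y \<bullet> north) * ?k y = head_beta m p0 (1 - y \<bullet> north) * ennreal (1 / norm (x - y) ^ (DIM(real ^ 'n) - 2))" by simp
  qed
  finally show ?thesis .
qed

text \<open>These are the Frostman conditions. By \<open>potential_sum\<close> the potential
  \<open>U\<close> and that of the \<open>tail_beta\<close> density add up to \<open>F\<close>, and
  the latter is at most the field, with equality on the cap. At the North Pole the field is
  infinite.\<close>

lemma U_plus_Q:
  assumes x: "norm x = 1"
  shows "F \<le> U x + Q x" and "p0 \<le> 1 - x \<bullet> north \<Longrightarrow> U x + Q x = F"
proof -
  define V where "V = ennreal C * sphere_int (\<lambda>y. tail_beta m p0 (1 - y \<bullet> north) * ennreal (1 / norm (x - y) ^ (DIM(real ^ 'n) - 2)))"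
  have UV: "U x + V = F"
    unfolding U_eq[OF x] V_def F_def distrib_left[symmetric]
    using potential_sum[OF d3 x north(1), of p0] unfolding dimn m_def[symmetric] by simp
  have Qx: "Q x = ennreal (q * (1 - x \<bullet> north) powr (- m))" if "x \<noteq> north"
    using point_charge_field_eq[OF q, of x k] inner_less_one[OF x north(1) that] by (simp add: north(2) m_def)
  have V: "V \<le> Q x" "p0 \<le> 1 - x \<bullet> north \<Longrightarrow> V = Q x" if "x \<noteq> north"
    using balayage_potential[OF d3 q p0_pos x north(1) that] Qx[OF that]
    unfolding V_def C_def dimn m_def[symmetric] by simp_all
  show "F \<le> U x + Q x"
  proof (cases "x = north")
    case True
    then show ?thesis using point_charge_field_north_pole[OF q, of k] by (simp add: north_def)
  next
    case False
    then show ?thesis unfolding UV[symmetric] using V(1) by (intro add_left_mono)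
  qed
  assume p: "p0 \<le> 1 - x \<bullet> north"
  then have "x \<noteq> north" using p0_pos north(1) by (auto simp: norm_eq_1)
  then show "U x + Q x = F" using V(2)[OF _ p] UV by simp
qed

lemma AE_M0_cap: "AE x in M0. norm x = 1 \<and> p0 \<le> 1 - x \<bullet> north"
proof -
  have "AE x in eqm. norm x = 1 \<and> p0 \<le> 1 - x \<bullet> north"
    unfolding eqm_def AE_density[OF dens_measurable_surface]
  proof (intro AE_I2 impI conjI)
    fix x :: "real ^ 'n" assume x: "x \<in> space surface_measure" and "0 < dens x"
    then have "head_beta m p0 (1 - x \<bullet> north) \<noteq> 0" by (auto simp: dens_def)
    then show "p0 \<le> 1 - x \<bullet> north" using head_beta_zero[OF _ p0_pos] by (meson not_le)
    show "norm x = 1" using space_sphere[OF x] .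
  qed
  then show ?thesis unfolding on_borel_def
    by (subst AE_distr_iff[OF ident_measurable_sphere[OF sets_eqm]]) auto
qed

lemma U_measurable [measurable]: "U \<in> borel_measurable borel"
proof -
  interpret B: prob_space M0 by (rule on_borel_prob[OF eqm_prob sets_eqm])
  have [measurable_cong]: "sets M0 = sets borel" by simp
  show ?thesis unfolding U_def[abs_def] by measurable
qed

lemma mutual_M0:
  assumes N: "prob_space N" "sets N = sets borel"
  shows "mutual_energy N M0 + (\<integral>\<^sup>+x. Q x \<partial>N) = (\<integral>\<^sup>+x. U x + Q x \<partial>N)"
proof -
  have [measurable_cong]: "sets N = sets borel" by (rule N(2))
  have "mutual_energy N M0 = (\<integral>\<^sup>+x. U x \<partial>N)" by (simp add: mutual_energy_def U_def)
  then show ?thesis by (subst nn_integral_add) simp_all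
qed

lemma F_le:
  assumes N: "prob_space N" "sets N = sets borel" "AE x in N. norm x = 1"
  shows "F \<le> mutual_energy N M0 + (\<integral>\<^sup>+x. Q x \<partial>N)"
proof -
  have "F = (\<integral>\<^sup>+x. F \<partial>N)" using prob_space.emeasure_space_1[OF N(1)] by simp
  also have "\<dots> \<le> (\<integral>\<^sup>+x. U x + Q x \<partial>N)"
    using U_plus_Q(1) by (intro nn_integral_mono_AE eventually_mono[OF N(3)]) auto
  finally show ?thesis unfolding mutual_M0[OF N(1,2)] .
qed

lemma F_eq: "mutual_energy M0 M0 + (\<integral>\<^sup>+x. Q x \<partial>M0) = F"
proof -
  have P: "prob_space M0" by (rule on_borel_prob[OF eqm_prob sets_eqm])
  have "(\<integral>\<^sup>+x. U x + Q x \<partial>M0) = (\<integral>\<^sup>+x. F \<partial>M0)"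
    using U_plus_Q(2) by (intro nn_integral_cong_AE eventually_mono[OF AE_M0_cap]) auto
  also have "\<dots> = F" using prob_space.emeasure_space_1[OF P] by simp
  finally show ?thesis unfolding mutual_M0[OF P sets_on_borel] .
qed

lemma weighted_energy_eq:
  assumes "\<mu> \<in> unit_sphere_measures"
  shows "weighted_energy Q \<mu> = mutual_energy (on_borel \<mu>) (on_borel \<mu>) + 2 * (\<integral>\<^sup>+x. Q x \<partial>on_borel \<mu>)"
  using assms unfolding weighted_energy_def unit_sphere_measures_def
  by (simp add: riesz_energy_on_borel nn_integral_on_borel)

text \<open>Integrating the Frostman conditions and using positive definiteness gives 2 I0 + 2 q0 =
  2 F \<le> 2 X + 2 qN \<le> I0 + IN + 2 qN, in the abbreviations of the proof; cancelling the
  finite I0 compares the weighted energies. If these are equal, then IN + I0 \<le> 2 X, and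
  \<open>sphere_measure_eqI\<close> identifies the measures.\<close>

lemma energy_comparison:
  assumes \<nu>: "\<nu> \<in> unit_sphere_measures"
  shows "weighted_energy Q eqm \<le> weighted_energy Q \<nu>"
    and "weighted_energy Q \<nu> = weighted_energy Q eqm \<Longrightarrow> \<nu> = eqm"
proof -
  let ?N = "on_borel \<nu>"
  have \<nu>': "prob_space \<nu>" "sets \<nu> = sets sphere_borel" using \<nu> by (auto simp: unit_sphere_measures_def)
  have N: "prob_space ?N" "sets ?N = sets borel" "AE x in ?N. norm x = 1"
    using on_borel_prob[OF \<nu>'] AE_on_borel_sphere[OF \<nu>'(2)] by auto
  have P: "prob_space M0" by (rule on_borel_prob[OF eqm_prob sets_eqm])
  interpret two_probs ?N M0 using N P by (simp add: two_probs_def two_probs_axioms_def)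
  define IN I0 X qN q0 where "IN = mutual_energy ?N ?N" and "I0 = mutual_energy M0 M0"
    and "X = mutual_energy ?N M0" and "qN = (\<integral>\<^sup>+x. Q x \<partial>?N)" and "q0 = (\<integral>\<^sup>+x. Q x \<partial>M0)"
  have f1: "I0 + q0 = F" using F_eq by (simp add: I0_def q0_def)
  have f2: "F \<le> X + qN" using F_le[OF N] by (simp add: X_def qN_def)
  have f3: "2 * X \<le> IN + I0" using mutual_energy_le[OF d3] by (simp add: X_def IN_def I0_def)
  \<comment> \<open>Both are summands of the finite constant \<open>F\<close>; the cancellations
    below depend on this.\<close>
  have I0: "I0 < \<infinity>" and q0: "q0 < \<infinity>" using F_finite unfolding f1[symmetric] by auto
  have W0: "weighted_energy Q eqm = I0 + 2 * q0" unfolding weighted_energy_eq[OF eqm_unit] I0_def q0_def ..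
  have WN: "weighted_energy Q \<nu> = IN + 2 * qN" unfolding weighted_energy_eq[OF \<nu>] IN_def qN_def ..
  have "I0 + (I0 + 2 * q0) = 2 * F" unfolding f1[symmetric] by (simp add: mult_2 add_ac)
  also have "\<dots> \<le> 2 * (X + qN)" using f2 by (rule mult_left_mono) simp
  also have "\<dots> = 2 * X + 2 * qN" by (rule distrib_left)
  finally have c1: "I0 + (I0 + 2 * q0) \<le> 2 * X + 2 * qN" .
  also have "\<dots> \<le> I0 + (IN + 2 * qN)" using add_right_mono[OF f3, of "2 * qN"] by (simp add: add_ac)
  finally have "I0 + 2 * q0 \<le> IN + 2 * qN" using I0 by (auto simp: ennreal_add_left_cancel_le)
  then show "weighted_energy Q eqm \<le> weighted_energy Q \<nu>" unfolding W0 WN .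
  assume "weighted_energy Q \<nu> = weighted_energy Q eqm"
  then have e: "IN + 2 * qN = I0 + 2 * q0" unfolding W0 WN .
  have fin: "IN + 2 * qN < \<infinity>" unfolding e using I0 q0 by (simp add: ennreal_mult_less_top)
  then have IN: "IN < \<infinity>" and qN: "2 * qN < \<infinity>" by auto
  have "2 * qN + (IN + I0) \<le> 2 * qN + 2 * X" using c1 unfolding e[symmetric] by (simp add: add_ac)
  then have "IN + I0 \<le> 2 * X" using qN by (auto simp: ennreal_add_left_cancel_le)
  then have "?N = M0"
    using IN I0 N(3) AE_on_borel_sphere[OF sets_eqm] unfolding IN_def I0_def X_def
    by (intro sphere_measure_eqI[OF d3]) auto
  then show "\<nu> = eqm" by (rule on_borel_inject[OF \<nu>'(2) sets_eqm])
qed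

lemma extremal_iff: "is_extremal_measure Q \<mu> \<longleftrightarrow> \<mu> = eqm"
proof -
  have min: "minimal_energy Q = weighted_energy Q eqm"
    unfolding minimal_energy_def
    by (intro antisym INF_lower eqm_unit INF_greatest energy_comparison(1))
  show ?thesis unfolding is_extremal_measure_def min using eqm_unit energy_comparison(2) by blast
qed

text \<open>Strictly inside the cap the density is positive, and the cone over an open piece of the
  sphere contains a nonempty open set, which has positive volume.\<close>

lemma eqm_open_pos:
  assumes W: "open W" and x: "x \<in> W" "norm x = 1" "x $ k < cos \<alpha>"
  shows "emeasure eqm (W \<inter> space eqm) > 0"
proof -
  define W' where "W' = W \<inter> {y. y $ k < cos \<alpha>}"
  have W': "open W'" unfolding W'_def using W by (intro open_Int open_Collect_less continuous_intros)
  have [measurable]: "W' \<in> sets borel" using W' by simp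
  have sp: "space eqm = sphere 0 1" by (simp add: eqm_def space_surface_measure)
  have Ws: "W \<inter> space eqm \<in> sets eqm" "W' \<inter> space eqm \<in> sets eqm"
    unfolding sets_eqm sphere_borel_def sp using W W' by (auto simp: sets_restrict_space intro!: image_eqI)
  have "emeasure eqm (W' \<inter> space eqm) = (\<integral>\<^sup>+y. indicator (W' \<inter> space eqm) y \<partial>eqm)"
    using Ws by (intro nn_integral_indicator[symmetric])
  also have "\<dots> = (\<integral>\<^sup>+y. indicator W' y \<partial>eqm)" by (intro nn_integral_cong) (auto simp: indicator_def)
  also have "\<dots> = ennreal C * sphere_int (\<lambda>y. head_beta m p0 (1 - y \<bullet> north) * indicator W' y)"
    by (rule nn_integral_eqm) measurable
  finally have e: "emeasure eqm (W' \<inter> space eqm) = ennreal C * sphere_int (\<lambda>y. head_beta m p0 (1 - y \<bullet> north) * indicator W' y)" .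
  have "sphere_int (\<lambda>y. head_beta m p0 (1 - y \<bullet> north) * indicator W' y) \<noteq> 0"
  proof
    assume "sphere_int (\<lambda>y. head_beta m p0 (1 - y \<bullet> north) * indicator W' y) = 0"
    then have "(\<integral>\<^sup>+z. head_beta m p0 (1 - sgn z \<bullet> north) * indicator W' (sgn z) * indicator {z. norm z \<le> 1} z \<partial>lborel) = 0"
      using d by (simp add: sphere_int_def)
    then have AE: "AE z in lborel. head_beta m p0 (1 - sgn z \<bullet> north) * indicator W' (sgn z) * indicator {z. norm z \<le> 1} z = 0"
      by (subst (asm) nn_integral_0_iff_AE) auto
    define Z where "Z = {z :: real ^ 'n. z \<noteq> 0 \<and> norm z < 1 \<and> sgn z \<in> W'}"
    have "open Z"
    proof -
      have "Z = (- {0} \<inter> sgn -` W') \<inter> ball 0 1" by (auto simp: Z_def)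
      moreover have "open (- {0::real ^ 'n} \<inter> sgn -` W')"
        using W' by (intro continuous_open_preimage) (auto intro!: continuous_on_sgn continuous_intros)
      ultimately show ?thesis by auto
    qed
    moreover have "(1/2) *\<^sub>R x \<in> Z"
    proof -
      have "sgn ((1/2) *\<^sub>R x) = x" using x by (simp add: sgn_scaleR sgn_div_norm)
      then show ?thesis using x by (auto simp: Z_def W'_def)
    qed
    ultimately have "\<not> negligible Z" using open_not_negligible by blast
    moreover have "AE z in lborel. z \<notin> Z"
    proof (rule eventually_mono[OF AE])
      fix z assume 0: "head_beta m p0 (1 - sgn z \<bullet> north) * indicator W' (sgn z) * indicator {z. norm z \<le> 1} z = 0"
      show "z \<notin> Z"
      proof
        assume z: "z \<in> Z"
        then have "sgn z $ k < cos \<alpha>" by (simp add: Z_def W'_def)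
        then have "head_beta m p0 (1 - sgn z \<bullet> north) > 0"
          by (intro head_beta_pos p0_pos) (simp add: north(2) p0_def)
        then show False using 0 z by (auto simp: Z_def)
      qed
    qed
    ultimately show False
      using \<open>open Z\<close> by (simp add: negligible_iff_null_sets AE_completion AE_iff_null_sets)
  qed
  then have "emeasure eqm (W' \<inter> space eqm) > 0"
    unfolding e using C_pos by (simp add: zero_less_iff_neq_zero ennreal_eq_0_iff)
  also have "emeasure eqm (W' \<inter> space eqm) \<le> emeasure eqm (W \<inter> space eqm)"
    using Ws by (intro emeasure_mono) (auto simp: W'_def)
  finally show ?thesis .
qed

text \<open>Off the closed cap the density vanishes on an open neighbourhood. Points strictly inside
  are settled by \<open>eqm_open_pos\<close>, and every boundary point is a limit of such points
  along its meridian.\<close>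

lemma support_eqm: "measure_support eqm = south_cap k \<alpha>"
proof (intro subset_antisym subsetI)
  have sp: "space eqm = sphere 0 1" by (simp add: eqm_def space_surface_measure)
  fix x assume x: "x \<in> measure_support eqm"
  then have x1: "norm x = 1" by (simp add: measure_support_def sp)
  show "x \<in> south_cap k \<alpha>"
  proof (rule ccontr)
    assume "x \<notin> south_cap k \<alpha>"
    then have gt: "x $ k > cos \<alpha>" using x1 cap_iff[OF x1] polar(3)[OF x1] by (auto simp: south_cap_def)
    define W where "W = {y :: real ^ 'n. y $ k > cos \<alpha>}"
    have W: "open W" "x \<in> W" unfolding W_def using gt by (auto intro!: open_Collect_less continuous_intros)
    have [measurable]: "W \<in> sets borel" using W by simp
    have Ws: "W \<inter> space eqm \<in> sets eqm"
      unfolding sets_eqm sphere_borel_def sp using W by (auto simp: sets_restrict_space intro!: image_eqI)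
    have "emeasure eqm (W \<inter> space eqm) = (\<integral>\<^sup>+y. indicator (W \<inter> space eqm) y \<partial>eqm)"
      using Ws by (intro nn_integral_indicator[symmetric])
    also have "\<dots> = (\<integral>\<^sup>+y. indicator W y \<partial>eqm)" by (intro nn_integral_cong) (auto simp: indicator_def)
    also have "\<dots> = ennreal C * sphere_int (\<lambda>y. head_beta m p0 (1 - y \<bullet> north) * indicator W y)"
      by (rule nn_integral_eqm) measurable
    also have "(\<lambda>y. head_beta m p0 (1 - y \<bullet> north) * indicator W y) = (\<lambda>_. 0)"
      using head_beta_zero[OF _ p0_pos] by (auto simp: fun_eq_iff indicator_def W_def north(2) p0_def)
    finally have "emeasure eqm (W \<inter> space eqm) = 0" by (simp add: sphere_int_def)
    then show False using x W by (auto simp: measure_support_def)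
  qed
next
  have sp: "space eqm = sphere 0 1" by (simp add: eqm_def space_surface_measure)
  fix x assume "x \<in> south_cap k \<alpha>"
  then have x1: "norm x = 1" and le: "x $ k \<le> cos \<alpha>" using cap_iff by (auto simp: south_cap_def)
  have "emeasure eqm (W \<inter> space eqm) > 0" if W: "open W" "x \<in> W" for W
  proof (cases "x $ k < cos \<alpha>")
    case True
    then show ?thesis using eqm_open_pos[OF W(1) W(2) x1] by simp
  next
    case False
    then have xk: "x $ k = cos \<alpha>" using le by simp
    have sa: "sin \<alpha> > 0" using \<alpha> by (intro sin_gt_zero) auto
    \<comment> \<open>With this unit vector orthogonal to \<open>north\<close>, x = cos \<alpha>
      north + sin \<alpha> u. The great circle \<open>c\<close> below passes through x at parameter
      \<alpha>, and a larger parameter moves south into the open cap.\<close>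
    define u where "u = (1 / sin \<alpha>) *\<^sub>R (x - cos \<alpha> *\<^sub>R north)"
    have xn: "x \<bullet> north = cos \<alpha>" by (simp add: north(2) xk)
    have nn: "north \<bullet> north = 1" "x \<bullet> x = 1" using north(1) x1 by (simp_all add: norm_eq_1)
    have un: "u \<bullet> north = 0" by (simp add: u_def inner_diff_left xn nn)
    have "(x - cos \<alpha> *\<^sub>R north) \<bullet> (x - cos \<alpha> *\<^sub>R north) = 1 - (cos \<alpha>)\<^sup>2"
      by (simp add: inner_diff_left inner_diff_right xn nn inner_commute[of north x] power2_eq_square)
    then have "(x - cos \<alpha> *\<^sub>R north) \<bullet> (x - cos \<alpha> *\<^sub>R north) = sin \<alpha> * sin \<alpha>"
      unfolding sin_squared_eq[symmetric] by (simp only: power2_eq_square)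
    then have uu: "u \<bullet> u = 1" using sa by (simp add: u_def)
    define c where "c t = cos t *\<^sub>R north + sin t *\<^sub>R u" for t
    have c1: "norm (c t) = 1" for t
    proof -
      have "c t \<bullet> c t = (cos t)\<^sup>2 + (sin t)\<^sup>2"
        by (simp add: c_def inner_add_left inner_add_right nn un uu inner_commute[of north u] power2_eq_square)
      then show ?thesis by (simp add: norm_eq_1)
    qed
    have ck: "c t $ k = cos t" for t
      using un nn by (simp add: c_def inner_add_left flip: north(2))
    have c\<alpha>: "c \<alpha> = x" using sa by (simp add: c_def u_def)
    have "isCont c \<alpha>" unfolding c_def by (intro continuous_intros)
    then have "eventually (\<lambda>t. c t \<in> W) (at \<alpha>)"
      using W c\<alpha> by (auto simp: continuous_at dest: topological_tendstoD)
    then obtain e where e: "e > 0" "\<And>t. t \<noteq> \<alpha> \<Longrightarrow> dist t \<alpha> < e \<Longrightarrow> c t \<in> W"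
      unfolding eventually_at by blast
    \<comment> \<open>Halving each bound keeps the parameter \<alpha> + h strictly below pi and
      strictly within distance e of \<alpha>.\<close>
    define h where "h = min (e / 2) ((pi - \<alpha>) / 2)"
    have h: "0 < h" "h \<le> e / 2" "h \<le> (pi - \<alpha>) / 2" unfolding h_def using e(1) \<alpha> by (simp_all only: min.cobounded1 min.cobounded2 min_less_iff_conj half_gt_zero_iff diff_gt_0_iff_gt)
    define t where "t = \<alpha> + h"
    have t: "\<alpha> < t" "t < pi" "dist t \<alpha> < e" using h e(1) \<alpha> by (auto simp: t_def dist_real_def)
    have "cos t < cos \<alpha>" using t \<alpha> by (intro cos_monotone_0_pi) auto
    moreover have "c t \<in> W" by (rule e(2)) (use t in auto)
    ultimately show ?thesis using eqm_open_pos[OF W(1) _ c1] ck by simp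
  qed
  then show "x \<in> measure_support eqm" using x1 by (simp add: measure_support_def sp)
qed

end

theorem theorem2p5:
  fixes k :: "'n::finite" and d :: nat and q :: real
    and Q :: "real ^ 'n \<Rightarrow> ennreal"
  assumes "CARD('n) = d" and "d \<ge> 3" and "q > 0"
    and "Q = point_charge_field k q"
  shows "(\<exists>!\<mu>. is_extremal_measure Q \<mu>) \<and>
    (\<exists>\<alpha>\<^sub>0. 0 < \<alpha>\<^sub>0 \<and> \<alpha>\<^sub>0 < pi \<and> angle_equation d q \<alpha>\<^sub>0 \<and>
      (\<forall>\<alpha>. 0 < \<alpha> \<and> \<alpha> < pi \<and> angle_equation d q \<alpha> \<longrightarrow> \<alpha> = \<alpha>\<^sub>0) \<and>
      measure_support (extremal_measure Q) = south_cap k \<alpha>\<^sub>0 \<and>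
      has_real_density (extremal_measure Q) surface_measure
        (\<lambda>x. if \<alpha>\<^sub>0 \<le> polar_angle k x then density_formula d q \<alpha>\<^sub>0 (polar_angle k x) else 0))"
proof (rule angle_equation_unique_solution[OF assms(2,3)])
  fix \<alpha>
  assume solution: "0 < \<alpha>" "\<alpha> < pi" "angle_equation d q \<alpha>"
    and unique: "\<And>\<beta>. 0 < \<beta> \<Longrightarrow> \<beta> < pi \<Longrightarrow> angle_equation d q \<beta> \<Longrightarrow> \<beta> = \<alpha>"
  interpret cap_problem k q \<alpha>
    using assms(1-3) solution by unfold_locales simp_all
  have extremal: "is_extremal_measure Q \<mu> \<longleftrightarrow> \<mu> = eqm" for \<mu>
    unfolding assms(4) by (rule extremal_iff)
  have eqm: "extremal_measure Q = eqm"
    unfolding extremal_measure_def using extremal by (intro the_equality) simp_all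
  have "has_real_density eqm surface_measure
      (\<lambda>x. if \<alpha> \<le> polar_angle k x then density_formula d q \<alpha> (polar_angle k x) else 0)"
    using eqm_density unfolding dens_real_def[abs_def] assms(1) .
  moreover have "\<exists>!\<mu>. is_extremal_measure Q \<mu>" unfolding extremal by simp
  moreover have "\<forall>\<beta>. 0 < \<beta> \<and> \<beta> < pi \<and> angle_equation d q \<beta> \<longrightarrow> \<beta> = \<alpha>"
    using unique by blast
  ultimately show ?thesis
    unfolding eqm using solution support_eqm by (intro conjI exI[of _ \<alpha>])
qed

end
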